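(* Consider the batch arrival scenario with growing batch size $\ell(N)\to\infty$ and $\lambda(N)/N\to\lambda<1$ as $N\to\infty$. Let $\varepsilon>0$ be any fixed number with $\lambda+\varepsilon<1$, and consider the JSQ$(d(N))$ scheme (adapted to batch arrivals) with $d(N)\ge \ell(N)/(1-\lambda-\varepsilon)$. If $q_1^{d(N)}(0)\to q_1^\infty$ in probability with $q_1^\infty\le\lambda$, and $q_i^{d(N)}(0)\to 0$ in probability for all $i\ge2$, then the sequence of processes $\{\mathbf{q}^{d(N)}(t)\}_{t\ge0}$ converges weakly to the limit $\{\mathbf{q}(t)\}_{t\ge0}$ given by $$q_1(t)=\lambda+(q_1^\infty-\lambda)e^{-t},\qquad q_i(t)\equiv 0\ \text{ for all } i=2,\dots,b.$$
   Context: Model: the $N$-th system has $N$ parallel identical single-server queues and one dispatcher; tasks have independent unit-mean exponential service requirements. Each server has buffer capacity $b$ ($1\le b\le\infty$, including the task in service); a task assigned to a server with $b$ pending tasks is permanently discarded. Batch arrivals: batches of fixed size $\ell(N)>0$ arrive as a Poisson process of rate $\lambda(N)/\ell(N)$, so that the total task arrival rate is $\lambda(N)$. JSQ$(d(N))$ scheme for batch arrivals: when a batch of size $\ell(N)$ arrives, the dispatcher samples $d(N)$ servers, $\ell(N)\le d(N)\le N$, uniformly at random without replacement, and assigns the $\ell(N)$ tasks to the $\ell(N)$ servers with the smallest queue lengths among the sampled servers (one task each). $Q_i^{d(N)}(t)$ is the number of servers with queue length at least $i$ (including the task in service) at time $t$, $i=1,\dots,b$, and $\mathbf{q}^{d(N)}(t)=(q_i^{d(N)}(t))_{1\le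 i\le b}$ with $q_i^{d(N)}(t)=Q_i^{d(N)}(t)/N$; it takes values in $\mathcal{S}=\{\mathbf{q}\in[0,1]^b: q_i\le q_{i-1}\text{ for } i=2,\dots,b,\ \sum_{i=1}^b q_i<\infty\}$, equipped with the $\ell_1$ topology. Weak convergence of c\`adl\`ag processes is with respect to the Skorohod $J_1$ topology.
   Formalization: Two necessary assumptions are added: if λ>0, then ℓ(N)/N→0 (otherwise macroscopic batch jumps persist); and if b=∞, then the sum of q_i(0) over i≥2 tends to 0 in probability (otherwise ℓ1 convergence fails at time 0). *)

theory Defs
  imports "HOL-Probability.Probability" "HOL-Library.Extended_Nat"
begin

section \<open>The occupancy space with its \<open>\<ell>\<^sub>1\<close> metric\<close>

definition levels :: "enat \<Rightarrow> nat set" where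
  "levels b = {i. 1 \<le> i \<and> enat i \<le> b}"

text \<open>Vectors indexed by \<open>levels b\<close> are functions on \<open>nat\<close> that vanish at all other indices.\<close>

definition occupancy_space :: "enat \<Rightarrow> (nat \<Rightarrow> real) set" where
  "occupancy_space b = {q. (\<forall>i\<in>levels b. 0 \<le> q i \<and> q i \<le> 1) \<and>
     (\<forall>i\<in>levels b. 2 \<le> i \<longrightarrow> q i \<le> q (i - 1)) \<and>
     q summable_on levels b \<and> (\<forall>i. i \<notin> levels b \<longrightarrow> q i = 0)}"

definition l1_dist :: "enat \<Rightarrow> (nat \<Rightarrow> real) \<Rightarrow> (nat \<Rightarrow> real) \<Rightarrow> real" where
  "l1_dist b x y = (\<Sum>\<^sub>\<infinity>i\<in>levels b. \<bar>x i - y i\<bar>)"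

definition occupancy_metric :: "enat \<Rightarrow> (nat \<Rightarrow> real) metric" where
  "occupancy_metric b = metric (occupancy_space b, l1_dist b)"

lemma l1_summable:
  assumes "x \<in> occupancy_space b" "y \<in> occupancy_space b"
  shows "(\<lambda>i. \<bar>x i - y i\<bar>) summable_on levels b"
proof (rule summable_on_comparison_test)
  show "(\<lambda>i. x i + y i) summable_on levels b"
    using assms by (intro summable_on_add) (auto simp: occupancy_space_def)
  fix i assume "i \<in> levels b"
  then have "0 \<le> x i" "0 \<le> y i" using assms by (auto simp: occupancy_space_def)
  then show "\<bar>x i - y i\<bar> \<le> x i + y i" by linarith
qed auto

lemma Metric_space_occupancy: "Metric_space (occupancy_space b) (l1_dist b)"
proof
  fix x y show "0 \<le> l1_dist b x y" by (auto simp: l1_dist_def intro: infsum_nonneg)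
next
  fix x y show "l1_dist b x y = l1_dist b y x" by (simp add: l1_dist_def abs_minus_commute)
next
  fix x y assume xy: "x \<in> occupancy_space b" "y \<in> occupancy_space b"
  show "l1_dist b x y = 0 \<longleftrightarrow> x = y"
  proof
    assume 0: "l1_dist b x y = 0"
    have "x i = y i" for i
    proof (cases "i \<in> levels b")
      case True
      have "\<bar>x i - y i\<bar> = 0"
        by (rule nonneg_infsum_le_0D[OF _ l1_summable[OF xy] _ True])
          (use 0 in \<open>auto simp: l1_dist_def\<close>)
      then show ?thesis by simp
    qed (use xy in \<open>auto simp: occupancy_space_def\<close>)
    then show "x = y" by auto
  qed (simp add: l1_dist_def)
next
  fix x y z
  assume xyz: "x \<in> occupancy_space b" "y \<in> occupancy_space b" "z \<in> occupancy_space b"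
  have "l1_dist b x z \<le> (\<Sum>\<^sub>\<infinity>i\<in>levels b. \<bar>x i - y i\<bar> + \<bar>y i - z i\<bar>)"
    unfolding l1_dist_def using xyz by (intro infsum_mono l1_summable summable_on_add) auto
  also have "\<dots> = l1_dist b x y + l1_dist b y z"
    unfolding l1_dist_def using xyz by (intro infsum_add l1_summable)
  finally show "l1_dist b x z \<le> l1_dist b x y + l1_dist b y z" .
qed

lemma mspace_occupancy [simp]: "mspace (occupancy_metric b) = occupancy_space b"
  and mdist_occupancy [simp]: "mdist (occupancy_metric b) = l1_dist b"
  by (simp_all add: occupancy_metric_def Metric_space.mspace_metric
      Metric_space.mdist_metric Metric_space_occupancy)

section \<open>Skorohod space and weak convergence\<close>

definition cadlag_paths :: "'s metric \<Rightarrow> (real \<Rightarrow> 's) set" where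
  "cadlag_paths m = {x \<in> {0..} \<rightarrow>\<^sub>E mspace m.
     (\<forall>t\<ge>0. limitin (mtopology_of m) x (x t) (at_right t)) \<and>
     (\<forall>t>0. \<exists>l. limitin (mtopology_of m) x l (at_left t))}"

definition time_changes :: "(real \<Rightarrow> real) set" where
  "time_changes = {h. strict_mono_on {0..} h \<and> h ` {0..} = {0..}}"

definition J1_ball :: "'s metric \<Rightarrow> (real \<Rightarrow> 's) \<Rightarrow> real \<Rightarrow> real \<Rightarrow> (real \<Rightarrow> 's) set" where
  "J1_ball m x T e = {y \<in> cadlag_paths m. \<exists>h\<in>time_changes.
     \<forall>t\<in>{0..T}. \<bar>h t - t\<bar> < e \<and> mdist m (y t) (x (h t)) < e}"

text \<open>
  A sequence of paths \<open>x\<^sub>n\<close> converges to \<open>x\<close> in the Skorohod topology on \<open>[0, \<infinity>)\<close> iff for every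
  \<open>T\<close> there are time changes \<open>h\<^sub>n\<close> with \<open>h\<^sub>n t - t\<close> and the distance of \<open>x\<^sub>n t\<close> and \<open>x (h\<^sub>n t)\<close>
  tending to 0 uniformly on \<open>[0, T]\<close> (Ethier and Kurtz, Markov Processes, Prop. 3.5.3(c)), i.e.
  iff \<open>x\<^sub>n\<close> is eventually in each \<open>J1_ball m x T e\<close>. As that topology is metrizable, its open sets
  are those that contain a \<open>J1_ball\<close> around each of their points. Note that \<open>T\<close> bounds only the
  time argument of \<open>y\<close>, so that a jump of \<open>x\<close> at time \<open>T\<close> itself does no harm.
\<close>

definition J1_topology :: "'s metric \<Rightarrow> (real \<Rightarrow> 's) topology" where
  "J1_topology m = topology (\<lambda>U. U \<subseteq> cadlag_paths m \<and>
     (\<forall>x\<in>U. \<exists>T>0. \<exists>e>0. J1_ball m x T e \<subseteq> U))"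

lemma J1_ball_mono: "T \<le> T' \<Longrightarrow> e' \<le> e \<Longrightarrow> J1_ball m x T' e' \<subseteq> J1_ball m x T e"
proof
  fix y assume le: "T \<le> T'" "e' \<le> e" and "y \<in> J1_ball m x T' e'"
  then obtain h where y: "y \<in> cadlag_paths m" and h: "h \<in> time_changes"
    "\<forall>t\<in>{0..T'}. \<bar>h t - t\<bar> < e' \<and> mdist m (y t) (x (h t)) < e'"
    unfolding J1_ball_def by blast
  have "\<forall>t\<in>{0..T}. \<bar>h t - t\<bar> < e \<and> mdist m (y t) (x (h t)) < e"
    using h(2) le by (meson atLeastAtMost_iff less_le_trans order_trans)
  with y h(1) show "y \<in> J1_ball m x T e" unfolding J1_ball_def by blast
qed

lemma openin_J1_topology:
  "openin (J1_topology m) U \<longleftrightarrow>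
     U \<subseteq> cadlag_paths m \<and> (\<forall>x\<in>U. \<exists>T>0. \<exists>e>0. J1_ball m x T e \<subseteq> U)"
proof -
  define P where "P = (\<lambda>U. U \<subseteq> cadlag_paths m \<and> (\<forall>x\<in>U. \<exists>T>0. \<exists>e>0. J1_ball m x T e \<subseteq> U))"
  have "P (U \<inter> V)" if U: "P U" and V: "P V" for U V
    unfolding P_def
  proof (intro conjI ballI)
    fix x assume x: "x \<in> U \<inter> V"
    obtain T e where 1: "T > 0" "e > 0" "J1_ball m x T e \<subseteq> U"
      using U x unfolding P_def by blast
    obtain T' e' where 2: "T' > 0" "e' > 0" "J1_ball m x T' e' \<subseteq> V"
      using V x unfolding P_def by blast
    have "J1_ball m x (max T T') (min e e') \<subseteq> U \<inter> V"
      using 1(3) 2(3) J1_ball_mono[of T "max T T'" "min e e'" e m x]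
        J1_ball_mono[of T' "max T T'" "min e e'" e' m x] by auto
    then show "\<exists>T>0. \<exists>e>0. J1_ball m x T e \<subseteq> U \<inter> V"
      using 1 2 by (metis less_max_iff_disj min_less_iff_conj)
  qed (use U in \<open>auto simp: P_def\<close>)
  moreover have "P (\<Union>K)" if "\<forall>U\<in>K. P U" for K
    unfolding P_def
  proof (intro conjI ballI)
    fix x assume "x \<in> \<Union>K"
    then obtain U where "U \<in> K" "x \<in> U" by blast
    with that show "\<exists>T>0. \<exists>e>0. J1_ball m x T e \<subseteq> \<Union>K"
      unfolding P_def by (meson Union_upper order_trans)
  qed (use that in \<open>auto simp: P_def\<close>)
  ultimately have "istopology P" unfolding istopology_def by blast
  then show ?thesis
    unfolding J1_topology_def P_def by (simp add: topology_inverse')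
qed

lemma topspace_J1_topology [simp]: "topspace (J1_topology m) = cadlag_paths m"
proof
  have "\<exists>T>0. \<exists>e>0. J1_ball m x T e \<subseteq> cadlag_paths m" for x
    by (rule exI[of _ 1], simp, rule exI[of _ 1]) (auto simp: J1_ball_def)
  then have "openin (J1_topology m) (cadlag_paths m)"
    unfolding openin_J1_topology by blast
  then show "cadlag_paths m \<subseteq> topspace (J1_topology m)" by (rule openin_subset)
  show "topspace (J1_topology m) \<subseteq> cadlag_paths m"
    using openin_topspace[of "J1_topology m"] unfolding openin_J1_topology by blast
qed

definition borel_of :: "'x topology \<Rightarrow> 'x measure" where
  "borel_of T = sigma (topspace T) {U. openin T U}"

definition weakly_converges :: "'x topology \<Rightarrow> (nat \<Rightarrow> 'x measure) \<Rightarrow> 'x measure \<Rightarrow> bool" where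
  "weakly_converges T \<mu> \<nu> \<longleftrightarrow>
     (\<forall>f. continuous_map T euclideanreal f \<and> bounded (f ` topspace T) \<longrightarrow>
        (\<lambda>n. \<integral>x. f x \<partial>\<mu> n) \<longlonglongrightarrow> (\<integral>x. f x \<partial>\<nu>))"

text \<open>
  Weak convergence of random elements \<open>X n\<close> of the topological space \<open>T\<close>, each on its own
  probability space \<open>M n\<close>, to a random element with law \<open>\<nu>\<close>. Only \<open>n \<ge> 1\<close> matters.
\<close>

definition converges_in_law ::
  "'x topology \<Rightarrow> (nat \<Rightarrow> 'a measure) \<Rightarrow> (nat \<Rightarrow> 'a \<Rightarrow> 'x) \<Rightarrow> 'x measure \<Rightarrow> bool" where
  "converges_in_law T M X \<nu> \<longleftrightarrow>
     (\<forall>n\<ge>1. X n \<in> M n \<rightarrow>\<^sub>M borel_of T) \<and> prob_space \<nu> \<and> sets \<nu> = sets (borel_of T) \<and>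
     weakly_converges T (\<lambda>n. distr (M n) (borel_of T) (X n)) \<nu>"

definition converges_in_prob ::
  "(nat \<Rightarrow> 'a measure) \<Rightarrow> (nat \<Rightarrow> 'a \<Rightarrow> real) \<Rightarrow> real \<Rightarrow> bool" where
  "converges_in_prob M Y c \<longleftrightarrow>
     (\<forall>e>0. (\<lambda>n. measure (M n) {\<omega> \<in> space (M n). \<bar>Y n \<omega> - c\<bar> > e}) \<longlonglongrightarrow> 0)"

section \<open>The queueing system\<close>

text \<open>
  Servers are \<open>0, \<dots>, N - 1\<close>. The random primitives of one system are:
  \<^item> \<open>init\<close>: the list of the initial queue lengths;
  \<^item> \<open>gap k\<close>: the time between the arrivals of the batches \<open>k - 1\<close> and \<open>k\<close> (for \<open>k = 0\<close>: the
    time of the first arrival);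
  \<^item> \<open>sample k\<close>: the servers sampled for batch \<open>k\<close>, in the order in which they are drawn;
  \<^item> \<open>svc0 n j\<close>: the service requirement of the \<open>j\<close>-th task initially at server \<open>n\<close>; for \<open>j = 0\<close>,
    the task then in service, this is its remaining requirement;
  \<^item> \<open>svc k j\<close>: the service requirement of the \<open>j\<close>-th task of batch \<open>k\<close>.
\<close>

record 'a primitives =
  init :: "'a \<Rightarrow> nat list"
  gap :: "nat \<Rightarrow> 'a \<Rightarrow> real"
  sample :: "nat \<Rightarrow> 'a \<Rightarrow> nat list"
  svc0 :: "nat \<Rightarrow> nat \<Rightarrow> 'a \<Rightarrow> real"
  svc :: "nat \<Rightarrow> nat \<Rightarrow> 'a \<Rightarrow> real"

definition epoch :: "'a primitives \<Rightarrow> nat \<Rightarrow> 'a \<Rightarrow> real" where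
  "epoch P k \<omega> = (\<Sum>j\<le>k. gap P j \<omega>)"

text \<open>
  A ledger records for each server the departure times of all tasks it has accepted so far, in
  order of arrival. A task departing at \<open>c\<close> is pending at all times \<open>t < c\<close> from its arrival on.
\<close>

type_synonym ledger = "nat \<Rightarrow> real list"

definition pending :: "ledger \<Rightarrow> real \<Rightarrow> nat \<Rightarrow> nat" where
  "pending L t n = length (filter (\<lambda>c. t < c) (L n))"

text \<open>
  The dispatcher: among the sampled servers the \<open>l\<close> with the smallest queue lengths are chosen.
  Sorting is stable, so ties are resolved by the (uniformly random) order of sampling.
\<close>

definition jsq_choice :: "nat \<Rightarrow> (nat \<Rightarrow> nat) \<Rightarrow> nat list \<Rightarrow> nat list" where
  "jsq_choice l x ns = take l (sort_key x ns)"

text \<open>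
  A task with requirement \<open>s\<close> assigned to server \<open>n\<close> at time \<open>t\<close>: it is discarded if \<open>b\<close> tasks are
  pending; otherwise its service (first come, first served) starts at \<open>t\<close> or at the last departure
  among the earlier tasks, whichever is later.
\<close>

definition assign :: "enat \<Rightarrow> real \<Rightarrow> nat \<times> real \<Rightarrow> ledger \<Rightarrow> ledger" where
  "assign b t = (\<lambda>(n, s) L. if enat (pending L t n) < b
     then L(n := L n @ [Max (insert t (set (L n))) + s]) else L)"

text \<open>\<open>ledger_at b l P k \<omega>\<close> is the ledger just before the arrival of batch \<open>k\<close>.\<close>

primrec ledger_at :: "enat \<Rightarrow> nat \<Rightarrow> 'a primitives \<Rightarrow> nat \<Rightarrow> 'a \<Rightarrow> ledger" where
  "ledger_at b l P 0 \<omega> = (\<lambda>n. if n < length (init P \<omega>)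
     then map (\<lambda>j. \<Sum>i\<le>j. svc0 P n i \<omega>) [0..<init P \<omega> ! n] else [])"
| "ledger_at b l P (Suc k) \<omega> =
     (let L = ledger_at b l P k \<omega>; t = epoch P k \<omega>
      in fold (assign b t)
           (zip (jsq_choice l (pending L t) (sample P k \<omega>)) (map (\<lambda>j. svc P k j \<omega>) [0..<l])) L)"

definition queue_length :: "enat \<Rightarrow> nat \<Rightarrow> 'a primitives \<Rightarrow> 'a \<Rightarrow> real \<Rightarrow> nat \<Rightarrow> nat" where
  "queue_length b l P \<omega> t n = pending (ledger_at b l P (card {k. epoch P k \<omega> \<le> t}) \<omega>) t n"

definition occupancy :: "enat \<Rightarrow> nat \<Rightarrow> nat \<Rightarrow> 'a primitives \<Rightarrow> 'a \<Rightarrow> real \<Rightarrow> nat \<Rightarrow> real" where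
  "occupancy b N l P \<omega> = (\<lambda>t\<in>{0..}. \<lambda>i. if i \<in> levels b
     then real (card {n. n < N \<and> i \<le> queue_length b l P \<omega> t n}) / real N else 0)"

datatype source = Init | Gap nat | Sample nat | Svc0 nat nat | Svc nat nat

fun source_events :: "'a measure \<Rightarrow> 'a primitives \<Rightarrow> source \<Rightarrow> 'a set set" where
  "source_events M P Init = {init P -` A \<inter> space M | A. True}"
| "source_events M P (Gap k) = {gap P k -` A \<inter> space M | A. A \<in> sets borel}"
| "source_events M P (Sample k) = {sample P k -` A \<inter> space M | A. True}"
| "source_events M P (Svc0 n j) = {svc0 P n j -` A \<inter> space M | A. A \<in> sets borel}"
| "source_events M P (Svc k j) = {svc P k j -` A \<inter> space M | A. A \<in> sets borel}"

text \<open>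
  The Poisson arrival process of the batches, of rate \<open>r / l\<close>, is given by its independent
  exponential interarrival times. That its epochs tend to infinity holds almost surely anyway; it
  is required for every outcome so that all sample paths, and not only almost all, are cadlag.
\<close>

locale batch_jsq_system = prob_space M
  for M :: "'a measure" and P :: "'a primitives"
    and N :: nat and b :: enat and r :: real and l d :: nat +
  assumes rate_pos: "0 < r"
    and batch_bounds: "0 < l" "l \<le> d" "d \<le> N"
    and init_measurable: "init P \<in> M \<rightarrow>\<^sub>M count_space UNIV"
    and init_valid: "\<And>\<omega>. \<omega> \<in> space M \<Longrightarrow>
          length (init P \<omega>) = N \<and> (\<forall>x\<in>set (init P \<omega>). enat x \<le> b)"
    and gap_distributed: "\<And>k. distributed M lborel (gap P k) (exponential_density (r / real l))"
    and epochs_diverge: "\<And>\<omega>. \<omega> \<in> space M \<Longrightarrow> filterlim (\<lambda>k. epoch P k \<omega>) at_top sequentially"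
    and sample_measurable: "\<And>k. sample P k \<in> M \<rightarrow>\<^sub>M count_space UNIV"
    and sample_uniform: "\<And>k. distr M (count_space UNIV) (sample P k) =
          measure_pmf (pmf_of_set {ns. length ns = d \<and> distinct ns \<and> set ns \<subseteq> {..<N}})"
    and svc0_distributed: "\<And>n j. distributed M lborel (svc0 P n j) (exponential_density 1)"
    and svc_distributed: "\<And>k j. distributed M lborel (svc P k j) (exponential_density 1)"
    and independent: "indep_sets (source_events M P) UNIV"

end

theory Submission
  imports Defs
begin

text \<open>
  Compare the system with an infinite-server queue that receives the same batches with the
  same service requirements. As long as every batch finds enough idle servers in its sample,
  each task starts service on arrival, no task waits, and the number of busy servers is the
  population of that queue. The population is a functional of a Poisson process with
  independent marks; divided by \<open>N\<close> it concentrates around the solution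
  \<open>lam + (q - lam) * exp (- t)\<close> of the equation \<open>q' = lam - q\<close>.

  Two points need an argument. The first is that bad batches, those with fewer than \<open>l\<close> idle
  servers in the sample, are rare. While at most a fraction \<open>lam + eps / 2\<close> of the servers is
  busy, a sample of size at least \<open>l / (1 - lam - eps)\<close> contains in the mean more than \<open>l\<close>
  idle servers, by a fixed factor. The number of idle servers in it is hypergeometric, so by
  Chebyshev's inequality a batch is bad with probability of order \<open>1 / l\<close> (\<open>few_idle_draws\<close>).
  It then harms at most \<open>l\<close> tasks; hence the expected number of harmed tasks is of the order
  of the number of batches, that is \<open>N / l\<close>, which is negligible because \<open>l\<close> tends to infinity
  (\<open>bad_arrivals_tail\<close>). This presupposes what is to be shown, that few servers are busy. The
  circle is broken pathwise: the number of busy servers and the population of the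
  infinite-server queue differ by at most the number of waiting tasks at time 0 plus the tasks
  in bad batches (\<open>coupling_invariant\<close>), and since the population stays close to its limit,
  which is at most \<open>lam * N\<close>, induction over the epochs shows that the threshold is never
  passed (\<open>coupling_bound\<close>). The same error bounds the number of waiting tasks, which is the
  sum of all levels above the first, so that closeness holds in the
  \<open>\<ell>\<^sub>1\<close> distance.

  The second point is the law of large numbers for the infinite-server queue, uniformly in
  time. Mean and variance at a fixed time follow from Campbell's formulas for sums over one or
  two epochs (\<open>mark_count_deviation\<close>) and, for the initial tasks, from the independence of
  their service requirements (\<open>initial_deviation\<close>). The variance is of order \<open>l * N\<close> or
  smaller, which is negligible against \<open>N^2\<close> if \<open>l / N\<close> tends to 0, and if \<open>lam = 0\<close> since
  then there are too few arrivals. Between two grid points, the population changes by at most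
  the number of arrivals (\<open>uniform_closeness\<close>).

  The limit is a continuous path, so uniform closeness on bounded intervals gives convergence
  in the Skorohod topology. It remains that the occupancy process is a random element of the
  Skorohod space at all: its preimages of open sets are events because it is a step process in
  a countable state space (\<open>measurable_step_process\<close>).
\<close>

section \<open>Step paths in the Skorohod space\<close>

text \<open>
  Paths that are piecewise constant and right-continuous, with finitely many jumps in each
  bounded interval; all of them are at positive times. For \<open>J\<close> any finite superset of the jump
  times up to \<open>T\<close> may be taken.
\<close>

definition step_path :: "(real \<Rightarrow> 's) \<Rightarrow> bool" where
  "step_path x \<longleftrightarrow> (\<forall>T. \<exists>J. finite J \<and> J \<subseteq> {0<..} \<and>
     (\<forall>s t. 0 \<le> s \<and> s \<le> t \<and> t \<le> T \<and> {s<..t} \<inter> J = {} \<longrightarrow> x s = x t))"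

lemma step_path_cadlag:
  assumes step: "step_path x" and x: "x \<in> {0..} \<rightarrow>\<^sub>E mspace m"
  shows "x \<in> cadlag_paths m"
  unfolding cadlag_paths_def
proof (intro CollectI conjI allI impI)
  fix t :: real assume t: "0 \<le> t"
  obtain J where J: "finite J" "J \<subseteq> {0<..}" "\<forall>s s'. 0 \<le> s \<and> s \<le> s' \<and> s' \<le> t + 1 \<and> {s<..s'} \<inter> J = {} \<longrightarrow> x s = x s'"
    using step[unfolded step_path_def, rule_format, of "t + 1"] by auto
  have "\<forall>\<^sub>F s in at_right t. \<forall>j\<in>J. \<not> (t < j \<and> j \<le> s)"
  proof (intro eventually_ball_finite[OF J(1)] ballI)
    fix j
    show "\<forall>\<^sub>F s in at_right t. \<not> (t < j \<and> j \<le> s)"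
    proof (cases "t < j")
      case True then show ?thesis
        by (auto simp: eventually_at_right_field intro!: exI[of _ j])
    qed auto
  qed
  moreover have "\<forall>\<^sub>F s in at_right t. t < s \<and> s < t + 1"
    by (auto simp: eventually_at_right_field intro!: exI[of _ "t + 1"])
  ultimately have "\<forall>\<^sub>F s in at_right t. x s = x t"
  proof eventually_elim
    case (elim s)
    then have "{t<..s} \<inter> J = {}" by auto
    with J(3)[rule_format, of t s] t elim show ?case by auto
  qed
  then show "limitin (mtopology_of m) x (x t) (at_right t)"
    using x t by (intro limitin_eventually) (auto simp: PiE_iff)
next
  fix t :: real assume t: "0 < t"
  obtain J where J: "finite J" "J \<subseteq> {0<..}" "\<forall>s s'. 0 \<le> s \<and> s \<le> s' \<and> s' \<le> t \<and> {s<..s'} \<inter> J = {} \<longrightarrow> x s = x s'"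
    using step[unfolded step_path_def, rule_format, of t] by auto
  have "\<forall>\<^sub>F s in at_left t. \<forall>j\<in>J. \<not> (s < j \<and> j < t)"
  proof (intro eventually_ball_finite[OF J(1)] ballI)
    fix j
    show "\<forall>\<^sub>F s in at_left t. \<not> (s < j \<and> j < t)"
    proof (cases "j < t")
      case True then show ?thesis
        by (auto simp: eventually_at_left_field intro!: exI[of _ j])
    qed auto
  qed
  moreover have "\<forall>\<^sub>F s in at_left t. 0 < s \<and> s < t"
    using t by (auto simp: eventually_at_left_field intro!: exI[of _ "0"])
  ultimately have ev: "\<forall>\<^sub>F s in at_left t. 0 < s \<and> s < t \<and> {s<..<t} \<inter> J = {}"
    by eventually_elim auto
  then obtain s0 where s0: "0 < s0" "s0 < t" "{s0<..<t} \<inter> J = {}"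
    using eventually_happens[OF ev] by auto
  have "\<forall>\<^sub>F s in at_left t. s0 < s \<and> s < t"
    using s0 by (auto simp: eventually_at_left_field intro!: exI[of _ "s0"])
  then have "\<forall>\<^sub>F s in at_left t. x s = x s0"
  proof eventually_elim
    case (elim s)
    then have "{s0<..s} \<inter> J \<subseteq> {s0<..<t} \<inter> J" by auto
    then have "{s0<..s} \<inter> J = {}" using s0(3) by blast
    with J(3)[rule_format, of s0 s] s0 elim show ?case by auto
  qed
  then show "\<exists>l. limitin (mtopology_of m) x l (at_left t)"
    using x s0 by (intro exI[of _ "x s0"] limitin_eventually) (auto simp: PiE_iff)
qed (use x in auto)

lemma time_changesI:
  assumes mono: "strict_mono_on {0..} h" and cont: "continuous_on {0..} h"
    and 0: "h 0 = 0" and bdd: "\<And>t. 0 \<le> t \<Longrightarrow> \<bar>h t - t\<bar> \<le> c"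
  shows "h \<in> time_changes"
proof -
  have "h ` {0..} \<subseteq> {0..}"
    using strict_mono_onD[OF mono, of 0] 0 by (force simp: le_less)
  moreover have "s \<in> h ` {0..}" if "0 \<le> s" for s
  proof -
    have c: "0 \<le> c" using bdd[of 0] by simp
    have "\<exists>t. 0 \<le> t \<and> t \<le> s + c \<and> h t = s"
      using that c 0 bdd[of "s + c"] continuous_on_subset[OF cont, of "{0..s+c}"]
      by (intro IVT') auto
    then show ?thesis by auto
  qed
  ultimately show ?thesis using mono unfolding time_changes_def by auto
qed

lemma time_changes_comp: "g \<in> time_changes \<Longrightarrow> h \<in> time_changes \<Longrightarrow> (\<lambda>t. g (h t)) \<in> time_changes"
  unfolding time_changes_def strict_mono_on_def
  by (simp add: image_image[of g h, symmetric]) (metis atLeast_iff imageI)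

text \<open>
  An inverse of a time change, with the same bound on the displacement, turns an approximation
  of one path by another into one in the opposite direction.
\<close>

lemma time_changes_inverse:
  assumes h: "h \<in> time_changes" and bdd: "\<And>t. 0 \<le> t \<Longrightarrow> \<bar>h t - t\<bar> < e"
  obtains g where "g \<in> time_changes" "\<And>t. 0 \<le> t \<Longrightarrow> 0 \<le> g t \<and> h (g t) = t \<and> \<bar>g t - t\<bar> < e"
proof
  let ?g = "inv_into {0..} h"
  have img: "h ` {0..} = {0..}" and mono: "strict_mono_on {0..} h"
    using h by (auto simp: time_changes_def)
  have *: "0 \<le> ?g t \<and> h (?g t) = t" if "0 \<le> t" for t
    using that inv_into_into[of t h "{0..}"] f_inv_into_f[of t h "{0..}"] img by auto
  then show "0 \<le> ?g t \<and> h (?g t) = t \<and> \<bar>?g t - t\<bar> < e" if "0 \<le> t" for t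
    using bdd[of "?g t"] that by force
  have "strict_mono_on {0..} ?g"
  proof (rule strict_mono_onI)
    fix r s :: real assume rs: "r \<in> {0..}" "s \<in> {0..}" "r < s"
    show "?g r < ?g s"
      using *[of r] *[of s] rs strict_mono_onD[OF mono, of "?g s" "?g r"]
      by (cases "?g r" "?g s" rule: linorder_cases) auto
  qed
  moreover have "?g ` {0..} = {0..}"
    by (metis img inv_into_image_cancel order_refl strict_mono_on_imp_inj_on[OF mono])
  ultimately show "?g \<in> time_changes" by (simp add: time_changes_def)
qed

text \<open>
  Tent functions of height \<open>c j\<close> and half-width \<open>w\<close> have slopes at most \<open>d / w\<close>, so that a sum
  of them, subtracted from the identity, leaves a strictly increasing function once
  \<open>card J * d < w\<close>.
\<close>

lemma sum_tent_lipschitz: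
  fixes c u :: "'j \<Rightarrow> real"
  assumes "finite J" "\<And>j. j \<in> J \<Longrightarrow> 0 \<le> c j \<and> c j \<le> d" "0 < w"
  shows "\<bar>(\<Sum>j\<in>J. c j * max 0 (1 - \<bar>t - u j\<bar> / w)) - (\<Sum>j\<in>J. c j * max 0 (1 - \<bar>s - u j\<bar> / w))\<bar>
    \<le> real (card J) * d / w * \<bar>t - s\<bar>"
proof -
  have "\<bar>c j * max 0 (1 - \<bar>t - u j\<bar> / w) - c j * max 0 (1 - \<bar>s - u j\<bar> / w)\<bar> \<le> d / w * \<bar>t - s\<bar>"
    if "j \<in> J" for j
  proof -
    have "\<bar>max 0 (1 - \<bar>t - u j\<bar> / w) - max 0 (1 - \<bar>s - u j\<bar> / w)\<bar>
       \<le> \<bar>\<bar>t - u j\<bar> / w - \<bar>s - u j\<bar> / w\<bar>" by linarith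
    also have "\<dots> = \<bar>\<bar>t - u j\<bar> - \<bar>s - u j\<bar>\<bar> / w"
      using assms(3) by (simp add: diff_divide_distrib[symmetric])
    also have "\<dots> \<le> \<bar>t - s\<bar> / w"
      using assms(3) by (intro divide_right_mono) auto
    finally have "c j * \<bar>max 0 (1 - \<bar>t - u j\<bar> / w) - max 0 (1 - \<bar>s - u j\<bar> / w)\<bar> \<le> d * (\<bar>t - s\<bar> / w)"
      using assms(2)[OF that] by (intro mult_mono) auto
    then show ?thesis
      using assms(2)[OF that] by (simp add: abs_mult right_diff_distrib[symmetric])
  qed
  then have "(\<Sum>j\<in>J. \<bar>c j * max 0 (1 - \<bar>t - u j\<bar> / w) - c j * max 0 (1 - \<bar>s - u j\<bar> / w)\<bar>)
     \<le> (\<Sum>j\<in>J. d / w * \<bar>t - s\<bar>)" by (intro sum_mono)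
  then show ?thesis
    unfolding sum_subtractf[symmetric] by (intro order_trans[OF sum_abs]) simp
qed

text \<open>
  Rounding times down to multiples of \<open>1 / n\<close> delays a jump at \<open>j\<close> to the next grid point
  \<open>u j\<close>. The identity minus a tent of height \<open>u j - j\<close> around each \<open>u j\<close> undoes all these
  delays at once. The tents are so narrow that none of them reaches 0 or another point \<open>u i\<close>,
  but \<open>n\<close> is so large that they are flat.
\<close>

lemma grid_time_change:
  assumes J: "finite J" "J \<subseteq> {0<..}" and e: "0 < e"
  shows "\<exists>n0. \<forall>n\<ge>n0. \<exists>h\<in>time_changes. \<forall>t\<ge>0. \<bar>h t - t\<bar> < e \<and>
    (\<forall>j\<in>J. j \<le> h t \<longleftrightarrow> j \<le> of_int \<lfloor>real n * t\<rfloor> / real n)"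
proof -
  \<comment> \<open>At most half of the distance between any two points of \<open>insert 0 J\<close>; the 1 keeps the set
    nonempty.\<close>
  define w where "w = Min (insert 1 ((\<lambda>(i, j). \<bar>i - j\<bar>) ` {(i, j) \<in> insert 0 J \<times> insert 0 J. i \<noteq> j})) / 2"
  have fin: "finite (insert 1 ((\<lambda>(i, j). \<bar>i - j\<bar>) ` {(i, j) \<in> insert 0 J \<times> insert 0 J. i \<noteq> j}))"
    using finite_subset[of "{(i, j) \<in> insert 0 J \<times> insert 0 J. i \<noteq> j}" "insert 0 J \<times> insert 0 J"] J(1)
    by auto
  have w: "0 < w" unfolding w_def using fin by (auto simp: Min_gr_iff)
  have sep: "2 * w \<le> \<bar>i - j\<bar>" if "i \<in> insert 0 J" "j \<in> insert 0 J" "i \<noteq> j" for i j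
  proof -
    have "\<bar>i - j\<bar> \<in> (\<lambda>(i, j). \<bar>i - j\<bar>) ` {(i, j) \<in> insert 0 J \<times> insert 0 J. i \<noteq> j}"
      using that by (intro image_eqI[of _ _ "(i, j)"]) auto
    then have "Min (insert 1 ((\<lambda>(i, j). \<bar>i - j\<bar>) ` {(i, j) \<in> insert 0 J \<times> insert 0 J. i \<noteq> j})) \<le> \<bar>i - j\<bar>"
      by (intro Min_le fin) blast
    then show ?thesis by (simp add: w_def)
  qed
  \<comment> \<open>The three summands ensure that the delays are below \<open>w\<close>, that the tents are flat, and that
    the displacement is below \<open>e\<close>.\<close>
  define n0 where "n0 = nat \<lceil>1 / w + card J / w + card J / e\<rceil> + 1"
  show ?thesis
  proof (intro exI[of _ n0] allI impI)
    fix n assume "n0 \<le> n"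
    then have n: "real n > 1 / w + card J / w + card J / e" "real n > 0" unfolding n0_def
      by linarith+
    then have n': "1 < real n * w" "card J < real n * w" "card J < real n * e"
    proof -
      have pos: "0 \<le> 1 / w" "0 \<le> card J / w" "0 \<le> card J / e" using w e by auto
      have "1 / w < real n" "card J / w < real n" "card J / e < real n" using n pos by linarith+
      then show "1 < real n * w" "card J < real n * w" "card J < real n * e"
        using w e by (auto simp: pos_divide_less_eq)
    qed
    define u where "u j = of_int \<lceil>real n * j\<rceil> / real n" for j
    define c where "c j = u j - j" for j
    define h where "h t = t - (\<Sum>j\<in>J. c j * max 0 (1 - \<bar>t - u j\<bar> / w))" for t
    have c: "0 \<le> c j \<and> c j \<le> 1 / real n" for j
    proof -
      have "real n * c j = of_int \<lceil>real n * j\<rceil> - real n * j"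
        unfolding c_def u_def using n by (simp add: right_diff_distrib)
      then have "0 \<le> real n * c j" "real n * c j \<le> 1" by linarith+
      then show ?thesis using n by (auto simp: zero_le_mult_iff field_simps)
    qed
    have far: "w \<le> \<bar>i - u j\<bar>" if "i = 0 \<or> i \<in> u ` (J - {j})" "j \<in> J" for i j
    proof -
      have "1 / real n \<le> w" using n' n by (simp add: field_simps)
      from that(1) show ?thesis
      proof
        assume "i = 0"
        then show ?thesis using sep[of 0 j] that J c[of j] w by (force simp: c_def)
      next
        assume "i \<in> u ` (J - {j})"
        then obtain k where k: "k \<in> J" "k \<noteq> j" "i = u k" by auto
        then have "2 * w \<le> \<bar>k - j\<bar>" using sep that by auto
        moreover have "\<bar>(k - j) - (i - u j)\<bar> \<le> 1 / real n"
          using c[of k] c[of j] k(3) unfolding c_def by linarith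
        ultimately show ?thesis using \<open>1 / real n \<le> w\<close> by linarith
      qed
    qed
    have tent0: "c j * max 0 (1 - \<bar>t - u j\<bar> / w) = 0" if "w \<le> \<bar>t - u j\<bar>" for t j
      using that w by (simp add: max_def field_simps)
    have mono: "strict_mono_on {0..} h"
    proof (rule strict_mono_onI)
      fix r s :: real assume "r < s"
      have "real (card J) * (1 / real n) / w < 1" using n' n w by (simp add: field_simps)
      then have "real (card J) * (1 / real n) / w * \<bar>s - r\<bar> < 1 * (s - r)"
        using \<open>r < s\<close> mult_strict_right_mono[of "real (card J) * (1 / real n) / w" 1 "s - r"] by simp
      then show "h r < h s"
        using sum_tent_lipschitz[OF J(1) c w, of "\<lambda>j. j" s u r] unfolding h_def
        by (smt (verit, best) J(1) c sum_tent_lipschitz w)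
    qed
    have cont: "continuous_on {0..} h"
      unfolding h_def by (intro continuous_intros) (use w in auto)
    have h0: "h 0 = 0"
    proof -
      have "(\<Sum>j\<in>J. c j * max 0 (1 - \<bar>0 - u j\<bar> / w)) = 0"
        by (intro sum.neutral ballI tent0 far) auto
      then show ?thesis by (simp add: h_def)
    qed
    have bdd: "\<bar>h t - t\<bar> \<le> real (card J) * (1 / real n)" for t
    proof -
      have "\<bar>\<Sum>j\<in>J. c j * max 0 (1 - \<bar>t - u j\<bar> / w)\<bar> \<le> (\<Sum>j\<in>J. 1 / real n)"
      proof (rule order_trans[OF sum_abs sum_mono])
        fix j
        have "\<bar>c j * max 0 (1 - \<bar>t - u j\<bar> / w)\<bar> = c j * max 0 (1 - \<bar>t - u j\<bar> / w)"
          using c[of j] by (intro abs_of_nonneg) auto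
        also have "\<dots> \<le> 1 / real n * 1" using c[of j] w by (intro mult_mono) auto
        finally show "\<bar>c j * max 0 (1 - \<bar>t - u j\<bar> / w)\<bar> \<le> 1 / real n" by simp
      qed
      then show ?thesis unfolding h_def by simp
    qed
    have hu: "h (u j) = j" if "j \<in> J" for j
    proof -
      have "(\<Sum>i\<in>J. c i * max 0 (1 - \<bar>u j - u i\<bar> / w)) = (\<Sum>i\<in>J. if i = j then c j else 0)"
      proof (rule sum.cong[OF refl])
        fix i assume i: "i \<in> J"
        show "c i * max 0 (1 - \<bar>u j - u i\<bar> / w) = (if i = j then c j else 0)"
        proof (cases "i = j")
          case False
          then show ?thesis using far[of "u j" i] i that tent0 by auto
        qed auto
      qed
      then show ?thesis using J that by (simp add: h_def c_def)
    qed
    have u0: "0 \<le> u j" if "j \<in> J" for j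
    proof -
      have "0 \<le> real n * j" using that J(2) by (intro mult_nonneg_nonneg) auto
      then have "0 \<le> \<lceil>real n * j\<rceil>" by linarith
      then show ?thesis by (simp add: u_def)
    qed
    show "\<exists>h\<in>time_changes. \<forall>t\<ge>0. \<bar>h t - t\<bar> < e \<and> (\<forall>j\<in>J. j \<le> h t \<longleftrightarrow> j \<le> of_int \<lfloor>real n * t\<rfloor> / real n)"
    proof (intro bexI[of _ h] allI impI conjI ballI)
      show "h \<in> time_changes" by (rule time_changesI[OF mono cont h0 bdd])
      fix t :: real assume t: "0 \<le> t"
      have "real (card J) * (1 / real n) < e" using n' n by (simp add: field_simps)
      then show "\<bar>h t - t\<bar> < e" using bdd[of t] by linarith
      fix j assume j: "j \<in> J"
      have "j \<le> h t \<longleftrightarrow> u j \<le> t"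
        using strict_mono_on_less_eq[OF mono, of "u j" t] hu[OF j] u0[OF j] t by simp
      also have "\<dots> \<longleftrightarrow> of_int \<lceil>real n * j\<rceil> \<le> real n * t"
        unfolding u_def using n by (simp add: field_simps)
      also have "\<dots> \<longleftrightarrow> real n * j \<le> of_int \<lfloor>real n * t\<rfloor>"
        by (simp add: le_floor_iff[symmetric] ceiling_le_iff[symmetric])
      also have "\<dots> \<longleftrightarrow> j \<le> of_int \<lfloor>real n * t\<rfloor> / real n"
        using n by (simp add: field_simps)
      finally show "j \<le> h t \<longleftrightarrow> j \<le> of_int \<lfloor>real n * t\<rfloor> / real n" .
    qed
  qed
qed

text \<open>
  The cap \<open>n^2\<close> makes a path evaluated at grid times depend on finitely many of its values,
  and yet it is not felt before time \<open>n\<close>.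
\<close>

definition grid_time :: "nat \<Rightarrow> real \<Rightarrow> real" where
  "grid_time n t = real (min (nat \<lfloor>real n * t\<rfloor>) (n ^ 2)) / real n"

lemma skeleton_time_change:
  assumes step: "step_path x" and T: "0 < T" and e: "0 < e"
  shows "\<exists>n0. \<forall>n\<ge>n0. \<exists>h\<in>time_changes.
    (\<forall>t\<ge>0. \<bar>h t - t\<bar> < e) \<and> (\<forall>t\<in>{0..T}. x (h t) = x (grid_time n t))"
proof -
  obtain J where J: "finite J" "J \<subseteq> {0<..}"
    "\<forall>s t. 0 \<le> s \<and> s \<le> t \<and> t \<le> T + e \<and> {s<..t} \<inter> J = {} \<longrightarrow> x s = x t"
    using step[unfolded step_path_def, rule_format, of "T + e"] by auto
  obtain n0 where n0: "\<forall>n\<ge>n0. \<exists>h\<in>time_changes. \<forall>t\<ge>0. \<bar>h t - t\<bar> < e \<and>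
    (\<forall>j\<in>J. j \<le> h t \<longleftrightarrow> j \<le> of_int \<lfloor>real n * t\<rfloor> / real n)"
    using grid_time_change[OF J(1,2) e] by blast
  show ?thesis
  proof (intro exI[of _ "max n0 (nat \<lceil>T\<rceil> + 1)"] allI impI)
    fix n assume n: "max n0 (nat \<lceil>T\<rceil> + 1) \<le> n"
    then obtain h where h: "h \<in> time_changes" "\<forall>t\<ge>0. \<bar>h t - t\<bar> < e \<and>
      (\<forall>j\<in>J. j \<le> h t \<longleftrightarrow> j \<le> of_int \<lfloor>real n * t\<rfloor> / real n)" using n0 by auto
    have nT: "T \<le> real n" "0 < real n" using n by linarith+
    have "x (h t) = x (grid_time n t)" if t: "t \<in> {0..T}" for t
    proof -
      have "real n * t \<le> real n * real n" using t nT by (intro mult_left_mono) auto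
      then have "nat \<lfloor>real n * t\<rfloor> \<le> n\<^sup>2" 
        using nat_mono[OF floor_mono[of "real n * t" "real (n * n)"]]
        by (simp only: power2_eq_square of_nat_mult[symmetric] floor_of_nat nat_int)
      then have g: "grid_time n t = of_int \<lfloor>real n * t\<rfloor> / real n"
        using t nT by (simp add: grid_time_def min_def)
      have g0: "0 \<le> grid_time n t" by (simp add: grid_time_def)
      have "of_int \<lfloor>real n * t\<rfloor> \<le> real n * t" by simp
      then have "grid_time n t \<le> t" unfolding g using nT by (simp add: field_simps)
      then have gT: "grid_time n t \<le> T + e" using t e by auto
      have h0: "0 \<le> h t" using h(1) t unfolding time_changes_def by auto
      have "\<bar>h t - t\<bar> < e" using h(2) t by auto
      then have hT: "h t \<le> T + e" using t by auto
      have iff: "\<forall>j\<in>J. j \<le> h t \<longleftrightarrow> j \<le> grid_time n t" using h(2) t unfolding g by auto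
      show ?thesis
      proof (cases "h t \<le> grid_time n t")
        case True
        have "{h t<..grid_time n t} \<inter> J = {}" using iff by auto
        then show ?thesis using J(3)[rule_format, of "h t" "grid_time n t"] True h0 gT by auto
      next
        case False
        have "{grid_time n t<..h t} \<inter> J = {}" using iff by auto
        then show ?thesis using J(3)[rule_format, of "grid_time n t" "h t"] False g0 hT by auto
      qed
    qed
    then show "\<exists>h\<in>time_changes. (\<forall>t\<ge>0. \<bar>h t - t\<bar> < e) \<and> (\<forall>t\<in>{0..T}. x (h t) = x (grid_time n t))"
      using h by blast
  qed
qed

text \<open>
  Membership of a step path in an open set can be read off its restrictions to the grids. This
  is what makes the path measurable: a restriction to a grid takes only countably many values,
  so that every condition on it is an event. From left to right, a ball around \<open>x\<close> contains
  smaller balls around close paths; from right to left, \<open>x\<close> itself lies in the ball around its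
  restriction. Both directions use that \<open>x\<close> and its restriction agree up to a small time
  change.
\<close>

lemma J1_open_iff_skeleton:
  assumes U: "openin (J1_topology m) U" and x: "x \<in> cadlag_paths m" and step: "step_path x"
  shows "x \<in> U \<longleftrightarrow> (\<exists>k n0. \<forall>n\<ge>n0. J1_ball m (\<lambda>t. x (grid_time n t)) (real k) (1 / real (Suc k)) \<subseteq> U)"
proof
  assume "x \<in> U"
  then obtain T e where T: "0 < T" and e: "0 < e" and ball: "J1_ball m x T e \<subseteq> U"
    using U unfolding openin_J1_topology by blast
  \<comment> \<open>Half of \<open>e\<close> is spent on each of the two approximations.\<close>
  define k where "k = nat \<lceil>T\<rceil> + nat \<lceil>2 / e\<rceil>"
  have k: "T \<le> real k" "1 / real (Suc k) < e / 2"
  proof -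
    have "T \<le> real (nat \<lceil>T\<rceil>)" by linarith
    also have "\<dots> \<le> real k" by (simp add: k_def)
    finally show "T \<le> real k" .
    have "2 / e \<le> real (nat \<lceil>2 / e\<rceil>)" by linarith
    also have "\<dots> < real (Suc k)" by (simp add: k_def)
    finally have "2 < e * real (Suc k)" using e by (simp add: field_simps)
    then show "1 / real (Suc k) < e / 2" by (simp add: field_simps)
  qed
  obtain n0 where n0: "\<forall>n\<ge>n0. \<exists>h\<in>time_changes.
    (\<forall>t\<ge>0. \<bar>h t - t\<bar> < e / 2) \<and> (\<forall>t\<in>{0..T + e}. x (h t) = x (grid_time n t))"
    using skeleton_time_change[OF step, of "T + e" "e / 2"] T e by auto
  have "J1_ball m (\<lambda>t. x (grid_time n t)) (real k) (1 / real (Suc k)) \<subseteq> U" if "n0 \<le> n" for n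
  proof (rule subset_trans[OF subsetI ball])
    fix y assume "y \<in> J1_ball m (\<lambda>t. x (grid_time n t)) (real k) (1 / real (Suc k))"
    then obtain h where y: "y \<in> cadlag_paths m" and h: "h \<in> time_changes"
      "\<forall>t\<in>{0..real k}. \<bar>h t - t\<bar> < 1 / real (Suc k) \<and> mdist m (y t) (x (grid_time n (h t))) < 1 / real (Suc k)"
      unfolding J1_ball_def by blast
    obtain g where g: "g \<in> time_changes" "\<forall>t\<ge>0. \<bar>g t - t\<bar> < e / 2"
      "\<forall>t\<in>{0..T + e}. x (g t) = x (grid_time n t)" using n0 \<open>n0 \<le> n\<close> by blast
    have "\<bar>g (h t) - t\<bar> < e \<and> mdist m (y t) (x (g (h t))) < e" if t: "t \<in> {0..T}" for t
    proof -
      have 1: "\<bar>h t - t\<bar> < e / 2" "mdist m (y t) (x (grid_time n (h t))) < e / 2"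
        using h(2)[rule_format, of t] t k by auto
      have 2: "0 \<le> h t" using h(1) t unfolding time_changes_def by auto
      then have 3: "\<bar>g (h t) - h t\<bar> < e / 2" using g(2) by auto
      have "x (g (h t)) = x (grid_time n (h t))" using g(3) 1 2 t e by auto
      with 1(2) have "mdist m (y t) (x (g (h t))) < e" using e by simp
      moreover have "\<bar>g (h t) - t\<bar> < e" using 1(1) 3 by linarith
      ultimately show ?thesis by simp
    qed
    then show "y \<in> J1_ball m x T e"
      unfolding J1_ball_def using y time_changes_comp[OF g(1) h(1)]
      by (intro CollectI conjI bexI[of _ "\<lambda>t. g (h t)"]) auto
  qed
  then show "\<exists>k n0. \<forall>n\<ge>n0. J1_ball m (\<lambda>t. x (grid_time n t)) (real k) (1 / real (Suc k)) \<subseteq> U"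
    by blast
next
  assume "\<exists>k n0. \<forall>n\<ge>n0. J1_ball m (\<lambda>t. x (grid_time n t)) (real k) (1 / real (Suc k)) \<subseteq> U"
  then obtain k n0 where n0: "\<forall>n\<ge>n0. J1_ball m (\<lambda>t. x (grid_time n t)) (real k) (1 / real (Suc k)) \<subseteq> U"
    by blast
  define e where "e = 1 / real (Suc k)"
  have e: "0 < e" by (simp add: e_def)
  obtain n1 where n1: "\<forall>n\<ge>n1. \<exists>h\<in>time_changes.
    (\<forall>t\<ge>0. \<bar>h t - t\<bar> < e) \<and> (\<forall>t\<in>{0..real k + 1 + e}. x (h t) = x (grid_time n t))"
    using skeleton_time_change[OF step, of "real k + 1 + e" e] e by auto
  define n where "n = max n0 n1"
  obtain h where h: "h \<in> time_changes" "\<forall>t\<ge>0. \<bar>h t - t\<bar> < e"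
     "\<forall>t\<in>{0..real k + 1 + e}. x (h t) = x (grid_time n t)" 
    using n1[rule_format, of n] by (auto simp: n_def)
  obtain g where g: "g \<in> time_changes" "\<And>t. 0 \<le> t \<Longrightarrow> 0 \<le> g t \<and> h (g t) = t \<and> \<bar>g t - t\<bar> < e"
    using time_changes_inverse[OF h(1), of e] h(2) by auto
  have "\<bar>g t - t\<bar> < e \<and> mdist m (x t) (x (grid_time n (g t))) < e" if t: "t \<in> {0..real k}" for t
  proof -
    have gt: "0 \<le> g t" "h (g t) = t" "\<bar>g t - t\<bar> < e" using g(2)[of t] t by auto
    then have eq: "x (grid_time n (g t)) = x t" using h(3)[rule_format, of "g t"] t by auto
    have "x t \<in> mspace m" using x t unfolding cadlag_paths_def by auto
    then have "mdist m (x t) (x t) = 0" by simp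
    then show ?thesis using gt e by (simp add: eq)
  qed
  then have "x \<in> J1_ball m (\<lambda>t. x (grid_time n t)) (real k) (1 / real (Suc k))"
    unfolding J1_ball_def e_def[symmetric] using x g(1)
    by (intro CollectI conjI bexI[of _ g]) auto
  moreover have "J1_ball m (\<lambda>t. x (grid_time n t)) (real k) (1 / real (Suc k)) \<subseteq> U"
    using n0 by (simp add: n_def)
  ultimately show "x \<in> U" by blast
qed

lemma measurable_count_space_map:
  fixes f :: "'i \<Rightarrow> 'a \<Rightarrow> 'c::countable"
  assumes "\<And>i. i \<in> set is \<Longrightarrow> f i \<in> M \<rightarrow>\<^sub>M count_space UNIV"
  shows "(\<lambda>\<omega>. map (\<lambda>i. f i \<omega>) is) \<in> M \<rightarrow>\<^sub>M count_space UNIV"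
  using assms
proof (induction "is")
  case (Cons a "is")
  have [measurable]: "f a \<in> M \<rightarrow>\<^sub>M count_space UNIV"
    "(\<lambda>\<omega>. map (\<lambda>i. f i \<omega>) is) \<in> M \<rightarrow>\<^sub>M count_space UNIV" using Cons by auto
  show ?case by simp
qed simp

text \<open>
  Pointwise measurability suffices for processes that move through a countable set by jumps.
  The preimage of an open set is rewritten by the previous characterization as a countable
  combination of events.
\<close>

lemma measurable_step_process:
  fixes Z :: "real \<Rightarrow> 'a \<Rightarrow> 'c::countable" and X :: "'a \<Rightarrow> real \<Rightarrow> 's"
  assumes Z: "\<And>t. 0 \<le> t \<Longrightarrow> Z t \<in> M \<rightarrow>\<^sub>M count_space UNIV"
    and X: "\<And>\<omega> t. \<omega> \<in> space M \<Longrightarrow> 0 \<le> t \<Longrightarrow> X \<omega> t = \<phi> (Z t \<omega>)"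
    and cadlag: "\<And>\<omega>. \<omega> \<in> space M \<Longrightarrow> X \<omega> \<in> cadlag_paths m"
    and step: "\<And>\<omega>. \<omega> \<in> space M \<Longrightarrow> step_path (X \<omega>)"
  shows "X \<in> M \<rightarrow>\<^sub>M borel_of (J1_topology m)"
  unfolding borel_of_def topspace_J1_topology
proof (rule measurable_measure_of)
  show "{U. openin (J1_topology m) U} \<subseteq> Pow (cadlag_paths m)"
    using openin_subset[of "J1_topology m"] by auto
  fix U assume "U \<in> {U. openin (J1_topology m) U}"
  then have U: "openin (J1_topology m) U" by simp
  define G where "G n \<omega> = map (\<lambda>i. Z (real i / real n) \<omega>) [0..<Suc (n ^ 2)]" for n \<omega>
  have [measurable]: "G n \<in> M \<rightarrow>\<^sub>M count_space UNIV" for n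
    unfolding G_def by (intro measurable_count_space_map Z) auto
  have G: "(\<lambda>t. X \<omega> (grid_time n t)) = (\<lambda>t. \<phi> (G n \<omega> ! min (nat \<lfloor>real n * t\<rfloor>) (n ^ 2)))"
    if "\<omega> \<in> space M" for n \<omega>
  proof
    fix t
    have "X \<omega> (grid_time n t) = \<phi> (Z (grid_time n t) \<omega>)"
      using that by (intro X) (auto simp: grid_time_def)
    also have "Z (grid_time n t) \<omega> = G n \<omega> ! min (nat \<lfloor>real n * t\<rfloor>) (n ^ 2)"
      unfolding G_def grid_time_def by (subst nth_map) (auto simp del: upt_Suc simp: less_Suc_eq_le)
    finally show "X \<omega> (grid_time n t) = \<phi> (G n \<omega> ! min (nat \<lfloor>real n * t\<rfloor>) (n ^ 2))" .
  qed
  define P where "P n k xs \<longleftrightarrow>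
    J1_ball m (\<lambda>t. \<phi> (xs ! min (nat \<lfloor>real n * t\<rfloor>) (n ^ 2))) (real k) (1 / real (Suc k)) \<subseteq> U" for n k xs
  have "X -` U \<inter> space M = {\<omega>\<in>space M. \<exists>k n0. \<forall>n. n0 \<le> n \<longrightarrow> P n k (G n \<omega>)}"
    using J1_open_iff_skeleton[OF U cadlag step] G unfolding P_def by auto
  also have "\<dots> \<in> sets M"
  proof -
    have [measurable]: "Measurable.pred M (\<lambda>\<omega>. P n k (G n \<omega>))" for n k
      by (rule measurable_compose[of "G n" M "count_space UNIV" "P n k"]) auto
    show ?thesis by measurable
  qed
  finally show "X -` U \<inter> space M \<in> sets M" .
qed (use cadlag in \<open>auto simp: cadlag_paths_def\<close>)

section \<open>Sampling without replacement\<close>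

definition draws :: "nat \<Rightarrow> nat \<Rightarrow> nat list set" where
  "draws N d = {ns. length ns = d \<and> distinct ns \<and> set ns \<subseteq> {..<N}}"

lemma finite_draws [simp]: "finite (draws N d)"
  by (rule finite_subset[OF _ finite_lists_length_eq[of "{..<N}" d]]) (auto simp: draws_def)

lemma draws_nonempty: "d \<le> N \<Longrightarrow> draws N d \<noteq> {}"
  by (auto simp: draws_def intro!: exI[of _ "[0..<d]"])

text \<open>A permutation of the servers permutes the possible samples; all symmetry arguments below rest on this.\<close>

lemma bij_betw_draws:
  assumes "bij_betw \<pi> {..<N} {..<N}"
  shows "bij_betw (map \<pi>) (draws N d) (draws N d)"
proof (rule bij_betw_byWitness[of _ "map (inv_into {..<N} \<pi>)"])
  have inv: "inv_into {..<N} \<pi> (\<pi> a) = a" "\<pi> (inv_into {..<N} \<pi> a) = a" if "a < N" for a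
    using assms that by (auto simp: bij_betw_def inv_into_f_f f_inv_into_f)
  have inj: "inj_on \<pi> {..<N}" "inj_on (inv_into {..<N} \<pi>) {..<N}"
    using assms bij_betw_inv_into[OF assms] by (auto simp: bij_betw_def)
  have img: "\<pi> ` {..<N} = {..<N}" "inv_into {..<N} \<pi> ` {..<N} = {..<N}"
    using assms bij_betw_inv_into[OF assms] by (auto simp: bij_betw_def)
  show "\<forall>ns\<in>draws N d. map (inv_into {..<N} \<pi>) (map \<pi> ns) = ns"
    "\<forall>ns\<in>draws N d. map \<pi> (map (inv_into {..<N} \<pi>) ns) = ns"
    using inv by (auto simp: draws_def map_idI subset_eq)
  have "map f ` draws N d \<subseteq> draws N d" if f: "inj_on f {..<N}" "f ` {..<N} = {..<N}" for f
  proof (rule image_subsetI)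
    fix ns assume ns: "ns \<in> draws N d"
    then have "f ` set ns \<subseteq> f ` {..<N}" by (intro image_mono) (auto simp: draws_def)
    then show "map f ns \<in> draws N d"
      using ns f by (auto simp: draws_def distinct_map intro: inj_on_subset)
  qed
  then show "map \<pi> ` draws N d \<subseteq> draws N d" "map (inv_into {..<N} \<pi>) ` draws N d \<subseteq> draws N d"
    using inj img by blast+
qed

lemma ex_bij_betw_pair:
  assumes "a < N" "b < N" "a \<noteq> b" "a' < (N::nat)" "b' < N" "a' \<noteq> b'"
  shows "\<exists>\<pi>. bij_betw \<pi> {..<N} {..<N} \<and> \<pi> a = a' \<and> \<pi> b = b'"
proof -
  define \<pi> where "\<pi> = Transposition.transpose (Transposition.transpose a a' b) b' \<circ> Transposition.transpose a a'"
  have 1: "bij_betw (Transposition.transpose c c') {..<N} {..<N}" if "c < N" "c' < N" for c c'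
    by (rule bij_betw_byWitness[of _ "Transposition.transpose c c'"]) (use that in \<open>auto simp: Transposition.transpose_def\<close>)
  have "bij_betw \<pi> {..<N} {..<N}" unfolding \<pi>_def
    using assms by (intro bij_betw_trans[OF 1 1]) (auto simp: Transposition.transpose_def)
  moreover have "\<pi> a = a'" "\<pi> b = b'" using assms by (auto simp: \<pi>_def Transposition.transpose_def)
  ultimately show ?thesis by blast
qed

lemma card_draws_superset_image:
  assumes \<pi>: "bij_betw \<pi> {..<N} {..<N}" and C: "C \<subseteq> {..<N}"
  shows "card {ns \<in> draws N d. \<pi> ` C \<subseteq> set ns} = card {ns \<in> draws N d. C \<subseteq> set ns}"
proof -
  have b: "bij_betw (map \<pi>) (draws N d) (draws N d)" by (rule bij_betw_draws[OF \<pi>])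
  have iff: "\<pi> ` C \<subseteq> set (map \<pi> ns) \<longleftrightarrow> C \<subseteq> set ns" if "ns \<in> draws N d" for ns
    using inj_on_image_subset_iff[of \<pi> "{..<N}" C "set ns"] \<pi> C that
    by (auto simp: bij_betw_def draws_def)
  have "bij_betw (map \<pi>) {ns \<in> draws N d. C \<subseteq> set ns} {ns \<in> draws N d. \<pi> ` C \<subseteq> set ns}"
    using b iff by (rule bij_betw_Collect)
  then show ?thesis by (rule bij_betw_same_card[symmetric])
qed

text \<open>
  By symmetry all servers are contained in equally many samples, and the total is obtained by
  counting the pairs of a sample and one of its members in two ways.
\<close>

lemma card_draws_containing:
  assumes "a < N"
  shows "N * card {ns \<in> draws N d. a \<in> set ns} = d * card (draws N d)"
proof -
  have eq: "card {ns \<in> draws N d. c \<in> set ns} = card {ns \<in> draws N d. a \<in> set ns}" if "c < N" for c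
  proof (cases "a = c")
    case False
    then obtain \<pi> where "bij_betw \<pi> {..<N} {..<N} \<and> \<pi> a = c \<and> \<pi> c = a"
      using ex_bij_betw_pair[of a N c c a] assms \<open>c < N\<close> by auto
    then show ?thesis using card_draws_superset_image[of \<pi> N "{a}" d] assms by simp
  qed auto
  have "N * card {ns \<in> draws N d. a \<in> set ns} = (\<Sum>c<N. card {ns \<in> draws N d. c \<in> set ns})"
    using eq by simp
  also have "\<dots> = (\<Sum>c<N. \<Sum>ns\<in>draws N d. of_bool (c \<in> set ns))" 
    by (intro sum.cong refl) (simp add: of_bool_def sum.If_cases Int_def)
  also have "\<dots> = (\<Sum>ns\<in>draws N d. \<Sum>c<N. of_bool (c \<in> set ns))" by (rule sum.swap)
  also have "\<dots> = (\<Sum>ns\<in>draws N d. d)"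
  proof (intro sum.cong refl)
    fix ns assume ns: "ns \<in> draws N d"
    then have "{..<N} \<inter> {c. c \<in> set ns} = set ns" by (auto simp: draws_def)
    then have "(\<Sum>c<N. of_bool (c \<in> set ns)) = card (set ns)"
      by (simp add: of_bool_def sum.If_cases)
    also have "\<dots> = d" using ns by (auto simp: draws_def distinct_card)
    finally show "(\<Sum>c<N. of_bool (c \<in> set ns)) = d" .
  qed
  finally show ?thesis by simp
qed

text \<open>The same double counting, now over ordered pairs of distinct servers.\<close>

lemma card_draws_containing_pair:
  assumes "a < N" "b < N" "a \<noteq> b"
  shows "N * (N - 1) * card {ns \<in> draws N d. a \<in> set ns \<and> b \<in> set ns} = d * (d - 1) * card (draws N d)"
proof -
  let ?P = "{p \<in> {..<N} \<times> {..<N}. fst p \<noteq> snd p}"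
  have off: "card {p \<in> A \<times> A. fst p \<noteq> snd p} = card A * (card A - 1)" if "finite A" for A :: "nat set"
  proof -
    have "{p \<in> A \<times> A. fst p \<noteq> snd p} = (SIGMA a:A. A - {a})" by auto
    then show ?thesis using that by simp
  qed
  have eq: "card {ns \<in> draws N d. fst p \<in> set ns \<and> snd p \<in> set ns} =
      card {ns \<in> draws N d. a \<in> set ns \<and> b \<in> set ns}" if "p \<in> ?P" for p
  proof -
    obtain \<pi> where "bij_betw \<pi> {..<N} {..<N} \<and> \<pi> a = fst p \<and> \<pi> b = snd p"
      using ex_bij_betw_pair[OF assms, of "fst p" "snd p"] \<open>p \<in> ?P\<close> by auto
    then show ?thesis using card_draws_superset_image[of \<pi> N "{a, b}" d] assms by simp
  qed
  have "N * (N - 1) * card {ns \<in> draws N d. a \<in> set ns \<and> b \<in> set ns} =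
      (\<Sum>p\<in>?P. card {ns \<in> draws N d. fst p \<in> set ns \<and> snd p \<in> set ns})"
    using eq off[of "{..<N}"] by simp
  also have "\<dots> = (\<Sum>p\<in>?P. \<Sum>ns\<in>draws N d. of_bool (fst p \<in> set ns \<and> snd p \<in> set ns))"
    by (intro sum.cong refl) (simp add: of_bool_def sum.If_cases Int_def)
  also have "\<dots> = (\<Sum>ns\<in>draws N d. \<Sum>p\<in>?P. of_bool (fst p \<in> set ns \<and> snd p \<in> set ns))"
    by (rule sum.swap)
  also have "\<dots> = (\<Sum>ns\<in>draws N d. d * (d - 1))"
  proof (intro sum.cong refl)
    fix ns assume ns: "ns \<in> draws N d"
    then have "?P \<inter> {p. fst p \<in> set ns \<and> snd p \<in> set ns} = {p \<in> set ns \<times> set ns. fst p \<noteq> snd p}"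
      by (auto simp: draws_def)
    then have "(\<Sum>p\<in>?P. of_bool (fst p \<in> set ns \<and> snd p \<in> set ns)) = card (set ns) * (card (set ns) - 1)"
      using off[of "set ns"] by (simp add: of_bool_def sum.If_cases)
    also have "card (set ns) = d" using ns by (auto simp: draws_def distinct_card)
    finally show "(\<Sum>p\<in>?P. of_bool (fst p \<in> set ns \<and> snd p \<in> set ns)) = d * (d - 1)" .
  qed
  finally show ?thesis by simp
qed

text \<open>
  The number of sampled servers in \<open>I\<close> is hypergeometric with mean \<open>\<mu>\<close>. Its indicators are
  negatively correlated, hence the variance is at most \<open>\<mu>\<close>, as for independent draws.
\<close>

lemma draws_second_moment:
  assumes I: "I \<subseteq> {..<N}" and d: "0 < d" "d \<le> N"
  defines "D \<equiv> real (card (draws N d))" and "\<mu> \<equiv> real d * real (card I) / real N"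
  shows "(\<Sum>ns\<in>draws N d. (real (card (I \<inter> set ns)) - \<mu>)\<^sup>2) \<le> D * \<mu>"
proof -
  have fin: "finite I" using I finite_subset by blast
  have N: "0 < N" using d by simp
  have cardI: "card I \<le> N" using card_mono[OF _ I] by simp
  define H where "H ns = real (card (I \<inter> set ns))" for ns
  have H: "H ns = (\<Sum>a\<in>I. of_bool (a \<in> set ns))" for ns
    unfolding H_def using fin by (simp add: of_bool_def sum.If_cases)
  have one: "(\<Sum>ns\<in>draws N d. of_bool (a \<in> set ns)) = D * real d / real N" if "a \<in> I" for a
  proof -
    have "real N * real (card {ns \<in> draws N d. a \<in> set ns}) = real d * D"
      using card_draws_containing[of a N d] that I unfolding D_def
      by (metis lessThan_iff of_nat_mult subsetD)
    then show ?thesis using N by (simp add: of_bool_def sum.If_cases Int_def field_simps)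
  qed
  have two: "(\<Sum>ns\<in>draws N d. of_bool (a \<in> set ns) * of_bool (b \<in> set ns))
       \<le> D * (real d / real N) * (real d - 1) / (real N - 1)" if "a \<in> I" "b \<in> I" "a \<noteq> b" for a b
  proof -
    have lt: "a < N" "b < N" using that I by auto
    then have N1: "1 < N" using that by linarith
    have "real N * (real N - 1) * real (card {ns \<in> draws N d. a \<in> set ns \<and> b \<in> set ns}) = real d * (real d - 1) * D"
      using arg_cong[OF card_draws_containing_pair[OF lt that(3), of d], of real] N1 d
      unfolding D_def by (simp add: of_nat_diff)
    then have "real (card {ns \<in> draws N d. a \<in> set ns \<and> b \<in> set ns}) = D * (real d / real N) * (real d - 1) / (real N - 1)"
      using N1 by (simp add: field_simps)
    then show ?thesis by (simp add: of_bool_conj[symmetric] del: of_bool_conj) (simp add: of_bool_def sum.If_cases Int_def)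
  qed
  have sum1: "(\<Sum>ns\<in>draws N d. H ns) = D * \<mu>"
  proof -
    have "(\<Sum>ns\<in>draws N d. H ns) = (\<Sum>a\<in>I. \<Sum>ns\<in>draws N d. of_bool (a \<in> set ns))"
      unfolding H by (rule sum.swap)
    also have "\<dots> = (\<Sum>a\<in>I. D * real d / real N)" by (intro sum.cong refl one)
    also have "\<dots> = D * \<mu>" by (simp add: \<mu>_def)
    finally show ?thesis .
  qed
  have sum2: "(\<Sum>ns\<in>draws N d. (H ns)\<^sup>2) \<le> D * \<mu> + D * \<mu>\<^sup>2"
  proof -
    have "(\<Sum>ns\<in>draws N d. (H ns)\<^sup>2) =
        (\<Sum>ns\<in>draws N d. \<Sum>a\<in>I. \<Sum>b\<in>I. of_bool (a \<in> set ns) * of_bool (b \<in> set ns))"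
      unfolding H power2_eq_square sum_product ..
    also have "\<dots> = (\<Sum>a\<in>I. \<Sum>ns\<in>draws N d. \<Sum>b\<in>I. of_bool (a \<in> set ns) * of_bool (b \<in> set ns))"
      by (rule sum.swap)
    also have "\<dots> = (\<Sum>a\<in>I. \<Sum>b\<in>I. \<Sum>ns\<in>draws N d. of_bool (a \<in> set ns) * of_bool (b \<in> set ns))"
      by (intro sum.cong refl sum.swap)
    also have "\<dots> \<le> (\<Sum>a\<in>I. \<Sum>b\<in>I. (if b = a then D * real d / real N
        else D * (real d / real N) * (real d - 1) / (real N - 1)))"
    proof (intro sum_mono)
      fix a b assume ab: "a \<in> I" "b \<in> I"
      have "of_bool (a \<in> set ns) * of_bool (a \<in> set ns) = (of_bool (a \<in> set ns) :: real)" for ns by simp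
      then show "(\<Sum>ns\<in>draws N d. of_bool (a \<in> set ns) * of_bool (b \<in> set ns)) \<le>
        (if b = a then D * real d / real N else D * (real d / real N) * (real d - 1) / (real N - 1))"
        using two[OF ab] one[OF ab(1)] by (cases "b = a") auto
    qed
    also have "\<dots> = (\<Sum>a\<in>I. D * real d / real N +
       (real (card I) - 1) * (D * (real d / real N) * (real d - 1) / (real N - 1)))"
    proof (intro sum.cong refl)
      fix a assume a: "a \<in> I"
      then have "0 < card I" using fin card_gt_0_iff by blast
      then have "real (card (I - {a})) = real (card I) - 1"
        using fin a by (simp add: of_nat_diff)
      then show "(\<Sum>b\<in>I. (if b = a then D * real d / real N else D * (real d / real N) * (real d - 1) / (real N - 1)))
        = D * real d / real N + (real (card I) - 1) * (D * (real d / real N) * (real d - 1) / (real N - 1))"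
        using fin a by (subst sum.remove[of _ a]) auto
    qed
    also have "\<dots> = D * \<mu> + D * (\<mu> * ((real (card I) - 1) * (real d - 1) / (real N - 1)))"
      unfolding \<mu>_def sum_constant by (simp add: divide_inverse algebra_simps)
    also have "\<dots> \<le> D * \<mu> + D * (\<mu> * \<mu>)"
    proof (cases "card I = 0 \<or> N = 1")
      case True
      then show ?thesis
      proof
        assume "card I = 0" then show ?thesis by (simp add: \<mu>_def)
      next
        assume "N = 1" then show ?thesis by (simp add: D_def \<mu>_def)
      qed
    next
      case False
      then have r: "1 \<le> real (card I)" "1 < real N" "1 \<le> real d" "real d \<le> real N" using N d by auto
      have "(real d - 1) / (real N - 1) \<le> real d / real N" using r by (simp add: field_simps)
      then have "(real (card I) - 1) * ((real d - 1) / (real N - 1)) \<le> real (card I) * (real d / real N)"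
        using r by (intro mult_mono) auto
      then have "(real (card I) - 1) * (real d - 1) / (real N - 1) \<le> \<mu>"
        by (simp add: \<mu>_def mult.commute)
      then show ?thesis by (intro add_left_mono mult_left_mono) (auto simp: D_def \<mu>_def)
    qed
    finally show ?thesis by (simp add: power2_eq_square)
  qed
  have "(\<Sum>ns\<in>draws N d. (H ns - \<mu>)\<^sup>2) = (\<Sum>ns\<in>draws N d. (H ns)\<^sup>2) - 2 * \<mu> * (\<Sum>ns\<in>draws N d. H ns) + D * \<mu>\<^sup>2"
    by (simp add: power2_diff sum.distrib sum_subtractf sum_distrib_left D_def algebra_simps)
  also have "\<dots> \<le> D * \<mu>" using sum1 sum2 by (simp add: power2_eq_square algebra_simps)
  finally show ?thesis unfolding H_def .
qed

text \<open>
  Chebyshev's inequality: if the mean number of idle servers in the sample exceeds \<open>l\<close> by a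
  fixed factor, then a sample with fewer than \<open>l\<close> idle servers has probability of order
  \<open>1 / l\<close>. Such a sample spoils at most \<open>l\<close> tasks, so this modest rate is all that is needed.
\<close>

lemma few_idle_draws:
  assumes I: "I \<subseteq> {..<N}" and l: "0 < l" "l \<le> d" "d \<le> N" and \<delta>: "0 < \<delta>"
    and \<mu>: "(1 + \<delta>) * real l \<le> real d * real (card I) / real N"
  shows "real (card {ns \<in> draws N d. card (I \<inter> set ns) < l}) \<le> real (card (draws N d)) * ((1 + \<delta>)\<^sup>2 / \<delta>\<^sup>2 / real l)"
proof -
  let ?\<mu> = "real d * real (card I) / real N" and ?B = "{ns \<in> draws N d. card (I \<inter> set ns) < l}"
  \<comment> \<open>The mean exceeds \<open>l\<close> by at least the fraction \<open>c\<close> of itself.\<close>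
  define c where "c = \<delta> / (1 + \<delta>)"
  have c: "0 < c" using \<delta> by (simp add: c_def)
  have \<mu>0: "0 < ?\<mu>" using \<mu> l \<delta> by (smt (verit, best) mult_pos_pos of_nat_0_less_iff)
  have gap: "c * ?\<mu> \<le> ?\<mu> - real l"
  proof -
    have "real l \<le> ?\<mu> / (1 + \<delta>)"
      using \<mu> \<delta> by (subst pos_le_divide_eq) (simp_all add: mult.commute)
    moreover have "x - x / (1 + \<delta>) = c * x" for x :: real using \<delta> by (simp add: c_def field_simps)
    then have "?\<mu> - ?\<mu> / (1 + \<delta>) = c * ?\<mu>" .
    ultimately show ?thesis by linarith
  qed
  have "real (card ?B) * (c * ?\<mu>)\<^sup>2 = (\<Sum>ns\<in>?B. (c * ?\<mu>)\<^sup>2)" by simp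
  also have "\<dots> \<le> (\<Sum>ns\<in>?B. (real (card (I \<inter> set ns)) - ?\<mu>)\<^sup>2)"
  proof (intro sum_mono)
    fix ns assume "ns \<in> ?B"
    then have "c * ?\<mu> \<le> ?\<mu> - real (card (I \<inter> set ns))" using gap by auto
    then have "(c * ?\<mu>)\<^sup>2 \<le> (?\<mu> - real (card (I \<inter> set ns)))\<^sup>2"
      using c \<mu>0 by (intro power_mono) auto
    then show "(c * ?\<mu>)\<^sup>2 \<le> (real (card (I \<inter> set ns)) - ?\<mu>)\<^sup>2" by (simp add: power2_commute)
  qed
  also have "\<dots> \<le> (\<Sum>ns\<in>draws N d. (real (card (I \<inter> set ns)) - ?\<mu>)\<^sup>2)"
    by (intro sum_mono2) auto
  also have "\<dots> \<le> real (card (draws N d)) * ?\<mu>"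
    using draws_second_moment[OF I, of d] l by auto
  finally have "real (card ?B) * (c\<^sup>2 * ?\<mu>) * ?\<mu> \<le> real (card (draws N d)) * ?\<mu>"
    by (simp add: power2_eq_square algebra_simps)
  then have *: "real (card ?B) * (c\<^sup>2 * ?\<mu>) \<le> real (card (draws N d))"
    using \<mu>0 by (rule mult_right_le_imp_le)
  have "real l \<le> ?\<mu>" using \<mu> \<delta> by (smt (verit) l mult_le_cancel_right1 of_nat_0_less_iff)
  then have "real (card ?B) * (c\<^sup>2 * real l) \<le> real (card (draws N d))"
    by (intro order_trans[OF _ *] mult_left_mono) auto
  then show ?thesis using c l \<delta> by (simp add: c_def field_simps power_divide)
qed

section \<open>Coupling with an infinite-server queue\<close>

definition busy :: "nat \<Rightarrow> ledger \<Rightarrow> real \<Rightarrow> nat" where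
  "busy N L t = card {n. n < N \<and> 1 \<le> pending L t n}"

definition excess :: "nat \<Rightarrow> ledger \<Rightarrow> real \<Rightarrow> nat" where
  "excess N L t = (\<Sum>n<N. pending L t n - 1)"

lemma card_eq_sum_of_bool: "card {n. n < (N::nat) \<and> p n} = (\<Sum>n<N. of_bool (p n))"
proof -
  have "card {n \<in> {..<N}. p n} = (\<Sum>n\<in>{n \<in> {..<N}. p n}. 1)" by simp
  also have "\<dots> = (\<Sum>n<N. if p n then 1 else 0)" by (rule sum.inter_filter) simp
  finally show ?thesis by (simp only: of_bool_def lessThan_iff)
qed

lemma pending_antimono: "s \<le> t \<Longrightarrow> pending L t n \<le> pending L s n"
  unfolding pending_def length_filter_conv_card by (intro card_mono) auto

lemma pending_cong: "L n = L' n \<Longrightarrow> pending L t n = pending L' t n"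
  by (simp add: pending_def)

lemma fold_assign_other: "n \<notin> set ns \<Longrightarrow> fold (assign b t) (zip ns ss) L n = L n"
proof (induction ns arbitrary: ss L)
  case (Cons m ns)
  then show ?case by (cases ss) (auto simp: assign_def)
qed simp

lemma fold_assign_nth:
  "distinct ns \<Longrightarrow> j < length ns \<Longrightarrow> length ss = length ns \<Longrightarrow>
    fold (assign b t) (zip ns ss) L (ns ! j) = assign b t (ns ! j, ss ! j) L (ns ! j)"
proof (induction ns arbitrary: ss L j)
  case (Cons m ns)
  then obtain s ss' where ss: "ss = s # ss'" by (cases ss) auto
  show ?case
  proof (cases j)
    case 0
    then show ?thesis using Cons.prems fold_assign_other[of m ns b t ss'] by (simp add: ss)
  next
    case (Suc i)
    then have i: "i < length ns" "ns ! i \<noteq> m" using Cons.prems by auto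
    have "fold (assign b t) (zip (m # ns) ss) L ((m # ns) ! j) =
        assign b t (ns ! i, ss' ! i) (assign b t (m, s) L) (ns ! i)"
      using Cons.IH[of i ss'] Cons.prems i by (simp add: ss Suc)
    also have "\<dots> = assign b t (ns ! i, ss' ! i) L (ns ! i)"
      using i by (simp add: assign_def pending_def)
    finally show ?thesis by (simp add: ss Suc)
  qed
qed simp

lemma pending_assign_bounds:
  "pending L t n \<le> pending (assign b e (n, s) L) t n \<and> pending (assign b e (n, s) L) t n \<le> pending L t n + 1"
  by (simp add: assign_def pending_def)

text \<open>At an idle server all recorded departures are in the past, so service starts on arrival.\<close>

lemma pending_assign_idle:
  assumes "pending L e n = 0" "1 \<le> b" "e \<le> t"
  shows "pending (assign b e (n, s) L) t n = of_bool (t < e + s)"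
proof -
  have le: "\<forall>c\<in>set (L n). c \<le> e"
    using assms(1) by (auto simp: pending_def filter_empty_conv)
  then have "Max (insert e (set (L n))) = e" by (intro Max_eqI) auto
  moreover have "filter ((<) t) (L n) = []" 
    unfolding filter_empty_conv using le assms(3) by (auto intro: order_trans dest: bspec simp: not_less)
  moreover have "enat 0 < b" using assms(2) 
    by (cases b) (auto simp: one_enat_def)
  ultimately show ?thesis using assms(1) by (simp add: assign_def pending_def)
qed

text \<open>In the list sorted by queue length, all entries in front of a busy server have to include all the idle ones.\<close>

lemma jsq_choice_idle:
  fixes x :: "nat \<Rightarrow> nat"
  assumes "l \<le> length (filter (\<lambda>n. x n = 0) ns)" and "n \<in> set (jsq_choice l x ns)"
  shows "x n = 0"
proof (rule ccontr)
  define ys where "ys = map x (sort_key x ns)"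
  assume "x n \<noteq> 0"
  from assms(2) obtain i where i: "i < length ns" "i < l" "sort_key x ns ! i = n"
    unfolding jsq_choice_def by (auto simp: in_set_conv_nth)
  have "ys ! i \<noteq> 0" using i \<open>x n \<noteq> 0\<close> by (simp add: ys_def)
  have srt: "sorted ys" by (simp add: ys_def)
  have "{j. j < length ns \<and> ys ! j = 0} \<subseteq> {..<i}"
  proof
    fix j assume j: "j \<in> {j. j < length ns \<and> ys ! j = 0}"
    show "j \<in> {..<i}"
    proof (rule ccontr)
      assume "j \<notin> {..<i}"
      then have "ys ! i \<le> ys ! j" using j srt by (intro sorted_nth_mono) (auto simp: ys_def)
      then show False using j \<open>ys ! i \<noteq> 0\<close> by auto
    qed
  qed
  then have "card {j. j < length ns \<and> ys ! j = 0} \<le> i"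
    using card_mono[of "{..<i}"] by auto
  moreover have "card {j. j < length ns \<and> ys ! j = 0} = length (filter (\<lambda>n. x n = 0) (sort_key x ns))"
    unfolding length_filter_conv_card ys_def by (rule arg_cong[where f=card]) auto
  moreover have "\<dots> = length (filter (\<lambda>n. x n = 0) ns)"
    by (metis mset_filter mset_sort size_mset)
  ultimately show False using assms(1) i by simp
qed

text \<open>
  How one batch changes the number of busy servers and the number of waiting tasks. If all
  chosen servers are idle, the batch behaves as in an infinite-server queue; otherwise it
  causes errors of at most \<open>l\<close>.
\<close>

lemma batch_step:
  fixes L b e ns ss
  defines "L' \<equiv> fold (assign b e) (zip ns ss) L"
  assumes ns: "distinct ns" "set ns \<subseteq> {..<N}" "length ns = l" "length ss = l"
    and "1 \<le> b" "e \<le> t"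
  shows "busy N L t \<le> busy N L' t \<and> busy N L' t \<le> busy N L t + l \<and> excess N L' t \<le> excess N L t + l"
    and "\<forall>n\<in>set ns. pending L e n = 0 \<Longrightarrow> busy N L' t = busy N L t + card {j. j < l \<and> t < e + ss ! j}
      \<and> excess N L' t = excess N L t"
proof -
  have rest: "pending L' t n = pending L t n" if "n \<notin> set ns" for n
    unfolding L'_def by (rule pending_cong) (use that in \<open>simp add: fold_assign_other\<close>)
  have pend: "pending L' t (ns ! j) = pending (assign b e (ns ! j, ss ! j) L) t (ns ! j)" if "j < l" for j
    unfolding L'_def by (rule pending_cong) (use that ns in \<open>simp add: fold_assign_nth\<close>)
  have bd: "pending L t n \<le> pending L' t n \<and> pending L' t n \<le> pending L t n + of_bool (n \<in> set ns)" for n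
  proof (cases "n \<in> set ns")
    case True
    then obtain j where "j < l" "n = ns ! j" using ns by (auto simp: in_set_conv_nth)
    then show ?thesis using pend[of j] pending_assign_bounds True by simp
  qed (simp add: rest)
  have l: "(\<Sum>n<N. of_bool (n \<in> set ns)) = l"
  proof -
    have "{n. n < N \<and> n \<in> set ns} = set ns" using ns by auto
    then show ?thesis using card_eq_sum_of_bool[of N "\<lambda>n. n \<in> set ns"] ns by (simp add: distinct_card)
  qed
  have "busy N L t \<le> busy N L' t" unfolding busy_def card_eq_sum_of_bool
  proof (intro sum_mono)
    fix n show "of_bool (1 \<le> pending L t n) \<le> (of_bool (1 \<le> pending L' t n) :: nat)"
      using bd[of n] by (cases "1 \<le> pending L t n") auto
  qed
  moreover have "busy N L' t \<le> (\<Sum>n<N. of_bool (1 \<le> pending L t n) + of_bool (n \<in> set ns))"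
    unfolding busy_def card_eq_sum_of_bool
  proof (intro sum_mono)
    fix n show "of_bool (1 \<le> pending L' t n) \<le> of_bool (1 \<le> pending L t n) + (of_bool (n \<in> set ns) :: nat)"
      using bd[of n] by (cases "n \<in> set ns"; cases "1 \<le> pending L' t n") auto
  qed
  moreover have "excess N L' t \<le> (\<Sum>n<N. (pending L t n - 1) + of_bool (n \<in> set ns))"
    unfolding excess_def
  proof (intro sum_mono)
    fix n show "pending L' t n - 1 \<le> pending L t n - 1 + of_bool (n \<in> set ns)"
      using bd[of n] rest[of n] by (cases "n \<in> set ns") auto
  qed
  ultimately show "busy N L t \<le> busy N L' t \<and> busy N L' t \<le> busy N L t + l \<and> excess N L' t \<le> excess N L t + l"
    unfolding sum.distrib l by (simp add: busy_def excess_def card_eq_sum_of_bool)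
  assume idle: "\<forall>n\<in>set ns. pending L e n = 0"
  have old: "pending L t n = 0" if "n \<in> set ns" for n
    using idle that pending_antimono[OF \<open>e \<le> t\<close>, of L n] by auto
  have new: "pending L' t (ns ! j) = of_bool (t < e + ss ! j)" if "j < l" for j
    using pend[OF that] pending_assign_idle[of L e "ns ! j" b t "ss ! j"] idle that ns assms(6,7) by simp
  have split: "(\<Sum>n<N. f n) = (\<Sum>n\<in>{..<N} - set ns. f n) + (\<Sum>j<l. f (ns ! j))" for f :: "nat \<Rightarrow> nat"
  proof -
    have "(\<Sum>n\<in>set ns. f n) = (\<Sum>j<l. f (ns ! j))"
      using bij_betw_nth[OF ns(1), of "{..<l}" "set ns"] ns by (intro sum.reindex_bij_betw[symmetric]) simp
    then show ?thesis using sum.subset_diff[OF ns(2), of f] by simp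
  qed
  have nth: "ns ! j \<in> set ns" if "j < l" for j using that ns by auto
  show "busy N L' t = busy N L t + card {j. j < l \<and> t < e + ss ! j} \<and> excess N L' t = excess N L t"
  proof (intro conjI)
    have "(\<Sum>n\<in>{..<N} - set ns. of_bool (1 \<le> pending L' t n)) = (\<Sum>n\<in>{..<N} - set ns. of_bool (1 \<le> pending L t n) :: nat)"
      "(\<Sum>n\<in>{..<N} - set ns. pending L' t n - 1) = (\<Sum>n\<in>{..<N} - set ns. pending L t n - 1)"
      by (rule sum.cong; use rest in simp)+
    moreover have "(\<Sum>j<l. of_bool (1 \<le> pending L' t (ns ! j))) = (\<Sum>j<l. of_bool (t < e + ss ! j) :: nat)"
      by (rule sum.cong) (use new in auto)
    moreover have "(\<Sum>j<l. of_bool (1 \<le> pending L t (ns ! j))) = (\<Sum>j<l. 0 :: nat)"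
      "(\<Sum>j<l. pending L t (ns ! j) - 1) = (\<Sum>j<l. 0 :: nat)" 
      "(\<Sum>j<l. pending L' t (ns ! j) - 1) = (\<Sum>j<l. 0 :: nat)"
      by (rule sum.cong; use old nth new in simp)+
    ultimately show "busy N L' t = busy N L t + card {j. j < l \<and> t < e + ss ! j}" "excess N L' t = excess N L t"
      unfolding busy_def excess_def card_eq_sum_of_bool split by (simp_all only: sum.neutral_const add_0_right)
  qed
qed

definition few_idle :: "enat \<Rightarrow> nat \<Rightarrow> 'a primitives \<Rightarrow> nat \<Rightarrow> 'a \<Rightarrow> bool" where
  "few_idle b l P k \<omega> \<longleftrightarrow>
     length (filter (\<lambda>n. pending (ledger_at b l P k \<omega>) (epoch P k \<omega>) n = 0) (sample P k \<omega>)) < l"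

definition initial_excess :: "nat \<Rightarrow> 'a primitives \<Rightarrow> 'a \<Rightarrow> nat" where
  "initial_excess N P \<omega> = (\<Sum>n<N. init P \<omega> ! n - 1)"

text \<open>
  The initial tasks still present in the infinite-server queue, into which only the first task
  of each server is taken over.
\<close>

definition initial_present :: "nat \<Rightarrow> 'a primitives \<Rightarrow> real \<Rightarrow> 'a \<Rightarrow> nat" where
  "initial_present N P t \<omega> = card {n. n < N \<and> 1 \<le> init P \<omega> ! n \<and> t < svc0 P n 0 \<omega>}"

text \<open>
  The tasks of batch \<open>k\<close> still present in the infinite-server queue, where all of them start
  service on arrival.
\<close>

definition batch_present :: "nat \<Rightarrow> 'a primitives \<Rightarrow> real \<Rightarrow> nat \<Rightarrow> 'a \<Rightarrow> nat" where
  "batch_present l P t k \<omega> = card {j. j < l \<and> t < epoch P k \<omega> + svc P k j \<omega>}"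

lemma batch_present_le: "batch_present l P t k \<omega> \<le> l"
  unfolding batch_present_def by (rule order_trans[OF card_mono[of "{..<l}"]]) auto

text \<open>The outcomes, of total probability one, to which the pathwise coupling applies.\<close>

definition regular :: "nat \<Rightarrow> nat \<Rightarrow> 'a primitives \<Rightarrow> 'a \<Rightarrow> bool" where
  "regular N d P \<omega> \<longleftrightarrow> length (init P \<omega>) = N \<and> (\<forall>k. 0 < gap P k \<omega>) \<and> (\<forall>k. sample P k \<omega> \<in> draws N d) \<and>
     (\<forall>n j. 0 < svc0 P n j \<omega>) \<and> filterlim (\<lambda>k. epoch P k \<omega>) at_top sequentially"

lemma regular_strict_mono_epoch: "regular N d P \<omega> \<Longrightarrow> strict_mono (\<lambda>k. epoch P k \<omega>)"
  by (rule strict_mono_Suc_iff[THEN iffD2]) (auto simp: epoch_def regular_def)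

lemma regular_epoch_pos: "regular N d P \<omega> \<Longrightarrow> 0 < epoch P k \<omega>"
  unfolding epoch_def regular_def by (intro sum_pos) auto

lemma finite_epochs:
  assumes "filterlim (\<lambda>k. epoch P k \<omega>) at_top sequentially"
  shows "finite {k. epoch P k \<omega> \<le> t}"
proof -
  have "\<forall>\<^sub>F k in sequentially. t < epoch P k \<omega>"
    using assms by (simp add: filterlim_at_top_dense)
  then show ?thesis
    by (auto simp: eventually_sequentially finite_nat_set_iff_bounded not_less[symmetric])
qed

text \<open>
  As the epochs increase, the batches that have arrived by time \<open>t\<close> are the first ones, so
  that the ledger used by \<open>queue_length\<close> records exactly these batches.
\<close>

lemma regular_epochs_le:
  assumes "regular N d P \<omega>"
  shows "{k. epoch P k \<omega> \<le> t} = {..<card {k. epoch P k \<omega> \<le> t}}"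
proof -
  let ?S = "{k. epoch P k \<omega> \<le> t}"
  have fin: "finite ?S" using assms finite_epochs by (auto simp: regular_def)
  have down: "i \<in> ?S" if "k \<in> ?S" "i \<le> k" for i k
    using that monoD[OF strict_mono_mono[OF regular_strict_mono_epoch[OF assms]], of i k] by auto
  \<comment> \<open>The least index not in \<open>?S\<close> bounds the downward closed set \<open>?S\<close>.\<close>
  obtain m where "m \<notin> ?S" using fin infinite_UNIV_nat by (metis UNIV_eq_I)
  define K where "K = (LEAST m. m \<notin> ?S)"
  have "K \<notin> ?S" unfolding K_def by (rule LeastI) fact
  moreover have "k \<in> ?S" if "k < K" for k using not_less_Least[of k "\<lambda>m. m \<notin> ?S"] that unfolding K_def by blast
  ultimately have "?S = {..<K}" using down by (auto simp: set_eq_iff) (meson not_less)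
  then show ?thesis by simp
qed

text \<open>
  The error \<open>B\<close> collects the initial tasks that have to wait and all tasks of batches that
  find too few idle servers. Induction over the batches, uniformly in the observation time
  \<open>t\<close>: a departure is already determined when the task is assigned, so nothing has to be said
  about departures.
\<close>

lemma coupling_invariant:
  assumes reg: "regular N d P \<omega>" and l: "l \<le> d" and b: "1 \<le> b" and t: "\<forall>i<k. epoch P i \<omega> \<le> t"
  defines "L \<equiv> ledger_at b l P k \<omega>"
    and "X \<equiv> initial_present N P t \<omega> + (\<Sum>i<k. batch_present l P t i \<omega>)"
    and "B \<equiv> initial_excess N P \<omega> + l * card {i. i < k \<and> few_idle b l P i \<omega>}"
  shows "busy N L t \<le> X + B \<and> X \<le> busy N L t + B \<and> excess N L t \<le> B"
  using t unfolding L_def X_def B_def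
proof (induction k)
  case 0
  let ?L = "ledger_at b l P 0 \<omega>"
  have len: "length (init P \<omega>) = N" using reg by (simp add: regular_def)
  have pend: "pending ?L t n \<le> init P \<omega> ! n" if "n < N" for n
    using that len by (simp add: pending_def) (metis length_filter_le length_map length_upt minus_nat.diff_0)
  have one: "pending ?L t n = of_bool (t < svc0 P n 0 \<omega>)" if "n < N" "init P \<omega> ! n = 1" for n
    using that len by (simp add: pending_def)
  have ind: "of_bool (1 \<le> pending ?L t n) \<le> of_bool (1 \<le> init P \<omega> ! n \<and> t < svc0 P n 0 \<omega>) + (init P \<omega> ! n - 1)
     \<and> of_bool (1 \<le> init P \<omega> ! n \<and> t < svc0 P n 0 \<omega>) \<le> of_bool (1 \<le> pending ?L t n) + (init P \<omega> ! n - 1)"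
    if "n < N" for n
  proof -
    consider "init P \<omega> ! n = 0" | "init P \<omega> ! n = 1" | "2 \<le> init P \<omega> ! n" by linarith
    then show ?thesis
    proof cases
      case 1 then show ?thesis using pend[OF that] by simp
    next
      case 2 then show ?thesis using one[OF that] by simp
    next
      case 3
      have "of_bool p \<le> (1::nat)" for p by simp
      moreover have "1 \<le> init P \<omega> ! n - 1" using 3 by simp
      ultimately show ?thesis by (meson le_trans trans_le_add2)
    qed
  qed
  have "excess N ?L t \<le> initial_excess N P \<omega>"
    unfolding excess_def initial_excess_def using pend by (intro sum_mono diff_le_mono) auto
  moreover have "busy N ?L t \<le> initial_present N P t \<omega> + initial_excess N P \<omega>"
    unfolding busy_def initial_present_def initial_excess_def card_eq_sum_of_bool sum.distrib[symmetric]
    by (rule sum_mono) (rule ind[THEN conjunct1], simp)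
  moreover have "initial_present N P t \<omega> \<le> busy N ?L t + initial_excess N P \<omega>"
    unfolding busy_def initial_present_def initial_excess_def card_eq_sum_of_bool sum.distrib[symmetric]
    by (rule sum_mono) (rule ind[THEN conjunct2], simp)
  ultimately show ?case by simp
next
  case (Suc k)
  let ?L = "ledger_at b l P k \<omega>" and ?L' = "ledger_at b l P (Suc k) \<omega>" and ?e = "epoch P k \<omega>"
  let ?ss = "map (\<lambda>j. svc P k j \<omega>) [0..<l]" and ?ns = "jsq_choice l (pending ?L ?e) (sample P k \<omega>)"
  let ?F = "\<lambda>k. {i. i < k \<and> few_idle b l P i \<omega>}"
  have IH: "busy N ?L t \<le> initial_present N P t \<omega> + (\<Sum>i<k. batch_present l P t i \<omega>) + (initial_excess N P \<omega> + l * card (?F k))"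
    "initial_present N P t \<omega> + (\<Sum>i<k. batch_present l P t i \<omega>) \<le> busy N ?L t + (initial_excess N P \<omega> + l * card (?F k))"
    "excess N ?L t \<le> initial_excess N P \<omega> + l * card (?F k)"
    using Suc by auto
  have L': "?L' = fold (assign b ?e) (zip ?ns ?ss) ?L" by (simp add: Let_def)
  have smp: "sample P k \<omega> \<in> draws N d" using reg by (simp add: regular_def)
  have ns: "distinct ?ns" "set ?ns \<subseteq> {..<N}" "length ?ns = l" "length ?ss = l" "?e \<le> t"
    using smp l Suc.prems set_take_subset[of l "sort_key (pending ?L ?e) (sample P k \<omega>)"]
    by (auto simp: jsq_choice_def draws_def)
  note step = batch_step[OF ns(1-4) b ns(5), of ?L, folded L']
  have bp: "card {j. j < l \<and> t < ?e + ?ss ! j} = batch_present l P t k \<omega>"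
    unfolding batch_present_def by (rule arg_cong[where f=card]) auto
  show ?case
  proof (cases "few_idle b l P k \<omega>")
    case True
    then have "?F (Suc k) = insert k (?F k)" by (auto simp: less_Suc_eq)
    then have "card (?F (Suc k)) = Suc (card (?F k))" by simp
    then show ?thesis using IH step(1) batch_present_le[of l P t k \<omega>] by (simp add: distrib_left del: ledger_at.simps)
  next
    case False
    then have "?F (Suc k) = ?F k" by (auto simp: less_Suc_eq)
    moreover have "\<forall>n\<in>set ?ns. pending ?L ?e n = 0"
      using False jsq_choice_idle[of l "pending ?L ?e" "sample P k \<omega>"]
      unfolding few_idle_def not_less by blast
    ultimately show ?thesis using IH step(2) by (simp add: bp del: ledger_at.simps)
  qed
qed

text \<open>
  The population of the infinite-server queue that is fed with the same arrivals and service
  requirements.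
\<close>

definition present :: "nat \<Rightarrow> nat \<Rightarrow> 'a primitives \<Rightarrow> real \<Rightarrow> 'a \<Rightarrow> nat" where
  "present N l P t \<omega> = initial_present N P t \<omega> + (\<Sum>k | epoch P k \<omega> \<le> t. batch_present l P t k \<omega>)"

definition arrived :: "nat \<Rightarrow> 'a primitives \<Rightarrow> real \<Rightarrow> 'a \<Rightarrow> nat" where
  "arrived l P t \<omega> = l * card {k. epoch P k \<omega> \<le> t}"

text \<open>
  Tasks present at time \<open>t\<close> either were present at time \<open>s\<close> or have arrived in between. With
  the monotonicity of the arrivals, this controls the population between two grid points.
\<close>

lemma present_arrived:
  assumes fin: "\<And>t. finite {k. epoch P k \<omega> \<le> t}" and st: "s \<le> t"
  shows "present N l P t \<omega> + arrived l P s \<omega> \<le> present N l P s \<omega> + arrived l P t \<omega>"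
proof -
  let ?S = "{k. epoch P k \<omega> \<le> s}" and ?T = "{k. epoch P k \<omega> \<le> t}"
  have sub: "?S \<subseteq> ?T" using st by auto
  have "initial_present N P t \<omega> \<le> initial_present N P s \<omega>"
    unfolding initial_present_def using st by (intro card_mono) auto
  moreover have "(\<Sum>k\<in>?S. batch_present l P t k \<omega>) \<le> (\<Sum>k\<in>?S. batch_present l P s k \<omega>)"
    unfolding batch_present_def using st by (intro sum_mono card_mono) auto
  moreover have "(\<Sum>k\<in>?T - ?S. batch_present l P t k \<omega>) \<le> (\<Sum>k\<in>?T - ?S. l)"
    by (intro sum_mono batch_present_le)
  moreover have "(\<Sum>k\<in>?T. batch_present l P t k \<omega>) =
      (\<Sum>k\<in>?T - ?S. batch_present l P t k \<omega>) + (\<Sum>k\<in>?S. batch_present l P t k \<omega>)"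
    by (rule sum.subset_diff[OF sub fin])
  moreover have "l * card ?T = (\<Sum>k\<in>?T - ?S. l) + l * card ?S"
    using sum.subset_diff[OF sub fin, of "\<lambda>_. l"] by (simp add: mult.commute)
  ultimately show ?thesis unfolding present_def arrived_def by linarith
qed

lemma arrived_mono:
  assumes fin: "\<And>t. finite {k. epoch P k \<omega> \<le> t}" and st: "s \<le> t"
  shows "arrived l P s \<omega> \<le> arrived l P t \<omega>"
  unfolding arrived_def using assms by (intro mult_left_mono card_mono) auto

text \<open>
  Batches that arrive while more than \<open>\<theta>\<close> servers are busy are left out, because only for the
  others the sample is likely to contain enough idle servers. Conditions under which \<open>\<theta>\<close> is
  never exceeded, so that nothing is left out, are given by \<open>coupling_bound\<close>.
\<close>

definition bad_arrivals :: "enat \<Rightarrow> nat \<Rightarrow> nat \<Rightarrow> 'a primitives \<Rightarrow> real \<Rightarrow> real \<Rightarrow> 'a \<Rightarrow> nat" where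
  "bad_arrivals b N l P \<theta> T \<omega> = l * card {k. epoch P k \<omega> \<le> T \<and> few_idle b l P k \<omega> \<and>
     real (busy N (ledger_at b l P k \<omega>) (epoch P k \<omega>)) \<le> \<theta>}"

text \<open>
  A bootstrap argument. As long as the number of busy servers stays below \<open>\<theta>\<close>, all bad batches
  so far are counted by \<open>bad_arrivals\<close>, and then the coupling keeps the number of busy servers
  below \<open>\<theta>\<close> at the next epoch as well.
\<close>

lemma coupling_bound:
  assumes reg: "regular N d P \<omega>" and l: "l \<le> d" and b: "1 \<le> b"
    and small: "\<And>s. 0 \<le> s \<Longrightarrow> s \<le> T \<Longrightarrow>
      real (present N l P s \<omega>) + real (initial_excess N P \<omega> + bad_arrivals b N l P \<theta> T \<omega>) \<le> \<theta>"
    and t: "0 \<le> t" "t \<le> T"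
  defines "L \<equiv> ledger_at b l P (card {k. epoch P k \<omega> \<le> t}) \<omega>"
    and "B \<equiv> initial_excess N P \<omega> + bad_arrivals b N l P \<theta> T \<omega>"
  shows "busy N L t \<le> present N l P t \<omega> + B \<and> present N l P t \<omega> \<le> busy N L t + B \<and> excess N L t \<le> B"
proof -
  let ?W = "{k. epoch P k \<omega> \<le> T \<and> few_idle b l P k \<omega> \<and>
     real (busy N (ledger_at b l P k \<omega>) (epoch P k \<omega>)) \<le> \<theta>}"
  have fin: "finite {k. epoch P k \<omega> \<le> s}" for s using finite_epochs reg by (auto simp: regular_def)
  have finW: "finite ?W" by (rule finite_subset[OF _ fin[of T]]) auto
  have mono: "epoch P i \<omega> \<le> epoch P k \<omega>" if "i \<le> k" for i k
    using monoD[OF strict_mono_mono[OF regular_strict_mono_epoch[OF reg]] that] .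
  have few: "initial_excess N P \<omega> + l * card {i. i < k \<and> few_idle b l P i \<omega>} \<le> B"
    if "\<And>i. i < k \<Longrightarrow> epoch P i \<omega> \<le> T \<and> real (busy N (ledger_at b l P i \<omega>) (epoch P i \<omega>)) \<le> \<theta>" for k
  proof -
    have "{i. i < k \<and> few_idle b l P i \<omega>} \<subseteq> ?W" using that by blast
    then show ?thesis
      unfolding B_def bad_arrivals_def by (intro add_left_mono mult_left_mono card_mono finW) simp_all
  qed
  have low: "real (busy N (ledger_at b l P k \<omega>) (epoch P k \<omega>)) \<le> \<theta>" if "epoch P k \<omega> \<le> T" for k
    using that
  proof (induction k rule: less_induct)
    case (less k)
    have "epoch P i \<omega> \<le> T \<and> real (busy N (ledger_at b l P i \<omega>) (epoch P i \<omega>)) \<le> \<theta>" if "i < k" for i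
      using less that mono[of i k] by auto
    note few' = few[OF this]
    have sub: "{..<k} \<subseteq> {i. epoch P i \<omega> \<le> epoch P k \<omega>}" using mono by auto
    have "busy N (ledger_at b l P k \<omega>) (epoch P k \<omega>) \<le>
        initial_present N P (epoch P k \<omega>) \<omega> + (\<Sum>i<k. batch_present l P (epoch P k \<omega>) i \<omega>) +
        (initial_excess N P \<omega> + l * card {i. i < k \<and> few_idle b l P i \<omega>})"
      using coupling_invariant[OF reg l b, of k "epoch P k \<omega>"] mono by auto
    also have "\<dots> \<le> present N l P (epoch P k \<omega>) \<omega> + B"
      unfolding present_def by (intro add_mono sum_mono2 order_refl sub few' fin zero_le)
    finally show ?case
      using small[of "epoch P k \<omega>"] less.prems regular_epoch_pos[OF reg, of k] unfolding B_def by linarith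
  qed
  let ?K = "card {k. epoch P k \<omega> \<le> t}"
  have K: "{k. epoch P k \<omega> \<le> t} = {..<?K}" by (rule regular_epochs_le[OF reg])
  then have Kt: "epoch P i \<omega> \<le> t" if "i < ?K" for i using that by blast
  have fK: "initial_excess N P \<omega> + l * card {i. i < ?K \<and> few_idle b l P i \<omega>} \<le> B"
  proof (rule few)
    fix i assume "i < ?K"
    then have "epoch P i \<omega> \<le> T" using Kt[of i] t by linarith
    then show "epoch P i \<omega> \<le> T \<and> real (busy N (ledger_at b l P i \<omega>) (epoch P i \<omega>)) \<le> \<theta>"
      using low[of i] by blast
  qed
  have "present N l P t \<omega> = initial_present N P t \<omega> + (\<Sum>i<?K. batch_present l P t i \<omega>)"
    using arg_cong[OF K, of "\<lambda>A. initial_present N P t \<omega> + (\<Sum>i\<in>A. batch_present l P t i \<omega>)"]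
    by (simp only: present_def)
  moreover have "\<forall>i<?K. epoch P i \<omega> \<le> t" using Kt by blast
  note coupling_invariant[OF reg l b this]
  ultimately show ?thesis using fK unfolding L_def by linarith
qed

section \<open>Occupancy profiles\<close>

text \<open>
  Summing over the levels \<open>i \<ge> 2\<close> the number of servers with at least \<open>i\<close> tasks counts each
  waiting task once.
\<close>

lemma sum_tail_counts_le:
  fixes q :: "nat \<Rightarrow> nat" and N :: nat
  assumes "finite S" "S \<subseteq> {2..}"
  shows "(\<Sum>i\<in>S. card {n. n < N \<and> i \<le> q n}) \<le> (\<Sum>n<N. q n - 1)"
    and "(\<And>n. n < N \<Longrightarrow> {2..q n} \<subseteq> S) \<Longrightarrow> (\<Sum>i\<in>S. card {n. n < N \<and> i \<le> q n}) = (\<Sum>n<N. q n - 1)"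
proof -
  have eq: "(\<Sum>i\<in>S. card {n. n < N \<and> i \<le> q n}) = (\<Sum>n<N. card (S \<inter> {..q n}))"
  proof -
    have "(\<Sum>i\<in>S. card {n. n < N \<and> i \<le> q n}) = (\<Sum>n<N. \<Sum>i\<in>S. of_bool (i \<le> q n))"
      unfolding card_eq_sum_of_bool by (rule sum.swap)
    also have "\<dots> = (\<Sum>n<N. card (S \<inter> {..q n}))"
      using assms(1) by (intro sum.cong refl) (simp add: atMost_def)
    finally show ?thesis .
  qed
  have "card (S \<inter> {..q n}) \<le> q n - 1" for n
    using card_mono[of "{2..q n}" "S \<inter> {..q n}"] assms by (auto simp: subset_eq)
  then show "(\<Sum>i\<in>S. card {n. n < N \<and> i \<le> q n}) \<le> (\<Sum>n<N. q n - 1)"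
    unfolding eq by (intro sum_mono)
  assume *: "\<And>n. n < N \<Longrightarrow> {2..q n} \<subseteq> S"
  have "card (S \<inter> {..q n}) = q n - 1" if "n < N" for n
  proof -
    have "S \<inter> {..q n} = {2..q n}" using *[OF that] assms by auto
    then show ?thesis by simp
  qed
  then show "(\<Sum>i\<in>S. card {n. n < N \<and> i \<le> q n}) = (\<Sum>n<N. q n - 1)"
    unfolding eq by simp
qed

text \<open>The occupancy vector of a system with queue lengths \<open>q\<close>.\<close>

definition profile :: "enat \<Rightarrow> nat \<Rightarrow> (nat \<Rightarrow> nat) \<Rightarrow> nat \<Rightarrow> real" where
  "profile b N q = (\<lambda>i. if i \<in> levels b then real (card {n. n < N \<and> i \<le> q n}) / real N else 0)"

lemma occupancy_eq_profile:
  "0 \<le> t \<Longrightarrow> occupancy b N l P \<omega> t = profile b N (queue_length b l P \<omega> t)"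
  by (simp add: occupancy_def profile_def)

lemma profile_zero: "(\<Sum>n<N. q n) < i \<Longrightarrow> profile b N q i = 0"
proof -
  assume i: "(\<Sum>n<N. q n) < i"
  have "q n < i" if "n < N" for n
    using member_le_sum[of n "{..<N}" q] that i by auto
  then have "{n. n < N \<and> i \<le> q n} = {}" by (auto simp: not_le)
  then show ?thesis by (simp add: profile_def)
qed

lemma profile_occupancy_space: "profile b N q \<in> occupancy_space b"
  unfolding occupancy_space_def
proof (intro CollectI conjI ballI allI impI)
  fix i assume i: "i \<in> levels b"
  show "0 \<le> profile b N q i" by (simp add: profile_def)
  have "card {n. n < N \<and> i \<le> q n} \<le> card {..<N}" by (intro card_mono) auto
  then show "profile b N q i \<le> 1" 
    by (cases "N = 0") (auto simp: profile_def divide_le_eq_1)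
  assume 2: "2 \<le> i"
  have "enat (i - 1) \<le> enat i" by simp
  then have "i - 1 \<in> levels b" 
    using i 2 by (auto simp: levels_def intro: order_trans[of _ "enat i"])
  moreover have "card {n. n < N \<and> i \<le> q n} \<le> card {n. n < N \<and> i - 1 \<le> q n}" by (intro card_mono) auto
  ultimately show "profile b N q i \<le> profile b N q (i - 1)"
    using i by (simp add: profile_def divide_right_mono)
next
  have "profile b N q summable_on levels b \<longleftrightarrow> profile b N q summable_on levels b \<inter> {..\<Sum>n<N. q n}"
    by (rule summable_on_cong_neutral) (use profile_zero in \<open>auto simp: not_le\<close>)
  moreover have "profile b N q summable_on levels b \<inter> {..\<Sum>n<N. q n}"
    by (rule summable_on_finite) blast
  ultimately show "profile b N q summable_on levels b" by blast
qed (simp add: profile_def)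

lemma l1_dist_profile_le:
  assumes b: "1 \<le> b" and N: "0 < N"
  shows "l1_dist b (profile b N q) (\<lambda>i. if i = 1 then x else 0) \<le>
    \<bar>real (card {n. n < N \<and> 1 \<le> q n}) / real N - x\<bar> + real (\<Sum>n<N. q n - 1) / real N"
proof -
  let ?F = "levels b \<inter> {..Suc (\<Sum>n<N. q n)}" and ?f = "\<lambda>i. \<bar>profile b N q i - (if i = 1 then x else 0)\<bar>"
  have one: "1 \<in> levels b" using b by (simp add: levels_def one_enat_def)
  have "l1_dist b (profile b N q) (\<lambda>i. if i = 1 then x else 0) = infsum ?f ?F"
    unfolding l1_dist_def by (rule infsum_cong_neutral) (auto simp: profile_zero)
  also have "\<dots> = (\<Sum>i\<in>?F. ?f i)" by (rule infsum_finite) simp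
  also have "\<dots> = ?f 1 + (\<Sum>i\<in>?F - {1}. ?f i)" using one by (intro sum.remove) auto
  also have "(\<Sum>i\<in>?F - {1}. ?f i) = (\<Sum>i\<in>?F - {1}. real (card {n. n < N \<and> i \<le> q n}) / real N)"
    by (intro sum.cong) (auto simp: profile_def)
  also have "\<dots> = real (\<Sum>i\<in>?F - {1}. card {n. n < N \<and> i \<le> q n}) / real N"
    by (simp add: sum_divide_distrib)
  also have "\<dots> \<le> real (\<Sum>n<N. q n - 1) / real N"
    by (intro divide_right_mono of_nat_mono sum_tail_counts_le) (auto simp: levels_def)
  also have "?f 1 = \<bar>real (card {n. n < N \<and> 1 \<le> q n}) / real N - x\<bar>"
    using one by (simp add: profile_def)
  finally show ?thesis by simp
qed

section \<open>Measurability of the ledger\<close>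

text \<open>
  A random list is described by its length and its entries; beyond its end the entry 0 serves
  as a default value.
\<close>

definition list_measurable :: "'a measure \<Rightarrow> ('a \<Rightarrow> real list) \<Rightarrow> bool" where
  "list_measurable F xs \<longleftrightarrow> (\<lambda>\<omega>. length (xs \<omega>)) \<in> F \<rightarrow>\<^sub>M count_space UNIV \<and>
     (\<forall>i. (\<lambda>\<omega>. if i < length (xs \<omega>) then xs \<omega> ! i else 0) \<in> borel_measurable F)"

lemma list_measurable_length:
  "list_measurable F xs \<Longrightarrow> (\<lambda>\<omega>. length (xs \<omega>)) \<in> F \<rightarrow>\<^sub>M count_space UNIV"
  by (simp add: list_measurable_def)

lemma list_measurable_compose_countable:
  fixes C :: "'a \<Rightarrow> 'c::countable"
  assumes "\<And>c. list_measurable F (\<lambda>\<omega>. G c \<omega>)" and "C \<in> F \<rightarrow>\<^sub>M count_space UNIV"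
  shows "list_measurable F (\<lambda>\<omega>. G (C \<omega>) \<omega>)"
  unfolding list_measurable_def
proof (intro conjI allI)
  show "(\<lambda>\<omega>. length (G (C \<omega>) \<omega>)) \<in> F \<rightarrow>\<^sub>M count_space UNIV"
    by (rule measurable_compose_countable[OF _ assms(2), where f = "\<lambda>c \<omega>. length (G c \<omega>)"])
      (use assms(1) in \<open>simp add: list_measurable_def\<close>)
  show "(\<lambda>\<omega>. if i < length (G (C \<omega>) \<omega>) then G (C \<omega>) \<omega> ! i else 0) \<in> borel_measurable F" for i
    by (rule measurable_compose_countable[OF _ assms(2),
          where f = "\<lambda>c \<omega>. if i < length (G c \<omega>) then G c \<omega> ! i else 0"])
      (use assms(1) in \<open>simp add: list_measurable_def\<close>)
qed

lemma list_measurable_if: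
  assumes "list_measurable F xs" "list_measurable F ys" and p: "Measurable.pred F p"
  shows "list_measurable F (\<lambda>\<omega>. if p \<omega> then xs \<omega> else ys \<omega>)"
proof (rule list_measurable_compose_countable[OF _ p])
  show "list_measurable F (\<lambda>\<omega>. if c then xs \<omega> else ys \<omega>)" for c
    using assms(1,2) by (cases c) simp_all
qed

lemma list_measurable_append1:
  assumes xs: "list_measurable F xs" and v: "v \<in> borel_measurable F"
  shows "list_measurable F (\<lambda>\<omega>. xs \<omega> @ [v \<omega>])"
  unfolding list_measurable_def
proof (intro conjI allI)
  have [measurable]: "(\<lambda>\<omega>. length (xs \<omega>)) \<in> F \<rightarrow>\<^sub>M count_space UNIV" using xs by (rule list_measurable_length)
  note v[measurable]
  show "(\<lambda>\<omega>. length (xs \<omega> @ [v \<omega>])) \<in> F \<rightarrow>\<^sub>M count_space UNIV" by simp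
  fix i
  have [measurable]: "(\<lambda>\<omega>. if i < length (xs \<omega>) then xs \<omega> ! i else 0) \<in> borel_measurable F"
    using xs by (simp add: list_measurable_def)
  have "(\<lambda>\<omega>. if i < length (xs \<omega>) then (if i < length (xs \<omega>) then xs \<omega> ! i else 0) else
      if i = length (xs \<omega>) then v \<omega> else 0) \<in> borel_measurable F" by measurable
  also have "(\<lambda>\<omega>. if i < length (xs \<omega>) then (if i < length (xs \<omega>) then xs \<omega> ! i else 0) else
      if i = length (xs \<omega>) then v \<omega> else 0) =
      (\<lambda>\<omega>. if i < length (xs \<omega> @ [v \<omega>]) then (xs \<omega> @ [v \<omega>]) ! i else 0)"
    by (auto simp: nth_append fun_eq_iff)
  finally show "(\<lambda>\<omega>. if i < length (xs \<omega> @ [v \<omega>]) then (xs \<omega> @ [v \<omega>]) ! i else 0) \<in> borel_measurable F" .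
qed

lemma list_measurable_map_upt:
  assumes "\<And>j. j < m \<Longrightarrow> f j \<in> borel_measurable F"
  shows "list_measurable F (\<lambda>\<omega>. map (\<lambda>j. f j \<omega>) [0..<m])"
  using assms
proof (induction m)
  case 0
  then show ?case by (simp add: list_measurable_def)
next
  case (Suc m)
  then show ?case using list_measurable_append1[of F "\<lambda>\<omega>. map (\<lambda>j. f j \<omega>) [0..<m]" "f m"] by simp
qed

text \<open>
  As lengths are countably many, a functional of a random list can be treated length by
  length, for lists of random variables.
\<close>

lemma measurable_list_functional:
  assumes xs: "list_measurable F xs"
    and f: "\<And>m e. (\<And>i. e i \<in> borel_measurable F) \<Longrightarrow> (\<lambda>\<omega>. f (map (\<lambda>i. e i \<omega>) [0..<m]) \<omega>) \<in> F \<rightarrow>\<^sub>M N"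
  shows "(\<lambda>\<omega>. f (xs \<omega>) \<omega>) \<in> F \<rightarrow>\<^sub>M N"
proof -
  define e where "e i \<omega> = (if i < length (xs \<omega>) then xs \<omega> ! i else 0)" for i \<omega>
  have "e i \<in> borel_measurable F" for i using xs unfolding e_def by (simp add: list_measurable_def)
  then have "(\<lambda>\<omega>. f (map (\<lambda>i. e i \<omega>) [0..<length (xs \<omega>)]) \<omega>) \<in> F \<rightarrow>\<^sub>M N"
    by (intro measurable_compose_countable[OF f list_measurable_length[OF xs]])
  also have "(\<lambda>\<omega>. f (map (\<lambda>i. e i \<omega>) [0..<length (xs \<omega>)]) \<omega>) = (\<lambda>\<omega>. f (xs \<omega>) \<omega>)"
  proof
    fix \<omega>
    have "map (\<lambda>i. e i \<omega>) [0..<length (xs \<omega>)] = xs \<omega>" by (rule nth_equalityI) (auto simp: e_def)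
    then show "f (map (\<lambda>i. e i \<omega>) [0..<length (xs \<omega>)]) \<omega> = f (xs \<omega>) \<omega>" by simp
  qed
  finally show ?thesis .
qed

definition ledger_measurable :: "'a measure \<Rightarrow> ('a \<Rightarrow> ledger) \<Rightarrow> bool" where
  "ledger_measurable F L \<longleftrightarrow> (\<forall>n. list_measurable F (\<lambda>\<omega>. L \<omega> n))"

lemma measurable_pending:
  assumes L: "ledger_measurable F L" and t: "t \<in> borel_measurable F"
  shows "(\<lambda>\<omega>. pending (L \<omega>) (t \<omega>) n) \<in> F \<rightarrow>\<^sub>M count_space UNIV"
  unfolding pending_def
proof (rule measurable_list_functional[where f = "\<lambda>xs \<omega>. length (filter (\<lambda>c. t \<omega> < c) xs)"])
  show "list_measurable F (\<lambda>\<omega>. L \<omega> n)" using L by (simp add: ledger_measurable_def)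
  fix m and e :: "nat \<Rightarrow> 'a \<Rightarrow> real" assume e: "\<And>i. e i \<in> borel_measurable F"
  note [measurable] = e t
  have "(\<lambda>\<omega>. map (\<lambda>i. t \<omega> < e i \<omega>) [0..<m]) \<in> F \<rightarrow>\<^sub>M count_space UNIV"
    by (intro measurable_count_space_map) measurable
  from measurable_compose[OF this, of "\<lambda>bs. length (filter id bs)" "count_space UNIV"]
  show "(\<lambda>\<omega>. length (filter (\<lambda>c. t \<omega> < c) (map (\<lambda>i. e i \<omega>) [0..<m]))) \<in> F \<rightarrow>\<^sub>M count_space UNIV"
    by (simp add: filter_map o_def)
qed

lemma measurable_Max_insert:
  assumes xs: "list_measurable F xs" and t: "t \<in> borel_measurable F"
  shows "(\<lambda>\<omega>. Max (insert (t \<omega>) (set (xs \<omega>)))) \<in> borel_measurable F"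
proof (rule measurable_list_functional[OF xs, where f = "\<lambda>xs \<omega>. Max (insert (t \<omega>) (set xs))"])
  fix m and e :: "nat \<Rightarrow> 'a \<Rightarrow> real" assume e: "\<And>i. e i \<in> borel_measurable F"
  show "(\<lambda>\<omega>. Max (insert (t \<omega>) (set (map (\<lambda>i. e i \<omega>) [0..<m])))) \<in> borel_measurable F"
  proof (induction m)
    case 0 then show ?case using t by simp
  next
    case (Suc m)
    have "Max (insert (t \<omega>) (set (map (\<lambda>i. e i \<omega>) [0..<Suc m]))) =
        max (e m \<omega>) (Max (insert (t \<omega>) (set (map (\<lambda>i. e i \<omega>) [0..<m]))))" for \<omega>
      by (subst Max_insert[symmetric]) (auto simp: atLeast0_lessThan_Suc insert_commute)
    then show ?case using Suc e[of m] by simp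
  qed
qed

lemma ledger_measurable_assign:
  assumes L: "ledger_measurable F L" and t: "t \<in> borel_measurable F" and s: "s \<in> borel_measurable F"
  shows "ledger_measurable F (\<lambda>\<omega>. assign b (t \<omega>) (n, s \<omega>) (L \<omega>))"
  unfolding ledger_measurable_def
proof
  fix n'
  have Ln: "list_measurable F (\<lambda>\<omega>. L \<omega> n')" for n' using L by (simp add: ledger_measurable_def)
  show "list_measurable F (\<lambda>\<omega>. assign b (t \<omega>) (n, s \<omega>) (L \<omega>) n')"
  proof (cases "n' = n")
    case True
    have [measurable]: "(\<lambda>\<omega>. pending (L \<omega>) (t \<omega>) n) \<in> F \<rightarrow>\<^sub>M count_space UNIV"
      by (rule measurable_pending[OF L t])
    have "list_measurable F (\<lambda>\<omega>. if enat (pending (L \<omega>) (t \<omega>) n) < b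
        then L \<omega> n @ [Max (insert (t \<omega>) (set (L \<omega> n))) + s \<omega>] else L \<omega> n)"
    proof (rule list_measurable_if[OF list_measurable_append1[OF Ln] Ln])
      show "(\<lambda>\<omega>. Max (insert (t \<omega>) (set (L \<omega> n))) + s \<omega>) \<in> borel_measurable F"
        by (rule borel_measurable_add[OF measurable_Max_insert[OF Ln t] s])
    qed measurable
    also have "(\<lambda>\<omega>. if enat (pending (L \<omega>) (t \<omega>) n) < b
        then L \<omega> n @ [Max (insert (t \<omega>) (set (L \<omega> n))) + s \<omega>] else L \<omega> n) =
        (\<lambda>\<omega>. assign b (t \<omega>) (n, s \<omega>) (L \<omega>) n')" using True by (auto simp: assign_def fun_eq_iff)
    finally show ?thesis .
  next
    case False
    then have "(\<lambda>\<omega>. assign b (t \<omega>) (n, s \<omega>) (L \<omega>) n') = (\<lambda>\<omega>. L \<omega> n')" by (auto simp: assign_def)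
    then show ?thesis using Ln by simp
  qed
qed

lemma ledger_measurable_batch:
  assumes "ledger_measurable F L" and t: "t \<in> borel_measurable F" and s: "\<And>j. s j \<in> borel_measurable F"
  shows "ledger_measurable F (\<lambda>\<omega>. fold (assign b (t \<omega>)) (zip ns (map (\<lambda>j. s j \<omega>) js)) (L \<omega>))"
  using assms(1)
proof (induction ns arbitrary: js L)
  case (Cons n ns)
  then show ?case
    by (cases js) (auto intro!: Cons.IH ledger_measurable_assign t s)
qed simp

lemma insort_key_cong_on: "(\<And>y. y \<in> set (x # ys) \<Longrightarrow> f y = g y) \<Longrightarrow> insort_key f x ys = insort_key g x ys"
  by (induction ys) auto

lemma sort_key_cong_on: "(\<And>y. y \<in> set ys \<Longrightarrow> f y = g y) \<Longrightarrow> sort_key f ys = sort_key g ys"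
  unfolding sort_key_def by (induction ys) (auto intro!: insort_key_cong_on simp flip: sort_key_def)

text \<open>The choice depends on the queue lengths of the sampled servers only, hence on a countable quantity.\<close>

lemma measurable_jsq_choice:
  assumes L: "ledger_measurable F L" and t: "t \<in> borel_measurable F" and S: "S \<in> F \<rightarrow>\<^sub>M count_space UNIV"
  shows "(\<lambda>\<omega>. jsq_choice l (pending (L \<omega>) (t \<omega>)) (S \<omega>)) \<in> F \<rightarrow>\<^sub>M count_space UNIV"
proof (rule measurable_compose_countable[OF _ S])
  fix ns
  \<comment> \<open>The queue lengths outside of the sample are forgotten.\<close>
  define H where "H vs = jsq_choice l (\<lambda>n. the (map_of (zip ns vs) n)) ns" for vs
  have "(\<lambda>\<omega>. map (\<lambda>n. pending (L \<omega>) (t \<omega>) n) ns) \<in> F \<rightarrow>\<^sub>M count_space UNIV"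
    by (intro measurable_count_space_map measurable_pending L t)
  then have "(\<lambda>\<omega>. H (map (\<lambda>n. pending (L \<omega>) (t \<omega>) n) ns)) \<in> F \<rightarrow>\<^sub>M count_space UNIV"
    by (rule measurable_compose) simp
  moreover have "H (map (\<lambda>n. pending (L \<omega>) (t \<omega>) n) ns) = jsq_choice l (pending (L \<omega>) (t \<omega>)) ns" for \<omega>
    unfolding H_def jsq_choice_def
    by (rule arg_cong[where f = "take l"], rule sort_key_cong_on) (simp add: map_of_zip_map)
  ultimately show "(\<lambda>\<omega>. jsq_choice l (pending (L \<omega>) (t \<omega>)) ns) \<in> F \<rightarrow>\<^sub>M count_space UNIV" by simp
qed

text \<open>
  The ledger before batch \<open>k\<close> is a function of the initial data and of the batches before \<open>k\<close>.
  It is stated for an arbitrary \<sigma>-algebra \<open>F\<close>, since the independence of the sample of batch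
  \<open>k\<close> from the past needs it for the \<sigma>-algebra of all other primitives.
\<close>

lemma ledger_measurable_ledger_at:
  assumes init: "init P \<in> F \<rightarrow>\<^sub>M count_space UNIV" and svc0: "\<And>n j. svc0 P n j \<in> borel_measurable F"
    and prim: "\<And>i. i < k \<Longrightarrow> gap P i \<in> borel_measurable F" "\<And>i. i < k \<Longrightarrow> sample P i \<in> F \<rightarrow>\<^sub>M count_space UNIV"
      "\<And>i j. i < k \<Longrightarrow> svc P i j \<in> borel_measurable F"
  shows "ledger_measurable F (ledger_at b l P k)"
  using prim
proof (induction k)
  case 0
  have init_list: "list_measurable F (\<lambda>\<omega>. if n < length xs then map (\<lambda>j. \<Sum>i\<le>j. svc0 P n i \<omega>) [0..<xs ! n] else [])" for n xs
  proof (cases "n < length xs")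
    case True
    have "list_measurable F (\<lambda>\<omega>. map (\<lambda>j. \<Sum>i\<le>j. svc0 P n i \<omega>) [0..<xs ! n])"
      by (rule list_measurable_map_upt) (intro borel_measurable_sum svc0)
    then show ?thesis using True by simp
  qed (simp add: list_measurable_def)
  show ?case
    unfolding ledger_measurable_def
  proof
    fix n
    have "list_measurable F (\<lambda>\<omega>. (\<lambda>xs \<omega>. if n < length xs
        then map (\<lambda>j. \<Sum>i\<le>j. svc0 P n i \<omega>) [0..<xs ! n] else []) (init P \<omega>) \<omega>)"
      by (rule list_measurable_compose_countable[OF init_list init])
    then show "list_measurable F (\<lambda>\<omega>. ledger_at b l P 0 \<omega> n)" by (simp only: ledger_at.simps)
  qed
next
  case (Suc k)
  let ?ns = "\<lambda>\<omega>. jsq_choice l (pending (ledger_at b l P k \<omega>) (epoch P k \<omega>)) (sample P k \<omega>)"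
  have L: "ledger_measurable F (ledger_at b l P k)" using Suc by auto
  have e: "epoch P k \<in> borel_measurable F"
    unfolding epoch_def[abs_def] using Suc.prems by (intro borel_measurable_sum) auto
  have C: "?ns \<in> F \<rightarrow>\<^sub>M count_space UNIV"
    using Suc.prems by (intro measurable_jsq_choice L e) auto
  show ?case unfolding ledger_measurable_def
  proof
    fix n
    have "list_measurable F (\<lambda>\<omega>. fold (assign b (epoch P k \<omega>)) (zip ns (map (\<lambda>j. svc P k j \<omega>) [0..<l])) (ledger_at b l P k \<omega>) n)" for ns
      using ledger_measurable_batch[OF L e, of "svc P k" b ns "[0..<l]"] Suc.prems
      unfolding ledger_measurable_def by auto
    from list_measurable_compose_countable[OF this C]
    show "list_measurable F (\<lambda>\<omega>. ledger_at b l P (Suc k) \<omega> n)" by (simp add: Let_def)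
  qed
qed

section \<open>Sample paths of the occupancy process\<close>

lemma finite_ledger_range: "finite {c. \<exists>k\<le>(K::nat). \<exists>n<(N::nat). c \<in> set (L k n :: real list)}"
proof -
  have "{c. \<exists>k\<le>K. \<exists>n<N. c \<in> set (L k n)} = (\<Union>k\<in>{..K}. \<Union>n\<in>{..<N}. set (L k n))" by auto
  then show ?thesis by simp
qed

text \<open>
  The jumps up to time \<open>T\<close> are among the epochs and the departures recorded in the finitely
  many ledgers in use up to then.
\<close>

lemma step_path_queue_lengths:
  assumes "filterlim (\<lambda>k. epoch P k \<omega>) at_top sequentially"
  shows "step_path (\<lambda>t. map (queue_length b l P \<omega> t) [0..<N])"
  unfolding step_path_def
proof
  fix T
  let ?K = "\<lambda>t. card {k. epoch P k \<omega> \<le> t}" and ?L = "\<lambda>k. ledger_at b l P k \<omega>"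
  define J where "J = ((\<lambda>k. epoch P k \<omega>) ` {k. epoch P k \<omega> \<le> T} \<union> {c. \<exists>k\<le>?K T. \<exists>n<N. c \<in> set (?L k n)}) \<inter> {0<..}"
  have fin: "finite {k. epoch P k \<omega> \<le> t}" for t by (rule finite_epochs[OF assms])
  have J: "finite J" unfolding J_def
    by (intro finite_Int finite_UnI finite_imageI fin finite_ledger_range disjI1)
  have "map (queue_length b l P \<omega> s) [0..<N] = map (queue_length b l P \<omega> t) [0..<N]"
    if st: "0 \<le> s" "s \<le> t" "t \<le> T" "{s<..t} \<inter> J = {}" for s t
  proof -
    have "{k. epoch P k \<omega> \<le> t} \<subseteq> {k. epoch P k \<omega> \<le> s}"
    proof
      fix k assume k: "k \<in> {k. epoch P k \<omega> \<le> t}"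
      show "k \<in> {k. epoch P k \<omega> \<le> s}"
      proof (rule ccontr)
        assume "k \<notin> {k. epoch P k \<omega> \<le> s}"
        then have "epoch P k \<omega> \<in> {s<..t} \<inter> J" 
          using k st(1-3) unfolding J_def by (simp add: not_le)
        then show False using st(4) by blast
      qed
    qed
    moreover have "{k. epoch P k \<omega> \<le> s} \<subseteq> {k. epoch P k \<omega> \<le> t}" using st by auto
    ultimately have K: "?K s = ?K t" by (simp add: subset_antisym)
    have KT: "?K t \<le> ?K T" using st by (intro card_mono fin) auto
    have "pending (?L (?K t)) s n = pending (?L (?K t)) t n" if "n < N" for n
    proof -
      have "s < c \<longleftrightarrow> t < c" if "c \<in> set (?L (?K t) n)" for c
      proof (rule ccontr)
        assume "\<not> (s < c \<longleftrightarrow> t < c)"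
        then have c: "s < c" "c \<le> t" using st by linarith+
        then have "c \<in> {s<..t} \<inter> J" 
          using KT that \<open>n < N\<close> st(1-3) unfolding J_def by auto
        then show False using st(4) by blast
      qed
      then have "filter (\<lambda>c. s < c) (?L (?K t) n) = filter (\<lambda>c. t < c) (?L (?K t) n)"
        by (rule filter_cong[OF refl])
      then show ?thesis by (simp add: pending_def)
    qed
    then show ?thesis using K by (simp add: queue_length_def)
  qed
  then show "\<exists>J. finite J \<and> J \<subseteq> {0<..} \<and> (\<forall>s t. 0 \<le> s \<and> s \<le> t \<and> t \<le> T \<and> {s<..t} \<inter> J = {} \<longrightarrow>
      map (queue_length b l P \<omega> s) [0..<N] = map (queue_length b l P \<omega> t) [0..<N])"
    using J by (intro exI[of _ J]) (auto simp: J_def)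
qed

lemma profile_cong: "(\<And>n. n < N \<Longrightarrow> q n = q' n) \<Longrightarrow> profile b N q = profile b N q'"
  unfolding profile_def by (intro ext) (auto intro!: arg_cong[where f = card])

lemma occupancy_eq_profile_list:
  assumes "0 \<le> t"
  shows "occupancy b N l P \<omega> t = profile b N (\<lambda>n. map (queue_length b l P \<omega> t) [0..<N] ! n)"
  unfolding occupancy_eq_profile[OF assms] by (rule profile_cong) simp

lemma step_path_image:
  assumes z: "step_path z" and x: "\<And>t. 0 \<le> t \<Longrightarrow> x t = \<phi> (z t)"
  shows "step_path x"
  unfolding step_path_def
proof
  fix T
  obtain J where J: "finite J" "J \<subseteq> {0<..}"
    "\<forall>s t. 0 \<le> s \<and> s \<le> t \<and> t \<le> T \<and> {s<..t} \<inter> J = {} \<longrightarrow> z s = z t"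
    using z[unfolded step_path_def, rule_format, of T] by auto
  have "x s = x t" if "0 \<le> s \<and> s \<le> t \<and> t \<le> T \<and> {s<..t} \<inter> J = {}" for s t
  proof -
    have "z s = z t" "0 \<le> s" "0 \<le> t" using J(3) that by auto
    then show ?thesis using x by simp
  qed
  then show "\<exists>J. finite J \<and> J \<subseteq> {0<..} \<and> (\<forall>s t. 0 \<le> s \<and> s \<le> t \<and> t \<le> T \<and> {s<..t} \<inter> J = {} \<longrightarrow> x s = x t)"
    using J(1,2) by blast
qed

lemma step_path_occupancy:
  assumes "filterlim (\<lambda>k. epoch P k \<omega>) at_top sequentially"
  shows "step_path (occupancy b N l P \<omega>)"
proof (rule step_path_image[where \<phi> = "\<lambda>xs. profile b N (\<lambda>n. xs ! n)"])
  show "step_path (\<lambda>t. map (queue_length b l P \<omega> t) [0..<N])"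
    by (rule step_path_queue_lengths[OF assms])
  show "occupancy b N l P \<omega> t = profile b N (\<lambda>n. map (queue_length b l P \<omega> t) [0..<N] ! n)"
    if "0 \<le> t" for t by (rule occupancy_eq_profile_list[OF that])
qed

lemma occupancy_cadlag:
  assumes "filterlim (\<lambda>k. epoch P k \<omega>) at_top sequentially"
  shows "occupancy b N l P \<omega> \<in> cadlag_paths (occupancy_metric b)"
proof (rule step_path_cadlag[OF step_path_occupancy[OF assms]])
  have "occupancy b N l P \<omega> t = undefined" if "t < 0" for t
    using that by (simp add: occupancy_def)
  then show "occupancy b N l P \<omega> \<in> {0..} \<rightarrow>\<^sub>E mspace (occupancy_metric b)"
    by (auto simp: occupancy_eq_profile profile_occupancy_space PiE_iff extensional_def)
qed

lemma Int_stable_vimage: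
  assumes "\<And>A B. A \<in> S \<Longrightarrow> B \<in> S \<Longrightarrow> A \<inter> B \<in> S"
  shows "Int_stable {f -` A \<inter> \<Omega> |A. A \<in> S}"
proof (rule Int_stableI)
  fix C D assume "C \<in> {f -` A \<inter> \<Omega> |A. A \<in> S}" "D \<in> {f -` A \<inter> \<Omega> |A. A \<in> S}"
  then obtain A B where AB: "A \<in> S" "B \<in> S" "C = f -` A \<inter> \<Omega>" "D = f -` B \<inter> \<Omega>" by blast
  then have "C \<inter> D = f -` (A \<inter> B) \<inter> \<Omega>" by blast
  then show "C \<inter> D \<in> {f -` A \<inter> \<Omega> |A. A \<in> S}" using assms[OF AB(1,2)] by blast
qed

context batch_jsq_system
begin

lemma init_rv: "init P \<in> M \<rightarrow>\<^sub>M count_space UNIV"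
  and gap_rv: "gap P k \<in> borel_measurable M"
  and sample_rv: "sample P k \<in> M \<rightarrow>\<^sub>M count_space UNIV"
  and svc0_rv: "svc0 P n j \<in> borel_measurable M"
  and svc_rv: "svc P k j \<in> borel_measurable M"
  using init_measurable sample_measurable distributed_measurable[OF gap_distributed]
    distributed_measurable[OF svc0_distributed] distributed_measurable[OF svc_distributed] by simp_all

lemma epoch_rv: "epoch P k \<in> borel_measurable M"
  unfolding epoch_def[abs_def] by (intro borel_measurable_sum gap_rv)

lemma ledger_rv: "ledger_measurable M (ledger_at b l P k)"
  by (intro ledger_measurable_ledger_at init_rv gap_rv sample_rv svc0_rv svc_rv)

lemma arrivals_rv: "(\<lambda>\<omega>. card {k. epoch P k \<omega> \<le> t}) \<in> M \<rightarrow>\<^sub>M count_space UNIV"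
proof (rule measurable_card)
  note epoch_rv[measurable]
  fix k show "{\<omega> \<in> space M. k \<in> {k. epoch P k \<omega> \<le> t}} \<in> sets M" by simp
qed

lemma queue_length_rv: "(\<lambda>\<omega>. queue_length b l P \<omega> t n) \<in> M \<rightarrow>\<^sub>M count_space UNIV"
  unfolding queue_length_def
  by (rule measurable_compose_countable[OF _ arrivals_rv]) (intro measurable_pending ledger_rv, simp)

lemma occupancy_rv: "occupancy b N l P \<in> M \<rightarrow>\<^sub>M borel_of (J1_topology (occupancy_metric b))"
proof (rule measurable_step_process[where \<phi> = "\<lambda>xs. profile b N (\<lambda>n. xs ! n)"])
  show "(\<lambda>\<omega>. map (queue_length b l P \<omega> t) [0..<N]) \<in> M \<rightarrow>\<^sub>M count_space UNIV" for t
    using measurable_count_space_map[of "[0..<N]" "\<lambda>n \<omega>. queue_length b l P \<omega> t n" M] queue_length_rv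
    by simp
  show "occupancy b N l P \<omega> t = profile b N (\<lambda>n. map (queue_length b l P \<omega> t) [0..<N] ! n)" if "0 \<le> t" for \<omega> t
    by (rule occupancy_eq_profile_list[OF that])
  fix \<omega> assume "\<omega> \<in> space M"
  note diverge = epochs_diverge[OF this]
  show "occupancy b N l P \<omega> \<in> cadlag_paths (occupancy_metric b)" by (rule occupancy_cadlag[OF diverge])
  show "step_path (occupancy b N l P \<omega>)" by (rule step_path_occupancy[OF diverge])
qed

section \<open>Almost sure properties and independence of the primitives\<close>

lemma AE_exponential_pos:
  assumes "distributed M lborel X (exponential_density \<rho>)"
  shows "AE \<omega> in M. 0 < X \<omega>"
proof -
  have "AE x in lborel. x \<noteq> (0::real)" using AE_lborel_singleton[of 0] by auto
  then have "AE x in lborel. ennreal (exponential_density \<rho> x) \<noteq> 0 \<longrightarrow> 0 < x"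
    by eventually_elim (auto simp: erlang_density_def)
  then have "AE x in density lborel (exponential_density \<rho>). 0 < x"
    by (subst AE_density) (auto simp: zero_less_iff_neq_zero)
  then have "AE x in distr M lborel X. 0 < x"
    by (subst distributed_distr_eq_density[OF assms])
  then show ?thesis by (rule AE_distrD[OF distributed_measurable[OF assms]])
qed

lemma sample_distr: "distr M (count_space UNIV) (sample P k) = measure_pmf (pmf_of_set (draws N d))"
  unfolding draws_def by (rule sample_uniform)

lemma sample_draws: "AE \<omega> in M. sample P k \<omega> \<in> draws N d"
proof -
  have ne: "draws N d \<noteq> {}" using draws_nonempty batch_bounds by simp
  have "AE ns in measure_pmf (pmf_of_set (draws N d)). ns \<in> draws N d"
    using ne by (simp add: AE_measure_pmf_iff)
  then have "AE ns in distr M (count_space UNIV) (sample P k). ns \<in> draws N d"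
    by (subst sample_distr)
  then show ?thesis by (rule AE_distrD[OF sample_rv])
qed

lemma AE_regular: "AE \<omega> in M. regular N d P \<omega>"
proof -
  have "AE \<omega> in M. \<forall>k. 0 < gap P k \<omega>" "AE \<omega> in M. \<forall>k. sample P k \<omega> \<in> draws N d"
    "AE \<omega> in M. \<forall>n j. 0 < svc0 P n j \<omega>"
    using AE_exponential_pos[OF gap_distributed] AE_exponential_pos[OF svc0_distributed] sample_draws
    by (simp_all add: AE_all_countable)
  moreover have "AE \<omega> in M. length (init P \<omega>) = N \<and> filterlim (\<lambda>k. epoch P k \<omega>) at_top sequentially"
    using init_valid epochs_diverge by (intro AE_I2) auto
  ultimately show ?thesis
    by eventually_elim (auto simp: regular_def)
qed

text \<open>The \<sigma>-algebra generated by a set of primitives.\<close>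

definition sources :: "source set \<Rightarrow> 'a measure" where
  "sources A = sigma (space M) (\<Union>s\<in>A. source_events M P s)"

lemma source_events_sets: "source_events M P s \<subseteq> sets M"
  by (cases s) (auto intro!: measurable_sets[OF init_rv] measurable_sets[OF gap_rv]
      measurable_sets[OF sample_rv] measurable_sets[OF svc0_rv] measurable_sets[OF svc_rv])

lemma space_sources [simp]: "space (sources A) = space M"
  by (simp only: sources_def space_measure_of_conv)

lemma sets_sources: "sets (sources A) = sigma_sets (space M) (\<Union>s\<in>A. source_events M P s)"
  unfolding sources_def
proof (rule sets_measure_of)
  show "(\<Union>s\<in>A. source_events M P s) \<subseteq> Pow (space M)"
    using source_events_sets sets.space_closed[of M] by (meson UN_least order_trans)
qed

lemma measurable_sources: "f \<in> sources A \<rightarrow>\<^sub>M S \<Longrightarrow> f \<in> M \<rightarrow>\<^sub>M S"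
proof (rule measurable_from_subalg)
  show "subalgebra M (sources A)"
    unfolding subalgebra_def sets_sources using source_events_sets by (auto intro!: sets.sigma_sets_subset)
qed

lemma sources_rv:
  assumes "s \<in> A"
  shows "s = Init \<Longrightarrow> init P \<in> sources A \<rightarrow>\<^sub>M count_space UNIV"
    and "s = Gap k \<Longrightarrow> gap P k \<in> borel_measurable (sources A)"
    and "s = Sample k \<Longrightarrow> sample P k \<in> sources A \<rightarrow>\<^sub>M count_space UNIV"
    and "s = Svc0 n j \<Longrightarrow> svc0 P n j \<in> borel_measurable (sources A)"
    and "s = Svc k j \<Longrightarrow> svc P k j \<in> borel_measurable (sources A)"
proof -
  have *: "B \<in> sets (sources A)" if "B \<in> source_events M P s" for B
    using that assms unfolding sets_sources by (intro sigma_sets.Basic) auto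
  show "s = Init \<Longrightarrow> init P \<in> sources A \<rightarrow>\<^sub>M count_space UNIV"
    and "s = Gap k \<Longrightarrow> gap P k \<in> borel_measurable (sources A)"
    and "s = Sample k \<Longrightarrow> sample P k \<in> sources A \<rightarrow>\<^sub>M count_space UNIV"
    and "s = Svc0 n j \<Longrightarrow> svc0 P n j \<in> borel_measurable (sources A)"
    and "s = Svc k j \<Longrightarrow> svc P k j \<in> borel_measurable (sources A)"
    by (rule measurableI; use * in auto)+
qed

lemma sigma_vimage_sources:
  assumes "Z \<in> sources D \<rightarrow>\<^sub>M R"
  shows "sigma_sets (space M) {Z -` C \<inter> space M |C. C \<in> sets R} \<subseteq> sets (sources D)"
proof -
  have "{Z -` C \<inter> space M |C. C \<in> sets R} \<subseteq> sets (sources D)"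
    using measurable_sets[OF assms] by auto
  from sets.sigma_sets_subset[OF this] show ?thesis by simp
qed

lemma indep_sources:
  assumes disj: "A \<inter> B = {}"
  shows "indep_set (sets (sources A)) (sets (sources B))"
proof -
  have *: "indep_sets (\<lambda>c. sigma_sets (space M) (\<Union>s\<in>case_bool A B c. source_events M P s)) UNIV"
  proof (rule indep_sets_collect_sigma)
    show "indep_sets (source_events M P) (\<Union>c. case_bool A B c)"
      by (rule indep_sets_mono_index[OF _ independent]) simp
    show "disjoint_family (case_bool A B)"
      using disj by (auto simp: disjoint_family_on_def split: bool.split)
    fix s show "Int_stable (source_events M P s)"
      using Int_stable_vimage[of UNIV "init P" "space M"] Int_stable_vimage[of UNIV "sample P k" "space M" for k]
        Int_stable_vimage[of "sets borel" "gap P k" "space M" for k]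
        Int_stable_vimage[of "sets borel" "svc0 P n j" "space M" for n j]
        Int_stable_vimage[of "sets borel" "svc P k j" "space M" for k j]
      by (cases s) (simp_all only: source_events.simps UNIV_I Int_UNIV_left sets.Int)
  qed
  show "indep_set (sets (sources A)) (sets (sources B))"
  proof -
    have "(\<lambda>c. sigma_sets (space M) (\<Union>s\<in>case_bool A B c. source_events M P s)) =
        case_bool (sets (sources A)) (sets (sources B))"
      unfolding sets_sources by (rule ext) (simp split: bool.split)
    with * show ?thesis unfolding indep_set_def by metis
  qed
qed

lemma indep_var_sources:
  assumes X: "X \<in> sources A \<rightarrow>\<^sub>M S" and Y: "Y \<in> sources B \<rightarrow>\<^sub>M T" and disj: "A \<inter> B = {}"
  shows "indep_var S X T Y"
proof -
  note ind = indep_sources[OF disj]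
  show ?thesis
    unfolding indep_var_eq
  proof (intro conjI)
    show "indep_set (sigma_sets (space M) {X -` A \<inter> space M |A. A \<in> sets S}) (sigma_sets (space M) {Y -` A \<inter> space M |A. A \<in> sets T})"
      using ind unfolding indep_set_def
    proof (rule indep_sets_mono_sets)
      fix c :: bool
      show "case_bool (sigma_sets (space M) {X -` A \<inter> space M |A. A \<in> sets S}) (sigma_sets (space M) {Y -` A \<inter> space M |A. A \<in> sets T}) c
          \<subseteq> case_bool (sets (sources A)) (sets (sources B)) c"
        using sigma_vimage_sources[OF X] sigma_vimage_sources[OF Y] by (cases c) simp_all
    qed
    show "random_variable S X" "random_variable T Y" using X Y by (auto intro: measurable_sources)
  qed
qed

text \<open>
  Fubini's theorem for random elements that are functions of disjoint sets of primitives; they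
  may have different types. Integrating out one primitive at a time replaces conditioning.
\<close>

lemma nn_integral_sources:
  assumes X: "X \<in> sources A \<rightarrow>\<^sub>M S" and Y: "Y \<in> sources B \<rightarrow>\<^sub>M T" and disj: "A \<inter> B = {}"
    and f: "f \<in> borel_measurable (S \<Otimes>\<^sub>M T)"
  shows "(\<integral>\<^sup>+\<omega>. f (X \<omega>, Y \<omega>) \<partial>M) = (\<integral>\<^sup>+\<omega>. (\<integral>\<^sup>+y. f (X \<omega>, y) \<partial>distr M T Y) \<partial>M)"
proof -
  have X': "X \<in> M \<rightarrow>\<^sub>M S" and Y': "Y \<in> M \<rightarrow>\<^sub>M T" using X Y by (auto intro: measurable_sources)
  interpret D: prob_space "distr M T Y" by (rule prob_space_distr[OF Y'])
  interpret C: prob_space "distr M S X" by (rule prob_space_distr[OF X'])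
  have XY: "(\<lambda>\<omega>. (X \<omega>, Y \<omega>)) \<in> M \<rightarrow>\<^sub>M S \<Otimes>\<^sub>M T" using X' Y' by (rule measurable_Pair)
  have eq: "distr M S X \<Otimes>\<^sub>M distr M T Y = distr M (S \<Otimes>\<^sub>M T) (\<lambda>\<omega>. (X \<omega>, Y \<omega>))"
  proof (rule pair_measure_eqI)
    show "sigma_finite_measure (distr M S X)" "sigma_finite_measure (distr M T Y)"
      by (rule C.sigma_finite_measure_axioms D.sigma_finite_measure_axioms)+
    show "sets (distr M S X \<Otimes>\<^sub>M distr M T Y) = sets (distr M (S \<Otimes>\<^sub>M T) (\<lambda>\<omega>. (X \<omega>, Y \<omega>)))"
      by (simp cong: sets_pair_measure_cong)
    fix U V assume "U \<in> sets (distr M S X)" "V \<in> sets (distr M T Y)"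
    then have U: "U \<in> sets S" and V: "V \<in> sets T" by simp_all
    have sU: "X -` U \<inter> space M \<in> sets (sources A)" and sV: "Y -` V \<inter> space M \<in> sets (sources B)"
      using measurable_sets[OF X U] measurable_sets[OF Y V] by simp_all
    have "(\<lambda>\<omega>. (X \<omega>, Y \<omega>)) -` (U \<times> V) \<inter> space M = (X -` U \<inter> space M) \<inter> (Y -` V \<inter> space M)" by auto
    then have "emeasure (distr M (S \<Otimes>\<^sub>M T) (\<lambda>\<omega>. (X \<omega>, Y \<omega>))) (U \<times> V) =
        prob ((X -` U \<inter> space M) \<inter> (Y -` V \<inter> space M))"
      using U V by (subst emeasure_distr[OF XY]) (simp_all add: emeasure_eq_measure)
    also have "\<dots> = ennreal (prob (X -` U \<inter> space M) * prob (Y -` V \<inter> space M))"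
      by (simp only: indep_setD[OF indep_sources[OF disj] sU sV])
    also have "\<dots> = emeasure (distr M S X) U * emeasure (distr M T Y) V"
      by (simp add: emeasure_distr[OF X' U] emeasure_distr[OF Y' V] emeasure_eq_measure ennreal_mult)
    finally show "emeasure (distr M S X) U * emeasure (distr M T Y) V =
      emeasure (distr M (S \<Otimes>\<^sub>M T) (\<lambda>\<omega>. (X \<omega>, Y \<omega>))) (U \<times> V)" by (rule sym)
  qed
  have fD: "f \<in> borel_measurable (distr M S X \<Otimes>\<^sub>M distr M T Y)" using f by simp
  have fD': "f \<in> borel_measurable (S \<Otimes>\<^sub>M distr M T Y)" using f by simp
  have meas: "(\<lambda>x. \<integral>\<^sup>+y. f (x, y) \<partial>distr M T Y) \<in> borel_measurable S"
    by (rule D.borel_measurable_nn_integral_fst[OF fD'])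
  have "(\<integral>\<^sup>+\<omega>. f (X \<omega>, Y \<omega>) \<partial>M) = (\<integral>\<^sup>+z. f z \<partial>distr M (S \<Otimes>\<^sub>M T) (\<lambda>\<omega>. (X \<omega>, Y \<omega>)))"
    by (rule nn_integral_distr[symmetric]) (use XY f in simp_all)
  also have "\<dots> = (\<integral>\<^sup>+z. f z \<partial>(distr M S X \<Otimes>\<^sub>M distr M T Y))" by (simp only: eq)
  also have "\<dots> = (\<integral>\<^sup>+x. (\<integral>\<^sup>+y. f (x, y) \<partial>distr M T Y) \<partial>distr M S X)"
    by (rule D.nn_integral_fst[OF fD, symmetric])
  also have "\<dots> = (\<integral>\<^sup>+\<omega>. (\<integral>\<^sup>+y. f (X \<omega>, y) \<partial>distr M T Y) \<partial>M)"
    by (rule nn_integral_distr[OF X']) (use meas in simp)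
  finally show ?thesis .
qed

end

section \<open>Moments of a marked Poisson process\<close>

text \<open>
  The intensity of a Poisson process is constant: the Poisson weights in the sum of the Erlang
  densities, which are the densities of the epochs, add up to one.
\<close>

lemma suminf_erlang_density:
  assumes "0 < \<rho>"
  shows "(\<Sum>k. ennreal (erlang_density k \<rho> x)) = ennreal \<rho> * indicator {0..} x"
proof (cases "x < 0")
  case True
  then show ?thesis by (simp add: erlang_density_def)
next
  case False
  have "(\<lambda>k. \<rho> * exp (- \<rho> * x) * ((\<rho> * x) ^ k /\<^sub>R fact k)) sums (\<rho> * exp (- \<rho> * x) * exp (\<rho> * x))"
    by (intro sums_mult exp_converges)
  also have "\<rho> * exp (- \<rho> * x) * exp (\<rho> * x) = \<rho>" by (simp add: exp_minus)
  also have "(\<lambda>k. \<rho> * exp (- \<rho> * x) * ((\<rho> * x) ^ k /\<^sub>R fact k)) = (\<lambda>k. erlang_density k \<rho> x)"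
    using False by (intro ext) (simp add: erlang_density_def power_mult_distrib divide_inverse)
  finally have "(\<lambda>k. erlang_density k \<rho> x) sums \<rho>" .
  moreover have "0 \<le> erlang_density k \<rho> x" for k using assms by simp
  ultimately show ?thesis using False suminf_ennreal_eq by (metis atLeast_iff indicator_simps(1) mult.right_neutral not_less)
qed

lemma (in prob_space) indep_sets_inj_reindex:
  assumes ind: "indep_sets F UNIV" and f: "inj f"
  shows "indep_sets (\<lambda>i. F (f i)) UNIV"
  unfolding indep_sets_def
proof (intro conjI ballI allI impI)
  show "F (f i) \<subseteq> events" for i using ind by (auto simp: indep_sets_def)
  fix J A assume J: "J \<noteq> {}" "finite J" and A: "A \<in> Pi J (\<lambda>i. F (f i))"
  define A' where "A' k = A (inv f k)" for k
  have A': "A' (f i) = A i" for i using f by (simp add: A'_def)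
  have "prob (\<Inter>k\<in>f ` J. A' k) = (\<Prod>k\<in>f ` J. prob (A' k))"
    by (rule indep_setsD[OF ind]) (use J A A' in auto)
  then show "prob (\<Inter>i\<in>J. A i) = (\<Prod>i\<in>J. prob (A i))"
    using f by (simp add: A' prod.reindex inj_on_subset[OF f])
qed

text \<open>
  Off the diagonal the pairs are parametrized by the first index and the distance, because the
  distance between two epochs is what is independent of the first one.
\<close>

lemma square_sum_off_diagonal:
  fixes a :: "nat \<Rightarrow> 'b::comm_semiring_1"
  shows "(\<Sum>k<K. a k)\<^sup>2 = (\<Sum>k<K. (a k)\<^sup>2) + 2 * (\<Sum>j<K. \<Sum>m<K - Suc j. a j * a (Suc j + m))"
proof (induction K)
  case (Suc K)
  have "(\<Sum>m<Suc K - Suc j. a j * a (Suc j + m)) = (\<Sum>m<K - Suc j. a j * a (Suc j + m)) + a j * a K"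
    if "j < K" for j
  proof -
    have "Suc K - Suc j = Suc (K - Suc j)" "Suc j + (K - Suc j) = K" using that by auto
    then show ?thesis by simp
  qed
  then have "(\<Sum>j<Suc K. \<Sum>m<Suc K - Suc j. a j * a (Suc j + m)) =
      (\<Sum>j<K. \<Sum>m<K - Suc j. a j * a (Suc j + m)) + (\<Sum>j<K. a j) * a K"
    by (simp add: sum.distrib sum_distrib_right)
  then show ?case using Suc by (simp add: power2_eq_square algebra_simps mult_2)
qed simp

definition half_line_integral :: "(real \<Rightarrow> ennreal) \<Rightarrow> ennreal" where
  "half_line_integral p = (\<integral>\<^sup>+x. p x * indicator {0..} x \<partial>lborel)"

text \<open>The integral over the triangle \<open>0 \<le> x \<le> z\<close> is half of the integral over the quadrant, by symmetry.\<close>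

lemma triangle_integral:
  assumes p[measurable]: "p \<in> borel_measurable borel"
  shows "2 * half_line_integral (\<lambda>x. p x * half_line_integral (\<lambda>y. p (x + y))) = (half_line_integral p)\<^sup>2"
proof -
  define q where "q x z = p x * indicator {0..} x * (p z * indicator {x..} z)" for x z :: real
  have [measurable]: "(\<lambda>(x, z). q x z) \<in> borel_measurable (borel \<Otimes>\<^sub>M borel)"
  proof -
    have "(\<lambda>(x, z). q x z) = (\<lambda>(x, z). if 0 \<le> x \<and> x \<le> z then p x * p z else 0)"
      by (auto simp: q_def fun_eq_iff split: split_indicator)
    then show ?thesis by simp
  qed
  have [measurable]: "(\<lambda>(z, x). q x z) \<in> borel_measurable (borel \<Otimes>\<^sub>M borel)"
    by measurable
  have shift: "half_line_integral (\<lambda>y. p (x + y)) = (\<integral>\<^sup>+z. p z * indicator {x..} z \<partial>lborel)" for x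
    unfolding half_line_integral_def
    by (subst (2) nn_integral_real_affine[of _ 1 x]) (auto intro!: nn_integral_cong split: split_indicator)
  have A: "half_line_integral (\<lambda>x. p x * half_line_integral (\<lambda>y. p (x + y))) = (\<integral>\<^sup>+x. \<integral>\<^sup>+z. q x z \<partial>lborel \<partial>lborel)"
    unfolding shift unfolding half_line_integral_def q_def
    by (intro nn_integral_cong) (simp add: nn_integral_cmult[symmetric] ac_simps)
  also have B: "\<dots> = (\<integral>\<^sup>+z. \<integral>\<^sup>+x. q x z \<partial>lborel \<partial>lborel)"
    by (rule lborel_pair.Fubini'[symmetric]) simp
  finally have "2 * half_line_integral (\<lambda>x. p x * half_line_integral (\<lambda>y. p (x + y))) =
      (\<integral>\<^sup>+x. \<integral>\<^sup>+z. q x z \<partial>lborel \<partial>lborel) + (\<integral>\<^sup>+x. \<integral>\<^sup>+z. q z x \<partial>lborel \<partial>lborel)"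
    using A by (simp add: mult_2)
  also have "\<dots> = (\<integral>\<^sup>+x. (\<integral>\<^sup>+z. q x z \<partial>lborel) + (\<integral>\<^sup>+z. q z x \<partial>lborel) \<partial>lborel)"
    by (rule nn_integral_add[symmetric]) simp_all
  also have "\<dots> = (\<integral>\<^sup>+x. (\<integral>\<^sup>+z. q x z + q z x \<partial>lborel) \<partial>lborel)"
    by (intro nn_integral_cong nn_integral_add[symmetric]) simp_all
  also have "\<dots> = (\<integral>\<^sup>+x. (\<integral>\<^sup>+z. (p x * indicator {0..} x) * (p z * indicator {0..} z) \<partial>lborel) \<partial>lborel)"
  proof (rule nn_integral_cong, rule nn_integral_cong_AE)
    fix x :: real
    have "AE z in lborel. z \<noteq> x" by (rule AE_lborel_singleton)
    then show "AE z in lborel. q x z + q z x = (p x * indicator {0..} x) * (p z * indicator {0..} z)"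
      by eventually_elim (auto simp: q_def ac_simps split: split_indicator)
  qed
  also have "\<dots> = (half_line_integral p)\<^sup>2"
    unfolding half_line_integral_def by (simp add: nn_integral_cmult nn_integral_multc power2_eq_square)
  finally show ?thesis .
qed

context batch_jsq_system
begin

definition batch_rate :: real where "batch_rate = r / real l"

lemma batch_rate_pos: "0 < batch_rate"
  unfolding batch_rate_def using rate_pos batch_bounds by simp

lemma indep_gaps: "indep_vars (\<lambda>_. borel) (gap P) I"
  unfolding indep_vars_def2
proof (intro conjI ballI)
  show "gap P i \<in> borel_measurable M" for i by (rule gap_rv)
  have "indep_sets (\<lambda>k. source_events M P (Gap k)) UNIV"
    by (rule indep_sets_inj_reindex[OF independent]) (simp add: inj_def)
  then show "indep_sets (\<lambda>i. {gap P i -` A \<inter> space M |A. A \<in> sets borel}) I"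
    by (simp only: source_events.simps) (rule indep_sets_mono_index[OF subset_UNIV])
qed

lemma gap_sum_distributed:
  "finite I \<Longrightarrow> I \<noteq> {} \<Longrightarrow> distributed M lborel (\<lambda>\<omega>. \<Sum>i\<in>I. gap P i \<omega>) (erlang_density (card I - 1) batch_rate)"
  unfolding batch_rate_def
  by (rule exponential_distributed_sum) (use rate_pos batch_bounds gap_distributed indep_gaps in auto)

lemma epoch_distributed: "distributed M lborel (epoch P k) (erlang_density k batch_rate)"
  using gap_sum_distributed[of "{..k}"] by (simp add: epoch_def[abs_def])

lemma suminf_nn_integral_erlang:
  assumes [measurable]: "g \<in> borel_measurable borel"
  shows "(\<Sum>k. \<integral>\<^sup>+x. ennreal (erlang_density k batch_rate x) * g x \<partial>lborel) = batch_rate * half_line_integral g"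
proof -
  have "(\<Sum>k. \<integral>\<^sup>+x. ennreal (erlang_density k batch_rate x) * g x \<partial>lborel) =
      (\<integral>\<^sup>+x. (\<Sum>k. ennreal (erlang_density k batch_rate x) * g x) \<partial>lborel)"
    by (rule nn_integral_suminf[symmetric]) simp
  also have "\<dots> = (\<integral>\<^sup>+x. ennreal batch_rate * (g x * indicator {0..} x) \<partial>lborel)"
    by (intro nn_integral_cong) (simp add: ennreal_suminf_multc suminf_erlang_density[OF batch_rate_pos] ac_simps)
  also have "\<dots> = batch_rate * half_line_integral g"
    unfolding half_line_integral_def by (rule nn_integral_cmult) simp
  finally show ?thesis .
qed

text \<open>Campbell's formula for the mean of a sum over the points of a Poisson process.\<close>

lemma campbell_first:
  assumes "g \<in> borel_measurable borel"
  shows "(\<Sum>k. \<integral>\<^sup>+\<omega>. g (epoch P k \<omega>) \<partial>M) = batch_rate * half_line_integral g"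
proof -
  have "(\<integral>\<^sup>+\<omega>. g (epoch P k \<omega>) \<partial>M) = (\<integral>\<^sup>+x. ennreal (erlang_density k batch_rate x) * g x \<partial>lborel)" for k
    by (rule distributed_nn_integral[OF epoch_distributed, symmetric]) (use assms in simp)
  then show ?thesis using suminf_nn_integral_erlang[OF assms] by simp
qed

lemma epoch_sources: "epoch P k \<in> borel_measurable (sources (Gap ` {..k}))"
  unfolding epoch_def[abs_def] by (intro borel_measurable_sum sources_rv(2)[OF _ refl]) auto

text \<open>The epochs after \<open>epoch P j\<close> form a Poisson process that starts there and is independent of it.\<close>

lemma campbell_pairs:
  assumes g[measurable]: "g \<in> borel_measurable borel" and h[measurable]: "h \<in> borel_measurable borel"
  shows "(\<Sum>m. \<integral>\<^sup>+\<omega>. g (epoch P j \<omega>) * h (epoch P (Suc j + m) \<omega>) \<partial>M) =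
    (\<integral>\<^sup>+\<omega>. g (epoch P j \<omega>) * (batch_rate * half_line_integral (\<lambda>y. h (epoch P j \<omega> + y))) \<partial>M)"
proof -
  note epoch_rv[measurable]
  define D where "D m \<omega> = (\<Sum>i\<in>{Suc j..Suc j + m}. gap P i \<omega>)" for m \<omega>
  have D: "distributed M lborel (D m) (erlang_density m batch_rate)" for m
    using gap_sum_distributed[of "{Suc j..Suc j + m}"] by (simp add: D_def[abs_def])
  have eD: "epoch P (Suc j + m) \<omega> = epoch P j \<omega> + D m \<omega>" for m \<omega>
  proof -
    have "{..Suc j + m} = {..j} \<union> {Suc j..Suc j + m}" by auto
    then show ?thesis unfolding epoch_def D_def by (simp add: sum.union_disjoint)
  qed
  have Dm: "D m \<in> borel_measurable (sources (Gap ` {Suc j..Suc j + m}))" for m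
    unfolding D_def[abs_def] by (intro borel_measurable_sum sources_rv(2)[OF _ refl]) auto
  have disj: "Gap ` {..j} \<inter> Gap ` {Suc j..Suc j + m} = {}" for m by auto
  have inner: "(\<integral>\<^sup>+y. h (x + y) \<partial>distr M borel (D m)) = (\<integral>\<^sup>+y. ennreal (erlang_density m batch_rate y) * h (x + y) \<partial>lborel)" for x m
  proof -
    have "distr M borel (D m) = distr M lborel (D m)" by (rule distr_cong) auto
    also have "\<dots> = density lborel (erlang_density m batch_rate)" by (rule distributed_distr_eq_density[OF D])
    finally show ?thesis by (simp add: nn_integral_density)
  qed
  have "(\<integral>\<^sup>+\<omega>. g (epoch P j \<omega>) * h (epoch P (Suc j + m) \<omega>) \<partial>M) =
      (\<integral>\<^sup>+\<omega>. g (epoch P j \<omega>) * (\<integral>\<^sup>+y. ennreal (erlang_density m batch_rate y) * h (epoch P j \<omega> + y) \<partial>lborel) \<partial>M)" for m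
  proof -
    have "(\<integral>\<^sup>+\<omega>. g (epoch P j \<omega>) * h (epoch P (Suc j + m) \<omega>) \<partial>M) =
        (\<integral>\<^sup>+\<omega>. (\<integral>\<^sup>+y. g (epoch P j \<omega>) * h (epoch P j \<omega> + y) \<partial>distr M borel (D m)) \<partial>M)"
      unfolding eD
      using nn_integral_sources[OF epoch_sources Dm disj, of "\<lambda>(x, y). g x * h (x + y)"] by simp
    also have "\<dots> = (\<integral>\<^sup>+\<omega>. g (epoch P j \<omega>) * (\<integral>\<^sup>+y. h (epoch P j \<omega> + y) \<partial>distr M borel (D m)) \<partial>M)"
      by (intro nn_integral_cong nn_integral_cmult) simp
    finally show ?thesis by (simp only: inner)
  qed
  then have "(\<Sum>m. \<integral>\<^sup>+\<omega>. g (epoch P j \<omega>) * h (epoch P (Suc j + m) \<omega>) \<partial>M) =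
      (\<Sum>m. \<integral>\<^sup>+\<omega>. g (epoch P j \<omega>) * (\<integral>\<^sup>+y. ennreal (erlang_density m batch_rate y) * h (epoch P j \<omega> + y) \<partial>lborel) \<partial>M)"
    by simp
  also have "\<dots> = (\<integral>\<^sup>+\<omega>. (\<Sum>m. g (epoch P j \<omega>) * (\<integral>\<^sup>+y. ennreal (erlang_density m batch_rate y) * h (epoch P j \<omega> + y) \<partial>lborel)) \<partial>M)"
    by (rule nn_integral_suminf[symmetric]) simp
  also have "\<dots> = (\<integral>\<^sup>+\<omega>. g (epoch P j \<omega>) * (batch_rate * half_line_integral (\<lambda>y. h (epoch P j \<omega> + y))) \<partial>M)"
    by (simp add: ennreal_suminf_cmult suminf_nn_integral_erlang)
  finally show ?thesis .
qed

end

text \<open>The probability that a task arriving at time \<open>x\<close> has a service requirement \<open>s\<close> with \<open>(x, s) \<in> S\<close>.\<close>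

definition mark_prob :: "(real \<times> real) set \<Rightarrow> real \<Rightarrow> ennreal" where
  "mark_prob S x = (\<integral>\<^sup>+s. indicator S (x, s) \<partial>density lborel (exponential_density 1))"

lemma sigma_finite_exponential: "sigma_finite_measure (density lborel (exponential_density 1))"
  using prob_space_erlang_density[of 1 0] prob_space_imp_sigma_finite by simp

lemma measurable_mark_prob:
  assumes S: "S \<in> sets (borel \<Otimes>\<^sub>M borel)"
  shows "mark_prob S \<in> borel_measurable borel"
proof -
  interpret sigma_finite_measure "density lborel (exponential_density 1)" by (rule sigma_finite_exponential)
  have "S \<in> sets (borel \<Otimes>\<^sub>M density lborel (exponential_density 1))"
    using S by (simp cong: sets_pair_measure_cong)
  then have "indicator S \<in> borel_measurable (borel \<Otimes>\<^sub>M density lborel (exponential_density 1))"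
    by (rule borel_measurable_indicator)
  from borel_measurable_nn_integral_fst[OF this] show ?thesis unfolding mark_prob_def[abs_def] .
qed

context batch_jsq_system
begin

lemma svc_distr: "distr M borel (svc P k j) = density lborel (exponential_density 1)"
proof -
  have "distr M borel (svc P k j) = distr M lborel (svc P k j)" by (rule distr_cong) auto
  then show ?thesis using distributed_distr_eq_density[OF svc_distributed] by simp
qed

lemma nn_integral_mark:
  assumes S[measurable]: "S \<in> sets (borel \<Otimes>\<^sub>M borel)"
  shows "(\<integral>\<^sup>+\<omega>. indicator S (epoch P k \<omega>, svc P k j \<omega>) \<partial>M) = (\<integral>\<^sup>+\<omega>. mark_prob S (epoch P k \<omega>) \<partial>M)"
proof -
  have "Gap ` {..k} \<inter> {Svc k j} = {}" by auto
  from nn_integral_sources[OF epoch_sources sources_rv(5)[OF singletonI refl] this, of "indicator S"]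
  show ?thesis by (simp add: mark_prob_def svc_distr)
qed

text \<open>The two service requirements are integrated out one after the other.\<close>

lemma nn_integral_mark_pair:
  assumes S[measurable]: "S \<in> sets (borel \<Otimes>\<^sub>M borel)" and i: "i < k"
  shows "(\<integral>\<^sup>+\<omega>. indicator S (epoch P i \<omega>, svc P i a \<omega>) * indicator S (epoch P k \<omega>, svc P k c \<omega>) \<partial>M) =
    (\<integral>\<^sup>+\<omega>. mark_prob S (epoch P i \<omega>) * mark_prob S (epoch P k \<omega>) \<partial>M)"
proof -
  have [measurable]: "mark_prob S \<in> borel_measurable borel" by (rule measurable_mark_prob[OF S])
  have gaps: "epoch P m \<in> borel_measurable (sources A)" if "Gap ` {..m} \<subseteq> A" for m A
    unfolding epoch_def[abs_def] using that by (intro borel_measurable_sum sources_rv(2)[OF _ refl]) auto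
  have X: "(\<lambda>\<omega>. (epoch P i \<omega>, svc P i a \<omega>, epoch P k \<omega>)) \<in> sources (range Gap \<union> {Svc i a}) \<rightarrow>\<^sub>M borel \<Otimes>\<^sub>M borel \<Otimes>\<^sub>M borel"
    by (intro measurable_Pair gaps sources_rv(5)[of "Svc i a"]) auto
  have "(range Gap \<union> {Svc i a}) \<inter> {Svc k c} = {}" using i by auto
  from nn_integral_sources[OF X sources_rv(5)[OF singletonI refl] this,
      of "\<lambda>z. indicator S (fst (fst z), fst (snd (fst z))) * indicator S (snd (snd (fst z)), snd z)"]
  have "(\<integral>\<^sup>+\<omega>. indicator S (epoch P i \<omega>, svc P i a \<omega>) * indicator S (epoch P k \<omega>, svc P k c \<omega>) \<partial>M) =
      (\<integral>\<^sup>+\<omega>. (\<integral>\<^sup>+w. indicator S (epoch P i \<omega>, svc P i a \<omega>) * indicator S (epoch P k \<omega>, w) \<partial>density lborel (exponential_density 1)) \<partial>M)"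
    by (simp add: svc_distr)
  also have "\<dots> = (\<integral>\<^sup>+\<omega>. indicator S (epoch P i \<omega>, svc P i a \<omega>) * mark_prob S (epoch P k \<omega>) \<partial>M)"
    unfolding mark_prob_def by (intro nn_integral_cong nn_integral_cmult) simp
  also have "\<dots> = (\<integral>\<^sup>+\<omega>. (\<integral>\<^sup>+s. indicator S (epoch P i \<omega>, s) * mark_prob S (epoch P k \<omega>) \<partial>density lborel (exponential_density 1)) \<partial>M)"
  proof -
    have X: "(\<lambda>\<omega>. (epoch P i \<omega>, epoch P k \<omega>)) \<in> sources (range Gap) \<rightarrow>\<^sub>M borel \<Otimes>\<^sub>M borel"
      by (intro measurable_Pair gaps) auto
    have "range Gap \<inter> {Svc i a} = {}" by auto
    from nn_integral_sources[OF X sources_rv(5)[OF singletonI refl] this,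
        of "\<lambda>z. indicator S (fst (fst z), snd z) * mark_prob S (snd (fst z))"]
    show ?thesis by (simp add: svc_distr)
  qed
  also have "\<dots> = (\<integral>\<^sup>+\<omega>. mark_prob S (epoch P i \<omega>) * mark_prob S (epoch P k \<omega>) \<partial>M)"
    unfolding mark_prob_def[of S "epoch P i _"] by (intro nn_integral_cong nn_integral_multc) simp
  finally show ?thesis .
qed

definition batch_marks :: "(real \<times> real) set \<Rightarrow> nat \<Rightarrow> 'a \<Rightarrow> ennreal" where
  "batch_marks S k \<omega> = (\<Sum>j<l. indicator S (epoch P k \<omega>, svc P k j \<omega>))"

lemma batch_marks_rv:
  assumes [measurable]: "S \<in> sets (borel \<Otimes>\<^sub>M borel)"
  shows "batch_marks S k \<in> borel_measurable M"
proof -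
  note [measurable] = epoch_rv svc_rv
  show ?thesis unfolding batch_marks_def[abs_def] by measurable
qed

lemma nn_integral_batch_marks:
  assumes S[measurable]: "S \<in> sets (borel \<Otimes>\<^sub>M borel)"
  shows "(\<integral>\<^sup>+\<omega>. batch_marks S k \<omega> \<partial>M) = of_nat l * (\<integral>\<^sup>+\<omega>. mark_prob S (epoch P k \<omega>) \<partial>M)"
proof -
  note [measurable] = epoch_rv svc_rv
  have "(\<integral>\<^sup>+\<omega>. batch_marks S k \<omega> \<partial>M) = (\<Sum>j<l. \<integral>\<^sup>+\<omega>. indicator S (epoch P k \<omega>, svc P k j \<omega>) \<partial>M)"
    unfolding batch_marks_def by (rule nn_integral_sum) measurable
  then show ?thesis by (simp add: nn_integral_mark[OF S])
qed

lemma nn_integral_batch_marks_pair: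
  assumes S[measurable]: "S \<in> sets (borel \<Otimes>\<^sub>M borel)" and i: "i < k"
  shows "(\<integral>\<^sup>+\<omega>. batch_marks S i \<omega> * batch_marks S k \<omega> \<partial>M) =
    of_nat l ^ 2 * (\<integral>\<^sup>+\<omega>. mark_prob S (epoch P i \<omega>) * mark_prob S (epoch P k \<omega>) \<partial>M)"
proof -
  note [measurable] = epoch_rv svc_rv
  have "(\<integral>\<^sup>+\<omega>. batch_marks S i \<omega> * batch_marks S k \<omega> \<partial>M) =
      (\<integral>\<^sup>+\<omega>. (\<Sum>a<l. \<Sum>c<l. indicator S (epoch P i \<omega>, svc P i a \<omega>) * indicator S (epoch P k \<omega>, svc P k c \<omega>)) \<partial>M)"
    unfolding batch_marks_def sum_product ..
  also have "\<dots> = (\<Sum>a<l. \<integral>\<^sup>+\<omega>. (\<Sum>c<l. indicator S (epoch P i \<omega>, svc P i a \<omega>) * indicator S (epoch P k \<omega>, svc P k c \<omega>)) \<partial>M)"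
    by (rule nn_integral_sum) measurable
  also have "\<dots> = (\<Sum>a<l. \<Sum>c<l. \<integral>\<^sup>+\<omega>. indicator S (epoch P i \<omega>, svc P i a \<omega>) * indicator S (epoch P k \<omega>, svc P k c \<omega>) \<partial>M)"
    by (intro sum.cong refl nn_integral_sum) measurable
  also have "\<dots> = of_nat l ^ 2 * (\<integral>\<^sup>+\<omega>. mark_prob S (epoch P i \<omega>) * mark_prob S (epoch P k \<omega>) \<partial>M)"
    by (simp add: nn_integral_mark_pair[OF S i] power2_eq_square mult.assoc)
  finally show ?thesis .
qed

text \<open>
  The pairs of tasks from different batches contribute at most the square of the mean. Those
  from the same batch are bounded by the batch size times the mean, since a batch has at most
  \<open>l\<close> tasks in \<open>S\<close>.
\<close>

lemma marks_second_moment: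
  assumes S[measurable]: "S \<in> sets (borel \<Otimes>\<^sub>M borel)"
  shows "(\<integral>\<^sup>+\<omega>. (\<Sum>k<K. batch_marks S k \<omega>)\<^sup>2 \<partial>M) \<le>
    of_nat l * (of_nat l * ennreal batch_rate * half_line_integral (mark_prob S)) +
    (of_nat l * ennreal batch_rate * half_line_integral (mark_prob S))\<^sup>2"
proof -
  let ?G = "batch_marks S" and ?p = "mark_prob S" and ?c = "half_line_integral (mark_prob S)" and ?\<rho> = "ennreal batch_rate"
  have p[measurable]: "?p \<in> borel_measurable borel" by (rule measurable_mark_prob[OF S])
  have [measurable]: "?G k \<in> borel_measurable M" for k by (rule batch_marks_rv[OF S])
  have tm[measurable]: "(\<lambda>x. half_line_integral (\<lambda>y. ?p (x + y))) \<in> borel_measurable borel"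
    unfolding half_line_integral_def by measurable
  have "?G k \<omega> \<le> of_nat l" for k \<omega>
    unfolding batch_marks_def using sum_mono[of "{..<l}" "\<lambda>j. indicator S (epoch P k \<omega>, svc P k j \<omega>)" "\<lambda>_. 1 :: ennreal"]
    by (simp add: indicator_def)
  then have "(\<integral>\<^sup>+\<omega>. (?G k \<omega>)\<^sup>2 \<partial>M) \<le> (\<integral>\<^sup>+\<omega>. of_nat l * ?G k \<omega> \<partial>M)" for k
    unfolding power2_eq_square by (intro nn_integral_mono mult_right_mono) auto
  then have diag: "(\<Sum>k<K. \<integral>\<^sup>+\<omega>. (?G k \<omega>)\<^sup>2 \<partial>M) \<le> (\<Sum>k<K. of_nat l * (of_nat l * (\<integral>\<^sup>+\<omega>. ?p (epoch P k \<omega>) \<partial>M)))"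
    by (intro sum_mono) (simp add: nn_integral_cmult nn_integral_batch_marks[OF S])
  also have "\<dots> = of_nat l * (of_nat l * (\<Sum>k<K. \<integral>\<^sup>+\<omega>. ?p (epoch P k \<omega>) \<partial>M))"
    by (simp add: sum_distrib_left)
  also have "\<dots> \<le> of_nat l * (of_nat l * (\<Sum>k. \<integral>\<^sup>+\<omega>. ?p (epoch P k \<omega>) \<partial>M))"
    by (intro mult_left_mono sum_le_suminf) auto
  also have "\<dots> = of_nat l * (of_nat l * ?\<rho> * ?c)" by (simp add: campbell_first[OF p] mult.assoc)
  finally have 1: "(\<Sum>k<K. \<integral>\<^sup>+\<omega>. (?G k \<omega>)\<^sup>2 \<partial>M) \<le> of_nat l * (of_nat l * ?\<rho> * ?c)" .
  have "(\<Sum>j<K. \<Sum>m<K - Suc j. \<integral>\<^sup>+\<omega>. ?G j \<omega> * ?G (Suc j + m) \<omega> \<partial>M) =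
      of_nat l ^ 2 * (\<Sum>j<K. \<Sum>m<K - Suc j. \<integral>\<^sup>+\<omega>. ?p (epoch P j \<omega>) * ?p (epoch P (Suc j + m) \<omega>) \<partial>M)"
    unfolding sum_distrib_left by (intro sum.cong refl nn_integral_batch_marks_pair[OF S]) simp
  also have "\<dots> \<le> of_nat l ^ 2 * (\<Sum>j<K. \<Sum>m. \<integral>\<^sup>+\<omega>. ?p (epoch P j \<omega>) * ?p (epoch P (Suc j + m) \<omega>) \<partial>M)"
    by (intro mult_left_mono sum_mono sum_le_suminf) auto
  also have "\<dots> = of_nat l ^ 2 * (\<Sum>j<K. \<integral>\<^sup>+\<omega>. ?p (epoch P j \<omega>) * (?\<rho> * half_line_integral (\<lambda>y. ?p (epoch P j \<omega> + y))) \<partial>M)"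
    by (simp only: campbell_pairs[OF p p])
  also have "\<dots> \<le> of_nat l ^ 2 * (\<Sum>j. \<integral>\<^sup>+\<omega>. ?p (epoch P j \<omega>) * (?\<rho> * half_line_integral (\<lambda>y. ?p (epoch P j \<omega> + y))) \<partial>M)"
    by (intro mult_left_mono sum_le_suminf) auto
  also have "\<dots> = of_nat l ^ 2 * (?\<rho> * half_line_integral (\<lambda>x. ?p x * (?\<rho> * half_line_integral (\<lambda>y. ?p (x + y)))))"
    using campbell_first[of "\<lambda>x. ?p x * (?\<rho> * half_line_integral (\<lambda>y. ?p (x + y)))"] by simp
  also have "half_line_integral (\<lambda>x. ?p x * (?\<rho> * half_line_integral (\<lambda>y. ?p (x + y)))) = ?\<rho> * half_line_integral (\<lambda>x. ?p x * half_line_integral (\<lambda>y. ?p (x + y)))"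
    unfolding half_line_integral_def[of "\<lambda>x. ?p x * _ x"] by (subst nn_integral_cmult[symmetric]) (simp_all add: ac_simps)
  finally have 2: "2 * (\<Sum>j<K. \<Sum>m<K - Suc j. \<integral>\<^sup>+\<omega>. ?G j \<omega> * ?G (Suc j + m) \<omega> \<partial>M) \<le>
     2 * (of_nat l ^ 2 * (?\<rho> * (?\<rho> * half_line_integral (\<lambda>x. ?p x * half_line_integral (\<lambda>y. ?p (x + y))))))"
    by (rule mult_left_mono) simp
  also have "\<dots> = of_nat l ^ 2 * (?\<rho> * ?\<rho>) * (2 * half_line_integral (\<lambda>x. ?p x * half_line_integral (\<lambda>y. ?p (x + y))))"
    by (simp only: ac_simps)
  also have "\<dots> = (of_nat l * ?\<rho> * ?c)\<^sup>2"
    unfolding triangle_integral[OF p] by (simp only: power2_eq_square ac_simps)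
  finally have 3: "2 * (\<Sum>j<K. \<Sum>m<K - Suc j. \<integral>\<^sup>+\<omega>. ?G j \<omega> * ?G (Suc j + m) \<omega> \<partial>M) \<le> (of_nat l * ?\<rho> * ?c)\<^sup>2" .
  have "(\<integral>\<^sup>+\<omega>. (\<Sum>k<K. ?G k \<omega>)\<^sup>2 \<partial>M) =
      (\<Sum>k<K. \<integral>\<^sup>+\<omega>. (?G k \<omega>)\<^sup>2 \<partial>M) + 2 * (\<Sum>j<K. \<Sum>m<K - Suc j. \<integral>\<^sup>+\<omega>. ?G j \<omega> * ?G (Suc j + m) \<omega> \<partial>M)"
    unfolding square_sum_off_diagonal by (simp add: nn_integral_add nn_integral_sum nn_integral_cmult)
  then show ?thesis using add_mono[OF 1 3] by (simp only:)
qed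

end

text \<open>A task that arrives at \<open>x \<le> t\<close> is still present at time \<open>t\<close> with probability \<open>exp (x - t)\<close>.\<close>

lemma half_line_integral_present:
  assumes t: "0 \<le> t"
  shows "half_line_integral (mark_prob {(x, s). x \<le> t \<and> t < x + s}) = ennreal (1 - exp (- t))"
proof -
  interpret E: prob_space "density lborel (exponential_density 1)" by (rule prob_space_erlang_density) simp
  have "mark_prob {(x, s). x \<le> t \<and> t < x + s} x = ennreal (exp (x - t)) * indicator {..t} x" for x
  proof (cases "x \<le> t")
    case True
    have "mark_prob {(x, s). x \<le> t \<and> t < x + s} x = (\<integral>\<^sup>+s. indicator (- {..t - x}) s \<partial>density lborel (exponential_density 1))"
      unfolding mark_prob_def using True by (intro nn_integral_cong) (auto split: split_indicator)
    also have "\<dots> = emeasure (density lborel (exponential_density 1)) (space (density lborel (exponential_density 1)) - {..t - x})"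
      by (subst nn_integral_indicator) (auto simp: Compl_eq_Diff_UNIV)
    also have "\<dots> = ennreal (1 - E.prob {..t - x})"
      by (subst E.emeasure_eq_measure, subst E.prob_compl) auto
    also have "E.prob {..t - x} = 1 - exp (x - t)"
      using emeasure_erlang_density[of 1 0 "t - x"] True by (simp add: measure_def erlang_CDF_def)
    finally show ?thesis using True by simp
  qed (simp add: mark_prob_def)
  then have "half_line_integral (mark_prob {(x, s). x \<le> t \<and> t < x + s}) = (\<integral>\<^sup>+x. ennreal (exp (x - t)) * indicator {0..t} x \<partial>lborel)"
    unfolding half_line_integral_def by (intro nn_integral_cong) (auto split: split_indicator)
  also have "\<dots> = ennreal (exp (t - t) - exp (0 - t))"
    by (rule nn_integral_FTC_Icc) (use t in \<open>auto intro!: derivative_eq_intros\<close>)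
  finally show ?thesis by simp
qed

lemma half_line_integral_arrived:
  assumes t: "0 \<le> t"
  shows "half_line_integral (mark_prob {(x, s). x \<le> t}) = ennreal t"
proof -
  interpret E: prob_space "density lborel (exponential_density 1)" by (rule prob_space_erlang_density) simp
  have "mark_prob {(x, s). x \<le> t} x = indicator {..t} x" for x
    using E.emeasure_space_1 by (simp add: mark_prob_def indicator_def)
  then have "half_line_integral (mark_prob {(x, s). x \<le> t}) = (\<integral>\<^sup>+x. indicator {0..t} x \<partial>lborel)"
    unfolding half_line_integral_def by (intro nn_integral_cong) (auto split: split_indicator)
  then show ?thesis using t by simp
qed

context batch_jsq_system
begin

text \<open>
  The number of tasks \<open>(epoch, requirement)\<close> in \<open>S\<close>. All sets \<open>S\<close> of interest concern tasks
  arrived by time \<open>T\<close>, which are finitely many.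
\<close>

definition mark_count :: "(real \<times> real) set \<Rightarrow> real \<Rightarrow> 'a \<Rightarrow> real" where
  "mark_count S T \<omega> = (\<Sum>k | epoch P k \<omega> \<le> T. \<Sum>j<l. indicator S (epoch P k \<omega>, svc P k j \<omega>))"

lemma rate_eq: "real l * batch_rate = r"
  unfolding batch_rate_def using batch_bounds by simp

text \<open>
  For each outcome the partial sums are eventually constant, which permits to pass to the
  limit in the second moment by Fatou's lemma.
\<close>

lemma mark_count_partial_sums:
  assumes \<omega>: "\<omega> \<in> space M" and ST: "S \<subseteq> {..T} \<times> UNIV"
  shows "\<forall>\<^sub>F K in sequentially. (\<Sum>k<K. batch_marks S k \<omega>) = ennreal (mark_count S T \<omega>)"
proof -
  let ?F = "{k. epoch P k \<omega> \<le> T}"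
  have fin: "finite ?F" by (rule finite_epochs[OF epochs_diverge[OF \<omega>]])
  have bm: "batch_marks S k \<omega> = ennreal (\<Sum>j<l. indicator S (epoch P k \<omega>, svc P k j \<omega>))" for k
    unfolding batch_marks_def by (subst sum_ennreal[symmetric]) (auto simp: ennreal_indicator)
  have zero: "batch_marks S k \<omega> = 0" if "k \<notin> ?F" for k
    unfolding batch_marks_def using that ST by (intro sum.neutral) (auto simp: indicator_def)
  obtain m where m: "?F \<subseteq> {..<m}" using fin finite_nat_bounded by blast
  have "(\<Sum>k<K. batch_marks S k \<omega>) = ennreal (mark_count S T \<omega>)" if "m \<le> K" for K
  proof -
    have "(\<Sum>k<K. batch_marks S k \<omega>) = (\<Sum>k\<in>?F. batch_marks S k \<omega>)"
      by (rule sum.mono_neutral_right) (use m that zero in auto)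
    also have "\<dots> = ennreal (mark_count S T \<omega>)"
      unfolding bm mark_count_def by (intro sum_ennreal sum_nonneg) auto
    finally show ?thesis .
  qed
  then show ?thesis unfolding eventually_sequentially by blast
qed

lemma mark_count_suminf:
  assumes \<omega>: "\<omega> \<in> space M" and ST: "S \<subseteq> {..T} \<times> UNIV"
  shows "ennreal (mark_count S T \<omega>) = (\<Sum>k. batch_marks S k \<omega>)"
proof -
  have "(\<lambda>k. batch_marks S k \<omega>) sums ennreal (mark_count S T \<omega>)"
    unfolding sums_def by (rule tendsto_eventually[OF mark_count_partial_sums[OF assms]])
  then show ?thesis by (simp add: sums_iff)
qed

lemma mark_count_nonneg: "0 \<le> mark_count S T \<omega>"
  unfolding mark_count_def by (intro sum_nonneg) simp

lemma mark_count_rv: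
  assumes S: "S \<in> sets (borel \<Otimes>\<^sub>M borel)" and ST: "S \<subseteq> {..T} \<times> UNIV"
  shows "mark_count S T \<in> borel_measurable M"
proof -
  note [measurable] = batch_marks_rv[OF S]
  have "(\<lambda>\<omega>. enn2real (\<Sum>k. batch_marks S k \<omega>)) \<in> borel_measurable M" by measurable
  moreover have "enn2real (\<Sum>k. batch_marks S k \<omega>) = mark_count S T \<omega>" if "\<omega> \<in> space M" for \<omega>
    using mark_count_suminf[OF that ST, symmetric] mark_count_nonneg by simp
  ultimately show ?thesis by (subst measurable_cong[where g = "\<lambda>\<omega>. enn2real (\<Sum>k. batch_marks S k \<omega>)"]) auto
qed

text \<open>Chebyshev's inequality. The bound vanishes after scaling by \<open>N\<close> as soon as \<open>l * r / N^2\<close> does.\<close>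

lemma mark_count_deviation:
  assumes S: "S \<in> sets (borel \<Otimes>\<^sub>M borel)" and ST: "S \<subseteq> {..T} \<times> UNIV"
    and c: "half_line_integral (mark_prob S) = ennreal c" "0 \<le> c" and a: "0 < a"
  shows "prob {\<omega> \<in> space M. a \<le> \<bar>mark_count S T \<omega> - r * c\<bar>} \<le> real l * r * c / a\<^sup>2"
proof -
  note [measurable] = mark_count_rv[OF S ST] batch_marks_rv[OF S]
  let ?Y = "mark_count S T"
  have rc: "0 \<le> r * c" using c rate_pos by simp
  have R: "of_nat l * ennreal batch_rate * ennreal c = ennreal (r * c)"
    using batch_rate_pos rate_eq c rate_pos by (simp add: ennreal_of_nat_eq_real_of_nat ennreal_mult[symmetric])
  have m1: "(\<integral>\<^sup>+\<omega>. ennreal (?Y \<omega>) \<partial>M) = ennreal (r * c)"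
  proof -
    have "(\<integral>\<^sup>+\<omega>. ennreal (?Y \<omega>) \<partial>M) = (\<integral>\<^sup>+\<omega>. (\<Sum>k. batch_marks S k \<omega>) \<partial>M)"
      by (intro nn_integral_cong mark_count_suminf ST)
    also have "\<dots> = (\<Sum>k. \<integral>\<^sup>+\<omega>. batch_marks S k \<omega> \<partial>M)" by (rule nn_integral_suminf) simp
    also have "\<dots> = of_nat l * (\<Sum>k. \<integral>\<^sup>+\<omega>. mark_prob S (epoch P k \<omega>) \<partial>M)"
      by (simp add: nn_integral_batch_marks[OF S])
    also have "\<dots> = of_nat l * ennreal batch_rate * ennreal c"
      by (simp only: campbell_first[OF measurable_mark_prob[OF S]] c(1) mult.assoc)
    finally show ?thesis using R by simp
  qed
  have m2: "(\<integral>\<^sup>+\<omega>. ennreal ((?Y \<omega>)\<^sup>2) \<partial>M) \<le> ennreal (real l * (r * c) + (r * c)\<^sup>2)"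
  proof -
    have "(\<integral>\<^sup>+\<omega>. ennreal ((?Y \<omega>)\<^sup>2) \<partial>M) = (\<integral>\<^sup>+\<omega>. liminf (\<lambda>K. (\<Sum>k<K. batch_marks S k \<omega>)\<^sup>2) \<partial>M)"
    proof (rule nn_integral_cong)
      fix \<omega> assume "\<omega> \<in> space M"
      have "\<forall>\<^sub>F K in sequentially. (\<Sum>k<K. batch_marks S k \<omega>)\<^sup>2 = ennreal ((?Y \<omega>)\<^sup>2)"
        using mark_count_partial_sums[OF \<open>\<omega> \<in> space M\<close> ST]
        by eventually_elim (simp add: mark_count_nonneg ennreal_power)
      then have "(\<lambda>K. (\<Sum>k<K. batch_marks S k \<omega>)\<^sup>2) \<longlonglongrightarrow> ennreal ((?Y \<omega>)\<^sup>2)" by (rule tendsto_eventually)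
      then show "ennreal ((?Y \<omega>)\<^sup>2) = liminf (\<lambda>K. (\<Sum>k<K. batch_marks S k \<omega>)\<^sup>2)"
        by (rule lim_imp_Liminf[OF sequentially_bot, symmetric])
    qed
    also have "\<dots> \<le> liminf (\<lambda>K. \<integral>\<^sup>+\<omega>. (\<Sum>k<K. batch_marks S k \<omega>)\<^sup>2 \<partial>M)"
      by (rule nn_integral_liminf) simp
    also have "\<dots> \<le> liminf (\<lambda>K. ennreal (real l * (r * c) + (r * c)\<^sup>2))"
    proof (intro Liminf_mono always_eventually allI)
      fix K
      have "ennreal (real l * (r * c) + (r * c)\<^sup>2) = of_nat l * ennreal (r * c) + (ennreal (r * c))\<^sup>2"
        using rc by (simp only: ennreal_of_nat_eq_real_of_nat ennreal_power ennreal_mult[symmetric]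
            ennreal_plus[symmetric] of_nat_0_le_iff mult_nonneg_nonneg zero_le_power2)
      then show "(\<integral>\<^sup>+\<omega>. (\<Sum>k<K. batch_marks S k \<omega>)\<^sup>2 \<partial>M) \<le> ennreal (real l * (r * c) + (r * c)\<^sup>2)"
        using marks_second_moment[OF S, of K] unfolding c(1) R by (simp only:)
    qed
    also have "\<dots> = ennreal (real l * (r * c) + (r * c)\<^sup>2)" by (simp add: Liminf_const)
    finally show ?thesis .
  qed
  have i2: "integrable M (\<lambda>\<omega>. (?Y \<omega>)\<^sup>2)"
    by (rule integrableI_nonneg) (use m2 in \<open>auto simp: less_top[symmetric] top_unique\<close>)
  have i1: "integrable M ?Y" by (rule square_integrable_imp_integrable[OF _ i2]) simp
  have e1: "expectation ?Y = r * c"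
    using m1 rc by (subst integral_eq_nn_integral) (auto simp: mark_count_nonneg)
  have "ennreal (expectation (\<lambda>\<omega>. (?Y \<omega>)\<^sup>2)) \<le> ennreal (real l * (r * c) + (r * c)\<^sup>2)"
    using m2 by (subst nn_integral_eq_integral[OF i2, symmetric]) auto
  then have e2: "expectation (\<lambda>\<omega>. (?Y \<omega>)\<^sup>2) \<le> real l * (r * c) + (r * c)\<^sup>2"
    using rc by (subst (asm) ennreal_le_iff) auto
  have "prob {\<omega> \<in> space M. a \<le> \<bar>?Y \<omega> - r * c\<bar>} \<le> variance ?Y / a\<^sup>2"
    using Chebyshev_inequality[OF _ i2 a] unfolding e1 by simp
  also have "variance ?Y \<le> real l * (r * c)" using e2 variance_eq[OF i1 i2] unfolding e1 by simp
  finally show ?thesis using a by (simp add: divide_right_mono mult.assoc)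
qed

end

section \<open>Concentration of the initial tasks and rarity of bad batches\<close>

definition initial_busy :: "nat \<Rightarrow> 'a primitives \<Rightarrow> 'a \<Rightarrow> nat" where
  "initial_busy N P \<omega> = card {n. n < N \<and> 1 \<le> init P \<omega> ! n}"

context batch_jsq_system
begin

text \<open>
  Given the initial queues, the first tasks survive until \<open>t\<close> independently with probability
  \<open>exp (- t)\<close>. The centred indicators are uncorrelated, so that the variance is at most \<open>N\<close>.
\<close>

lemma initial_deviation:
  assumes t: "0 \<le> t" and a: "0 < a"
  shows "prob {\<omega> \<in> space M. a \<le> \<bar>real (initial_present N P t \<omega>) - exp (- t) * real (initial_busy N P \<omega>)\<bar>} \<le> real N / a\<^sup>2"
proof -
  note [measurable] = init_rv svc0_rv
  define p where "p = exp (- t)"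
  have p: "0 < p" "p \<le> 1" using t by (auto simp: p_def)
  define v where "v n \<omega> = of_bool (t < svc0 P n 0 \<omega>) - p" for n \<omega>
  define u where "u n \<omega> = of_bool (1 \<le> init P \<omega> ! n) * v n \<omega>" for n \<omega>
  have occ[measurable]: "(\<lambda>\<omega>. of_bool (1 \<le> init P \<omega> ! n) :: real) \<in> borel_measurable M" for n
    by (rule measurable_compose[OF init_rv]) simp
  have [measurable]: "v n \<in> borel_measurable M" for n unfolding v_def of_bool_def by measurable
  have [measurable]: "u n \<in> borel_measurable M" for n unfolding u_def by measurable
  have vb: "\<bar>v n \<omega>\<bar> \<le> 1" for n \<omega> using p by (auto simp: v_def of_bool_def)
  have ub: "\<bar>u n \<omega>\<bar> \<le> 1" for n \<omega> using vb[of n \<omega>] by (simp add: u_def of_bool_def)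
  have mean: "expectation (v n) = 0" for n
  proof -
    have "expectation (\<lambda>\<omega>. of_bool (t < svc0 P n 0 \<omega>)) = expectation (indicator {\<omega> \<in> space M. t < svc0 P n 0 \<omega>})"
      by (rule Bochner_Integration.integral_cong) (auto simp: indicator_def)
    also have "\<dots> = prob {\<omega> \<in> space M. t < svc0 P n 0 \<omega>}" by simp
    also have "\<dots> = p" using exponential_distributedD_gt[OF svc0_distributed t, of n 0] by (simp add: p_def)
    finally have "expectation (\<lambda>\<omega>. of_bool (t < svc0 P n 0 \<omega>)) = p" .
    moreover have "integrable M (\<lambda>\<omega>. of_bool (t < svc0 P n 0 \<omega>) :: real)"
      by (rule integrable_const_bound[of _ 1]) (auto simp: of_bool_def)
    ultimately show ?thesis unfolding v_def by (simp add: prob_space)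
  qed
  have int: "integrable M (\<lambda>\<omega>. u n \<omega> * u m \<omega>)" for n m
    using ub by (intro integrable_const_bound[of _ 1]) (auto simp: abs_mult mult_le_one)
  have off: "expectation (\<lambda>\<omega>. u n \<omega> * u m \<omega>) = 0" if "n \<noteq> m" for n m
  proof -
    define x where "x \<omega> = of_bool (1 \<le> init P \<omega> ! n) * u m \<omega>" for \<omega>
    have init_s: "init P \<in> sources {Init, Svc0 m 0} \<rightarrow>\<^sub>M count_space UNIV"
      by (rule sources_rv(1)[OF _ refl]) simp
    have occ_s[measurable]: "(\<lambda>\<omega>. of_bool (1 \<le> init P \<omega> ! i) :: real) \<in> borel_measurable (sources {Init, Svc0 m 0})" for i
      by (rule measurable_compose[OF init_s]) simp
    have [measurable]: "svc0 P m 0 \<in> borel_measurable (sources {Init, Svc0 m 0})"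
      by (rule sources_rv(4)[OF _ refl]) simp
    have X: "x \<in> borel_measurable (sources {Init, Svc0 m 0})"
      unfolding x_def u_def v_def of_bool_def[of "t < _"] by measurable
    have [measurable]: "svc0 P n 0 \<in> borel_measurable (sources {Svc0 n 0})"
      by (rule sources_rv(4)[OF singletonI refl])
    have Y: "v n \<in> borel_measurable (sources {Svc0 n 0})" unfolding v_def of_bool_def by measurable
    have ind: "indep_var borel x borel (v n)"
      by (rule indep_var_sources[OF X Y]) (use that in auto)
    have [measurable]: "x \<in> borel_measurable M" by (rule measurable_sources[OF X])
    have "\<bar>x \<omega>\<bar> \<le> 1" for \<omega> using ub[of m \<omega>] by (simp add: x_def of_bool_def)
    then have "integrable M x" by (intro integrable_const_bound[of _ 1]) auto
    moreover have "integrable M (v n)" using vb by (intro integrable_const_bound[of _ 1]) auto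
    ultimately have "expectation (\<lambda>\<omega>. x \<omega> * v n \<omega>) = expectation x * expectation (v n)"
      by (rule indep_var_lebesgue_integral[OF ind])
    moreover have "u n \<omega> * u m \<omega> = x \<omega> * v n \<omega>" for \<omega> by (simp add: u_def x_def ac_simps)
    ultimately show ?thesis by (simp add: mean)
  qed
  define W where "W \<omega> = (\<Sum>n<N. u n \<omega>)" for \<omega>
  have W2: "(W \<omega>)\<^sup>2 = (\<Sum>n<N. \<Sum>m<N. u n \<omega> * u m \<omega>)" for \<omega>
    unfolding W_def power2_eq_square sum_product ..
  have iW: "integrable M (\<lambda>\<omega>. (W \<omega>)\<^sup>2)" unfolding W2 by (intro Bochner_Integration.integrable_sum int)
  have "expectation (\<lambda>\<omega>. (W \<omega>)\<^sup>2) = (\<Sum>n<N. \<Sum>m<N. expectation (\<lambda>\<omega>. u n \<omega> * u m \<omega>))"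
    unfolding W2 by (simp add: Bochner_Integration.integral_sum Bochner_Integration.integrable_sum int)
  also have "\<dots> = (\<Sum>n<N. \<Sum>m<N. if m = n then expectation (\<lambda>\<omega>. u n \<omega> * u n \<omega>) else 0)"
    by (intro sum.cong refl) (auto simp: off)
  also have "\<dots> = (\<Sum>n<N. expectation (\<lambda>\<omega>. u n \<omega> * u n \<omega>))" by simp
  also have "\<dots> \<le> (\<Sum>n<N. 1)"
  proof (rule sum_mono)
    fix n
    have "u n \<omega> * u n \<omega> \<le> 1" for \<omega> using ub[of n \<omega>] by (metis abs_square_le_1 power2_eq_square)
    then have "expectation (\<lambda>\<omega>. u n \<omega> * u n \<omega>) \<le> expectation (\<lambda>\<omega>. 1)"
      by (intro integral_mono int) auto
    then show "expectation (\<lambda>\<omega>. u n \<omega> * u n \<omega>) \<le> 1" by (simp add: prob_space)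
  qed
  finally have EW: "expectation (\<lambda>\<omega>. (W \<omega>)\<^sup>2) \<le> real N" by simp
  have eq: "W \<omega> = real (initial_present N P t \<omega>) - exp (- t) * real (initial_busy N P \<omega>)" for \<omega>
  proof -
    have "u n \<omega> = real (of_bool (1 \<le> init P \<omega> ! n \<and> t < svc0 P n 0 \<omega>)) - p * real (of_bool (1 \<le> init P \<omega> ! n))" for n
      by (simp add: u_def v_def of_bool_def)
    then have "W \<omega> = (\<Sum>n<N. real (of_bool (1 \<le> init P \<omega> ! n \<and> t < svc0 P n 0 \<omega>))) - p * (\<Sum>n<N. real (of_bool (1 \<le> init P \<omega> ! n)))"
      unfolding W_def by (simp only: sum_subtractf sum_distrib_left)
    then show ?thesis
      unfolding initial_present_def initial_busy_def card_eq_sum_of_bool p_def of_nat_sum .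
  qed
  have "prob {\<omega> \<in> space M. a \<le> \<bar>W \<omega>\<bar>} \<le> expectation (\<lambda>\<omega>. (W \<omega>)\<^sup>2) / a\<^sup>2"
    using iW a by (intro second_moment_method) (auto simp: W_def)
  also have "\<dots> \<le> real N / a\<^sup>2" using EW by (intro divide_right_mono) auto
  finally show ?thesis unfolding eq .
qed

lemma pending_epoch_rv: "(\<lambda>\<omega>. pending (ledger_at b l P k \<omega>) (epoch P k \<omega>) n) \<in> M \<rightarrow>\<^sub>M count_space UNIV"
  by (rule measurable_pending[OF ledger_rv epoch_rv])

lemma few_idle_rv: "Measurable.pred M (few_idle b l P k)"
  unfolding few_idle_def[abs_def]
proof (rule measurable_compose_countable[OF _ sample_rv])
  fix ns
  have "(\<lambda>\<omega>. map (\<lambda>n. pending (ledger_at b l P k \<omega>) (epoch P k \<omega>) n) ns) \<in> M \<rightarrow>\<^sub>M count_space UNIV"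
    by (intro measurable_count_space_map pending_epoch_rv)
  from measurable_compose[OF this, of "\<lambda>xs. length (filter (\<lambda>x. x = 0) xs) < l" "count_space UNIV"]
  show "Measurable.pred M (\<lambda>\<omega>. length (filter (\<lambda>n. pending (ledger_at b l P k \<omega>) (epoch P k \<omega>) n = 0) ns) < l)"
    by (simp add: filter_map o_def)
qed

lemma busy_rv:
  assumes "ledger_measurable F L" "e \<in> borel_measurable F"
  shows "(\<lambda>\<omega>. busy N (L \<omega>) (e \<omega>)) \<in> F \<rightarrow>\<^sub>M count_space UNIV"
proof -
  define g where "g xs = card {n. n < N \<and> 1 \<le> xs ! n}" for xs :: "nat list"
  have "(\<lambda>\<omega>. map (\<lambda>n. pending (L \<omega>) (e \<omega>) n) [0..<N]) \<in> F \<rightarrow>\<^sub>M count_space UNIV"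
    by (intro measurable_count_space_map measurable_pending assms)
  then have "(\<lambda>\<omega>. g (map (\<lambda>n. pending (L \<omega>) (e \<omega>) n) [0..<N])) \<in> F \<rightarrow>\<^sub>M count_space UNIV"
    by (rule measurable_compose) simp
  moreover have "g (map (\<lambda>n. pending (L \<omega>) (e \<omega>) n) [0..<N]) = busy N (L \<omega>) (e \<omega>)" for \<omega>
    unfolding busy_def g_def by (rule arg_cong[where f = card]) auto
  ultimately show ?thesis by simp
qed

text \<open>Batch \<open>k\<close> contributes to \<open>bad_arrivals\<close>.\<close>

definition overload :: "real \<Rightarrow> real \<Rightarrow> nat \<Rightarrow> 'a \<Rightarrow> bool" where
  "overload \<theta> T k \<omega> \<longleftrightarrow> epoch P k \<omega> \<le> T \<and> few_idle b l P k \<omega> \<and>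
     real (busy N (ledger_at b l P k \<omega>) (epoch P k \<omega>)) \<le> \<theta>"

lemma overload_rv: "Measurable.pred M (overload \<theta> T k)"
proof -
  note [measurable] = epoch_rv few_idle_rv busy_rv[OF ledger_rv epoch_rv]
  show ?thesis unfolding overload_def[abs_def] by measurable
qed

lemma bad_arrivals_overload: "bad_arrivals b N l P \<theta> T \<omega> = l * card {k. overload \<theta> T k \<omega>}"
  by (simp add: bad_arrivals_def overload_def)

lemma bad_arrivals_rv: "bad_arrivals b N l P \<theta> T \<in> M \<rightarrow>\<^sub>M count_space UNIV"
proof -
  note [measurable] = overload_rv
  have "(\<lambda>\<omega>. card {k. overload \<theta> T k \<omega>}) \<in> M \<rightarrow>\<^sub>M count_space UNIV"
    by (rule measurable_card) simp
  from measurable_compose[OF this, of "\<lambda>c. l * c" "count_space UNIV"]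
  show ?thesis unfolding bad_arrivals_overload[abs_def] by simp
qed

text \<open>
  The sample of batch \<open>k\<close> is independent of all other primitives, hence of its epoch and of
  the ledger at that time. Given these, \<open>few_idle_draws\<close> applies to the set of the idle
  servers.
\<close>

lemma overload_prob:
  assumes \<delta>: "0 < \<delta>" and enough: "(1 + \<delta>) * real l \<le> real d * (real N - \<theta>) / real N"
  shows "emeasure M {\<omega> \<in> space M. overload \<theta> T k \<omega>} \<le>
    ennreal ((1 + \<delta>)\<^sup>2 / \<delta>\<^sup>2 / real l) * (\<integral>\<^sup>+\<omega>. indicator {..T} (epoch P k \<omega>) \<partial>M)"
proof -
  let ?A = "- {Sample k}" and ?C = "(1 + \<delta>)\<^sup>2 / \<delta>\<^sup>2 / real l" and ?D = "measure_pmf (pmf_of_set (draws N d))"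
  let ?L = "ledger_at b l P k" and ?e = "epoch P k"
  let ?q = "\<lambda>\<omega>. map (\<lambda>n. pending (?L \<omega>) (?e \<omega>) n) [0..<N]"
  define Z where "Z \<omega> = (?e \<omega> \<le> T \<and> real (busy N (?L \<omega>) (?e \<omega>)) \<le> \<theta>, ?q \<omega>)" for \<omega>
  define f :: "(bool \<times> nat list) \<times> nat list \<Rightarrow> ennreal"
    where "f z = of_bool (fst (fst z) \<and> length (filter (\<lambda>n. snd (fst z) ! n = 0) (snd z)) < l)" for z
  have L: "ledger_measurable (sources ?A) ?L"
    by (intro ledger_measurable_ledger_at sources_rv(1)[OF _ refl] sources_rv(2)[OF _ refl]
        sources_rv(3)[OF _ refl] sources_rv(4)[OF _ refl] sources_rv(5)[OF _ refl]) auto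
  have e: "?e \<in> borel_measurable (sources ?A)"
    unfolding epoch_def[abs_def] by (intro borel_measurable_sum sources_rv(2)[OF _ refl]) auto
  have Z: "Z \<in> sources ?A \<rightarrow>\<^sub>M count_space UNIV"
  proof -
    note [measurable] = e busy_rv[OF L e]
    have [measurable]: "?q \<in> sources ?A \<rightarrow>\<^sub>M count_space UNIV"
      by (intro measurable_count_space_map measurable_pending L e)
    show ?thesis unfolding Z_def[abs_def] by measurable
  qed
  have smp: "sample P k \<in> sources {Sample k} \<rightarrow>\<^sub>M count_space UNIV" by (rule sources_rv(3)[OF singletonI refl])
  have ne: "draws N d \<noteq> {}" using draws_nonempty batch_bounds by simp
  have inner: "(\<integral>\<^sup>+ns. f (Z \<omega>, ns) \<partial>?D) \<le> ennreal ?C * indicator {..T} (?e \<omega>)" for \<omega>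
  proof (cases "?e \<omega> \<le> T \<and> real (busy N (?L \<omega>) (?e \<omega>)) \<le> \<theta>")
    case False
    then have "f (Z \<omega>, ns) = 0" for ns by (auto simp: f_def Z_def)
    then show ?thesis by simp
  next
    case True
    let ?I = "{n. n < N \<and> pending (?L \<omega>) (?e \<omega>) n = 0}"
    let ?B = "{ns. length (filter (\<lambda>n. ?q \<omega> ! n = 0) ns) < l}"
    have "card (?I \<union> {n. n < N \<and> 1 \<le> pending (?L \<omega>) (?e \<omega>) n}) = card ?I + busy N (?L \<omega>) (?e \<omega>)"
      unfolding busy_def by (rule card_Un_disjoint) auto
    moreover have "?I \<union> {n. n < N \<and> 1 \<le> pending (?L \<omega>) (?e \<omega>) n} = {..<N}" by auto
    ultimately have "real N = real (card ?I) + real (busy N (?L \<omega>) (?e \<omega>))" by simp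
    then have "real N - \<theta> \<le> real (card ?I)" using True by linarith
    then have "real d * (real N - \<theta>) / real N \<le> real d * real (card ?I) / real N"
      by (intro divide_right_mono mult_left_mono) auto
    then have few: "real (card {ns \<in> draws N d. card (?I \<inter> set ns) < l}) \<le> real (card (draws N d)) * ?C"
      using enough batch_bounds by (intro few_idle_draws[OF _ _ _ _ \<delta>]) auto
    have "(\<integral>\<^sup>+ns. f (Z \<omega>, ns) \<partial>?D) = (\<integral>\<^sup>+ns. indicator ?B ns \<partial>?D)"
      using True by (intro nn_integral_cong) (simp add: f_def Z_def indicator_def)
    also have "\<dots> = emeasure ?D ?B" by simp
    also have "\<dots> = ennreal (real (card (draws N d \<inter> ?B)) / real (card (draws N d)))"
      by (rule emeasure_pmf_of_set[OF ne finite_draws])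
    also have "draws N d \<inter> ?B = {ns \<in> draws N d. card (?I \<inter> set ns) < l}"
    proof -
      have "length (filter (\<lambda>n. ?q \<omega> ! n = 0) ns) = card (?I \<inter> set ns)"
        if ns: "ns \<in> draws N d" for ns
      proof -
        have "distinct (filter (\<lambda>n. ?q \<omega> ! n = 0) ns)"
          using ns by (simp add: draws_def)
        moreover have "set (filter (\<lambda>n. ?q \<omega> ! n = 0) ns) = ?I \<inter> set ns"
          using ns by (auto simp: draws_def)
        ultimately show ?thesis by (metis distinct_card)
      qed
      then show ?thesis by auto
    qed
    also have "ennreal (real (card {ns \<in> draws N d. card (?I \<inter> set ns) < l}) / real (card (draws N d))) \<le> ennreal ?C"
    proof (rule ennreal_leI)
      have "0 < real (card (draws N d))" using ne by (simp add: card_gt_0_iff)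
      then show "real (card {ns \<in> draws N d. card (?I \<inter> set ns) < l}) / real (card (draws N d)) \<le> ?C"
        using few by (subst pos_divide_le_eq) (auto simp: mult.commute)
    qed
    finally show ?thesis using True by simp
  qed
  have "emeasure M {\<omega> \<in> space M. overload \<theta> T k \<omega>} = (\<integral>\<^sup>+\<omega>. indicator {\<omega> \<in> space M. overload \<theta> T k \<omega>} \<omega> \<partial>M)"
    using overload_rv[of \<theta> T k] by simp
  also have "\<dots> = (\<integral>\<^sup>+\<omega>. f (Z \<omega>, sample P k \<omega>) \<partial>M)"
  proof (rule nn_integral_cong_AE)
    from sample_draws[of k] AE_space
    show "AE \<omega> in M. indicator {\<omega> \<in> space M. overload \<theta> T k \<omega>} \<omega> = f (Z \<omega>, sample P k \<omega>)"
    proof eventually_elim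
      case (elim \<omega>)
      have "filter (\<lambda>n. ?q \<omega> ! n = 0) (sample P k \<omega>) =
          filter (\<lambda>n. pending (?L \<omega>) (?e \<omega>) n = 0) (sample P k \<omega>)"
        using elim by (intro filter_cong refl) (auto simp: draws_def)
      then show ?case using elim by (simp add: f_def Z_def overload_def few_idle_def indicator_def of_bool_def)
    qed
  qed
  also have "\<dots> = (\<integral>\<^sup>+\<omega>. (\<integral>\<^sup>+ns. f (Z \<omega>, ns) \<partial>distr M (count_space UNIV) (sample P k)) \<partial>M)"
    by (rule nn_integral_sources[OF Z smp]) (auto simp: pair_measure_countable)
  also have "\<dots> \<le> (\<integral>\<^sup>+\<omega>. ennreal ?C * indicator {..T} (?e \<omega>) \<partial>M)"
    unfolding sample_distr by (intro nn_integral_mono inner)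
  also have "\<dots> = ennreal ?C * (\<integral>\<^sup>+\<omega>. indicator {..T} (?e \<omega>) \<partial>M)"
    using epoch_rv[of k] by (intro nn_integral_cmult) measurable
  finally show ?thesis .
qed

text \<open>
  Each batch arriving before \<open>T\<close> is bad with probability of order \<open>1 / l\<close> and then counts \<open>l\<close>
  times, so the expectation is of the order of the expected number \<open>batch_rate * T\<close> of
  batches. As these have many tasks each, this is small compared to the number of tasks.
  Markov's inequality completes the proof.
\<close>

lemma bad_arrivals_tail:
  assumes \<delta>: "0 < \<delta>" and enough: "(1 + \<delta>) * real l \<le> real d * (real N - \<theta>) / real N"
    and T: "0 \<le> T" and a: "0 < a"
  shows "prob {\<omega> \<in> space M. a \<le> real (bad_arrivals b N l P \<theta> T \<omega>)} \<le> (1 + \<delta>)\<^sup>2 / \<delta>\<^sup>2 * batch_rate * T / a"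
proof -
  let ?C = "(1 + \<delta>)\<^sup>2 / \<delta>\<^sup>2 / real l" and ?Y = "\<lambda>\<omega>. ennreal (real (bad_arrivals b N l P \<theta> T \<omega>))"
  note [measurable] = overload_rv bad_arrivals_rv
  have lpos: "0 < real l" using batch_bounds by simp
  have prod4: "ennreal x * (ennreal y * (ennreal z * ennreal w)) = ennreal (x * (y * (z * w)))"
    if "0 \<le> x" "0 \<le> y" "0 \<le> z" "0 \<le> w" for x y z w
    using that by (simp add: ennreal_mult)
  have "(\<integral>\<^sup>+\<omega>. ?Y \<omega> \<partial>M) = (\<integral>\<^sup>+\<omega>. ennreal (real l) * (\<Sum>k. indicator {\<omega> \<in> space M. overload \<theta> T k \<omega>} \<omega>) \<partial>M)"
  proof (rule nn_integral_cong)
    fix \<omega> assume \<omega>: "\<omega> \<in> space M"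
    have "finite {k. epoch P k \<omega> \<le> T}" by (rule finite_epochs[OF epochs_diverge[OF \<omega>]])
    then have fin: "finite {k. overload \<theta> T k \<omega>}" by (rule finite_subset[rotated]) (auto simp: overload_def)
    have "(\<Sum>k. indicator {\<omega> \<in> space M. overload \<theta> T k \<omega>} \<omega> :: ennreal) = (\<Sum>k\<in>{k. overload \<theta> T k \<omega>}. indicator {\<omega> \<in> space M. overload \<theta> T k \<omega>} \<omega>)"
      by (rule suminf_finite[OF fin]) simp
    also have "\<dots> = (\<Sum>k\<in>{k. overload \<theta> T k \<omega>}. 1)" using \<omega> by (intro sum.cong) auto
    also have "\<dots> = ennreal (real (card {k. overload \<theta> T k \<omega>}))" by (simp add: ennreal_of_nat_eq_real_of_nat)
    finally show "?Y \<omega> = ennreal (real l) * (\<Sum>k. indicator {\<omega> \<in> space M. overload \<theta> T k \<omega>} \<omega>)"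
      by (simp add: bad_arrivals_overload ennreal_mult)
  qed
  also have "\<dots> = ennreal (real l) * (\<Sum>k. emeasure M {\<omega> \<in> space M. overload \<theta> T k \<omega>})"
    by (simp add: nn_integral_cmult nn_integral_suminf)
  also have "\<dots> \<le> ennreal (real l) * (\<Sum>k. ennreal ?C * (\<integral>\<^sup>+\<omega>. indicator {..T} (epoch P k \<omega>) \<partial>M))"
    by (intro mult_left_mono suminf_le overload_prob[OF \<delta> enough]) auto
  also have "\<dots> = ennreal (real l) * (ennreal ?C * (ennreal batch_rate * half_line_integral (indicator {..T})))"
    using campbell_first[of "indicator {..T}"] by simp
  also have "half_line_integral (indicator {..T}) = ennreal T"
  proof -
    have "half_line_integral (indicator {..T}) = (\<integral>\<^sup>+x. indicator {0..T} x \<partial>lborel)"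
      unfolding half_line_integral_def by (intro nn_integral_cong) (auto split: split_indicator)
    then show ?thesis using T by simp
  qed
  also have "ennreal (real l) * (ennreal ?C * (ennreal batch_rate * ennreal T)) = ennreal (real l * (?C * (batch_rate * T)))"
    by (rule prod4) (use T batch_rate_pos in auto)
  also have "real l * (?C * (batch_rate * T)) = (1 + \<delta>)\<^sup>2 / \<delta>\<^sup>2 * batch_rate * T" using lpos by simp
  finally have E: "(\<integral>\<^sup>+\<omega>. ?Y \<omega> \<partial>M) \<le> ennreal ((1 + \<delta>)\<^sup>2 / \<delta>\<^sup>2 * batch_rate * T)" .
  have sets: "{\<omega> \<in> space M. a \<le> real (bad_arrivals b N l P \<theta> T \<omega>)} \<in> sets M" by measurable
  have "ennreal a * emeasure M {\<omega> \<in> space M. a \<le> real (bad_arrivals b N l P \<theta> T \<omega>)} =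
      (\<integral>\<^sup>+\<omega>. ennreal a * indicator {\<omega> \<in> space M. a \<le> real (bad_arrivals b N l P \<theta> T \<omega>)} \<omega> \<partial>M)"
    using sets by (simp add: nn_integral_cmult_indicator)
  also have "\<dots> \<le> (\<integral>\<^sup>+\<omega>. ?Y \<omega> \<partial>M)"
    by (intro nn_integral_mono) (auto simp: indicator_def intro: ennreal_leI)
  also note E
  finally have "ennreal (a * prob {\<omega> \<in> space M. a \<le> real (bad_arrivals b N l P \<theta> T \<omega>)}) \<le> ennreal ((1 + \<delta>)\<^sup>2 / \<delta>\<^sup>2 * batch_rate * T)"
    using a by (simp add: emeasure_eq_measure ennreal_mult)
  then have "a * prob {\<omega> \<in> space M. a \<le> real (bad_arrivals b N l P \<theta> T \<omega>)} \<le> (1 + \<delta>)\<^sup>2 / \<delta>\<^sup>2 * batch_rate * T"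
    using T batch_rate_pos by (subst (asm) ennreal_le_iff) auto
  then show ?thesis using a by (subst pos_le_divide_eq) (auto simp: mult.commute)
qed

end

section \<open>Uniform closeness to the fluid limit\<close>

lemma limit_lipschitz:
  fixes lam q :: real
  assumes "0 \<le> q" "q \<le> lam" "lam \<le> 1" "0 \<le> s" "s \<le> t"
  defines "x \<equiv> \<lambda>t. lam + (q - lam) * exp (- t)"
  shows "\<bar>x t - x s\<bar> \<le> t - s" and "0 \<le> x t" and "x t \<le> lam"
proof -
  have "1 + (- (t - s)) \<le> exp (- (t - s))" by (rule exp_ge_add_one_self)
  then have "1 - exp (- (t - s)) \<le> t - s" by linarith
  then have "exp (- s) * (1 - exp (- (t - s))) \<le> 1 * (t - s)"
    using assms(4,5) by (intro mult_mono) simp_all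
  moreover have "exp (- s) * (1 - exp (- (t - s))) = exp (- s) - exp (- t)"
    by (simp add: right_diff_distrib exp_add[symmetric])
  ultimately have e: "exp (- s) - exp (- t) \<le> t - s" by simp
  have e0: "0 \<le> exp (- s) - exp (- t)" using assms by simp
  have "x t - x s = (lam - q) * (exp (- s) - exp (- t))" by (simp add: x_def algebra_simps)
  moreover have "(lam - q) * (exp (- s) - exp (- t)) \<le> 1 * (t - s)"
    using assms e e0 by (intro mult_mono) auto
  moreover have "0 \<le> (lam - q) * (exp (- s) - exp (- t))" using assms e0 by (intro mult_nonneg_nonneg) auto
  ultimately show "\<bar>x t - x s\<bar> \<le> t - s" by simp
  have "(lam - q) * exp (- t) \<le> (lam - q) * 1" using assms by (intro mult_left_mono) auto
  then show "0 \<le> x t" using assms by (simp add: x_def algebra_simps)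
  have "0 \<le> (lam - q) * exp (- t)" using assms by (intro mult_nonneg_nonneg) auto
  then show "x t \<le> lam" by (simp add: x_def algebra_simps)
qed

text \<open>
  Closeness of the infinite-server queue at finitely many grid points extends to the whole
  interval (\<open>present_arrived\<close>), keeps the number of busy servers below \<open>\<theta>\<close> and so lets
  \<open>coupling_bound\<close> transfer it to the occupancy process.
\<close>

lemma uniform_closeness:
  fixes lam q \<delta> T :: real
  assumes reg: "regular N d P \<omega>" and l: "l \<le> d" and b: "1 \<le> b" and N: "0 < N"
    and q: "0 \<le> q" "q \<le> lam" "lam \<le> 1" and \<delta>: "0 < \<delta>" and n: "T / \<delta> + 1 \<le> real n"
  defines "x \<equiv> \<lambda>t. lam + (q - lam) * exp (- t)" and "\<theta> \<equiv> (lam + 7 * \<delta>) * real N"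
  assumes present: "\<And>i. i \<le> n \<Longrightarrow> \<bar>real (present N l P (real i * \<delta>) \<omega>) / real N - x (real i * \<delta>)\<bar> \<le> \<delta>"
    and arrived: "\<And>i. i \<le> n \<Longrightarrow> \<bar>real (arrived l P (real i * \<delta>) \<omega>) / real N - lam * (real i * \<delta>)\<bar> \<le> \<delta>"
    and excess: "real (initial_excess N P \<omega>) / real N \<le> \<delta>"
    and bad: "real (bad_arrivals b N l P \<theta> T \<omega>) / real N \<le> \<delta>"
    and t: "0 \<le> t" "t \<le> T"
  shows "l1_dist b (occupancy b N l P \<omega> t) (\<lambda>i. if i = 1 then x t else 0) \<le> 9 * \<delta>"
proof -
  let ?X = "\<lambda>t. real (present N l P t \<omega>) / real N" and ?A = "\<lambda>t. real (arrived l P t \<omega>) / real N"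
  let ?B = "initial_excess N P \<omega> + bad_arrivals b N l P \<theta> T \<omega>"
  have fin: "finite {k. epoch P k \<omega> \<le> s}" for s using finite_epochs reg by (auto simp: regular_def)
  have XA: "?X s' + ?A s \<le> ?X s + ?A s'" if "s \<le> s'" for s s'
    using present_arrived[OF fin that, of N l] N
    by (simp add: add_divide_distrib[symmetric] divide_right_mono of_nat_add[symmetric] del: of_nat_add)
  have A: "?A s \<le> ?A s'" if "s \<le> s'" for s s'
    using arrived_mono[OF fin that, of l] by (simp add: divide_right_mono)
  have close: "\<bar>?X s - x s\<bar> \<le> 5 * \<delta>" if s: "0 \<le> s" "s \<le> T" for s
  proof -
    \<comment> \<open>The grid has width \<open>\<delta>\<close>, and \<open>s\<close> lies between the points with indices \<open>i\<close> and \<open>Suc i\<close>.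
      The five multiples of \<open>\<delta>\<close> are: one for the population at a grid point, two for the
      arrivals at both of them, one for the arrivals in between, and one for the change of the
      limit.\<close>
    define i where "i = nat \<lfloor>s / \<delta>\<rfloor>"
    have i: "real i \<le> s / \<delta>" "s / \<delta> \<le> real i + 1" using s \<delta> unfolding i_def by simp_all
    have "s / \<delta> \<le> T / \<delta>" using s \<delta> by (simp add: divide_right_mono)
    then have "real i + 1 \<le> real n" using i n by linarith
    then have ni: "i \<le> n" "Suc i \<le> n" by linarith+
    let ?s = "real i * \<delta>" and ?s' = "real (Suc i) * \<delta>"
    have ss: "?s \<le> s" "s \<le> ?s'" "0 \<le> ?s" "?s' = ?s + \<delta>" using i \<delta> by (auto simp: field_simps)
    have lam\<delta>: "lam * ?s' - lam * ?s \<le> \<delta>"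
    proof -
      have "lam * ?s' - lam * ?s = lam * \<delta>" by (simp add: algebra_simps)
      also have "\<dots> \<le> 1 * \<delta>" using q \<delta> by (intro mult_right_mono) auto
      finally show ?thesis by simp
    qed
    have xs: "\<bar>x s - x ?s\<bar> \<le> s - ?s" "\<bar>x ?s' - x s\<bar> \<le> ?s' - s"
      using limit_lipschitz(1)[OF q, of ?s s] limit_lipschitz(1)[OF q, of s ?s'] ss s unfolding x_def by auto
    note bounds = present[OF ni(1)] present[OF ni(2)] arrived[OF ni(1)] arrived[OF ni(2)]
      XA[OF ss(1)] XA[OF ss(2)] A[OF ss(1)] A[OF ss(2)]
    have "?X s \<le> x s + 5 * \<delta>" using bounds lam\<delta> xs ss by linarith
    moreover have "x s - 5 * \<delta> \<le> ?X s" using bounds lam\<delta> xs ss by linarith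
    ultimately show ?thesis by linarith
  qed
  have B: "real ?B / real N \<le> 2 * \<delta>" using excess bad by (simp add: add_divide_distrib)
  \<comment> \<open>Seven multiples of \<open>\<delta>\<close> suffice as a margin: five for the infinite-server queue and two for
    the coupling error.\<close>
  have small: "real (present N l P s \<omega>) + real ?B \<le> \<theta>" if s: "0 \<le> s" "s \<le> T" for s
  proof -
    have "?X s + real ?B / real N \<le> lam + 7 * \<delta>"
      using close[OF s] B limit_lipschitz(3)[OF q s(1) order_refl] unfolding x_def by linarith
    then have "(real (present N l P s \<omega>) + real ?B) / real N \<le> lam + 7 * \<delta>"
      by (simp only: add_divide_distrib)
    then show ?thesis using N by (simp add: \<theta>_def pos_divide_le_eq)
  qed
  let ?L = "ledger_at b l P (card {k. epoch P k \<omega> \<le> t}) \<omega>"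
  have cpl: "busy N ?L t \<le> present N l P t \<omega> + ?B \<and> present N l P t \<omega> \<le> busy N ?L t + ?B \<and> excess N ?L t \<le> ?B"
    by (rule coupling_bound[OF reg l b small t])
  have q: "queue_length b l P \<omega> t n = pending ?L t n" for n by (simp add: queue_length_def)
  have "l1_dist b (occupancy b N l P \<omega> t) (\<lambda>i. if i = 1 then x t else 0) \<le>
      \<bar>real (busy N ?L t) / real N - x t\<bar> + real (excess N ?L t) / real N"
    using l1_dist_profile_le[OF b N, of "queue_length b l P \<omega> t" "x t"]
    unfolding occupancy_eq_profile[OF t(1)] busy_def excess_def q .
  moreover have "real (busy N ?L t) / real N \<le> ?X t + real ?B / real N"
    "?X t \<le> real (busy N ?L t) / real N + real ?B / real N" "real (excess N ?L t) / real N \<le> real ?B / real N"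
    using cpl N by (simp_all only: add_divide_distrib[symmetric] of_nat_add[symmetric] divide_right_mono of_nat_le_iff of_nat_0_le_iff)
  ultimately show ?thesis using close[OF t] B by linarith
qed

context batch_jsq_system
begin

lemma N_pos: "0 < N" using batch_bounds by simp

lemma real_present: "real (present N l P t \<omega>) = real (initial_present N P t \<omega>) + mark_count {(x, s). x \<le> t \<and> t < x + s} t \<omega>"
proof -
  have "real (batch_present l P t k \<omega>) = (\<Sum>j<l. indicator {(x, s). x \<le> t \<and> t < x + s} (epoch P k \<omega>, svc P k j \<omega>))"
    if "epoch P k \<omega> \<le> t" for k
    unfolding batch_present_def card_eq_sum_of_bool of_nat_sum using that
    by (intro sum.cong) (auto simp: indicator_def)
  then show ?thesis unfolding present_def mark_count_def by simp
qed

lemma real_arrived: "real (arrived l P t \<omega>) = mark_count {(x, s). x \<le> t} t \<omega>"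
  unfolding arrived_def mark_count_def by (simp add: indicator_def)

lemma measurable_mark_sets:
  "{(x, s). x \<le> t \<and> t < x + s} \<in> sets (borel \<Otimes>\<^sub>M borel :: (real \<times> real) measure)"
  "{(x, s). x \<le> t} \<in> sets (borel \<Otimes>\<^sub>M borel :: (real \<times> real) measure)"
proof -
  have "{z \<in> space (borel \<Otimes>\<^sub>M borel :: (real \<times> real) measure). fst z \<le> t \<and> t < fst z + snd z} \<in> sets (borel \<Otimes>\<^sub>M borel)"
    "{z \<in> space (borel \<Otimes>\<^sub>M borel :: (real \<times> real) measure). fst z \<le> t} \<in> sets (borel \<Otimes>\<^sub>M borel)" by measurable
  moreover have "{(x, s). x \<le> t \<and> t < x + s} = {z \<in> space (borel \<Otimes>\<^sub>M borel :: (real \<times> real) measure). fst z \<le> t \<and> t < fst z + snd z}"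
    "{(x, s). x \<le> t} = {z \<in> space (borel \<Otimes>\<^sub>M borel :: (real \<times> real) measure). fst z \<le> t}"
    by (auto simp: space_pair_measure)
  ultimately show "{(x, s). x \<le> t \<and> t < x + s} \<in> sets (borel \<Otimes>\<^sub>M borel :: (real \<times> real) measure)"
    "{(x, s). x \<le> t} \<in> sets (borel \<Otimes>\<^sub>M borel :: (real \<times> real) measure)"
    by simp_all
qed

lemma queue_length_0:
  assumes reg: "regular N d P \<omega>" and n: "n < N"
  shows "queue_length b l P \<omega> 0 n = init P \<omega> ! n"
proof -
  have "{k. epoch P k \<omega> \<le> 0} = {}" using regular_epoch_pos[OF reg] by (auto simp: not_le)
  moreover have "0 < (\<Sum>i\<le>j. svc0 P n i \<omega>)" for j using reg by (intro sum_pos) (auto simp: regular_def)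
  moreover have "length (init P \<omega>) = N" using reg by (simp add: regular_def)
  ultimately show ?thesis using n by (simp add: queue_length_def pending_def)
qed

lemma occupancy_0:
  assumes "regular N d P \<omega>"
  shows "occupancy b N l P \<omega> 0 = profile b N (\<lambda>n. init P \<omega> ! n)"
  unfolding occupancy_eq_profile[OF order_refl] by (rule profile_cong) (rule queue_length_0[OF assms])

lemma occupancy_0_rv: "(\<lambda>\<omega>. occupancy b N l P \<omega> 0 i) \<in> borel_measurable M"
proof -
  have Z: "(\<lambda>\<omega>. map (queue_length b l P \<omega> 0) [0..<N]) \<in> M \<rightarrow>\<^sub>M count_space UNIV"
    using measurable_count_space_map[of "[0..<N]" "\<lambda>n \<omega>. queue_length b l P \<omega> 0 n" M] queue_length_rv by simp
  show ?thesis unfolding occupancy_eq_profile_list[OF order_refl]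
    by (rule measurable_compose[OF Z]) simp
qed

end

lemma sum_profile_tail:
  fixes q :: "nat \<Rightarrow> nat"
  assumes "finite S" "S \<subseteq> {2..}" "S \<subseteq> levels b" "\<And>n. n < N \<Longrightarrow> {2..q n} \<subseteq> S"
  shows "(\<Sum>i\<in>S. profile b N q i) = real (\<Sum>n<N. q n - 1) / real N"
proof -
  have "(\<Sum>i\<in>S. profile b N q i) = (\<Sum>i\<in>S. real (card {n. n < N \<and> i \<le> q n}) / real N)"
    using assms(3) by (intro sum.cong) (auto simp: profile_def)
  also have "\<dots> = real (\<Sum>i\<in>S. card {n. n < N \<and> i \<le> q n}) / real N" by (simp add: sum_divide_distrib)
  also have "(\<Sum>i\<in>S. card {n. n < N \<and> i \<le> q n}) = (\<Sum>n<N. q n - 1)"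
    by (rule sum_tail_counts_le(2)[OF assms(1,2,4)])
  finally show ?thesis .
qed

context batch_jsq_system
begin

lemma initial_present_rv: "(\<lambda>\<omega>. real (initial_present N P t \<omega>)) \<in> borel_measurable M"
proof -
  note svc0_rv[measurable]
  have [measurable]: "Measurable.pred M (\<lambda>\<omega>. 1 \<le> init P \<omega> ! n)" for n
    by (rule measurable_compose[OF init_rv]) simp
  have "initial_present N P t \<in> M \<rightarrow>\<^sub>M count_space UNIV"
    unfolding initial_present_def[abs_def] by (rule measurable_card) measurable
  then show ?thesis by (rule measurable_compose) simp
qed

lemma initial_busy_rv: "(\<lambda>\<omega>. real (initial_busy N P \<omega>)) \<in> borel_measurable M"
  unfolding initial_busy_def by (rule measurable_compose[OF init_rv]) simp

lemma initial_excess_rv: "(\<lambda>\<omega>. real (initial_excess N P \<omega>)) \<in> borel_measurable M"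
  unfolding initial_excess_def by (rule measurable_compose[OF init_rv]) simp

lemma bad_arrivals_real_rv: "(\<lambda>\<omega>. real (bad_arrivals b N l P \<theta> T \<omega>)) \<in> borel_measurable M"
  by (rule measurable_compose[OF bad_arrivals_rv]) simp

lemma occupancy_0_1:
  assumes "regular N d P \<omega>" "1 \<le> b"
  shows "occupancy b N l P \<omega> 0 1 = real (initial_busy N P \<omega>) / real N"
  using assms by (simp add: occupancy_0 profile_def initial_busy_def levels_def one_enat_def)

text \<open>
  For unbounded buffers the total of the levels \<open>i \<ge> 2\<close> has to vanish, which does not follow
  from the convergence of the single levels.
\<close>

lemma initial_excess_tail_infinite:
  assumes b: "b = \<infinity>"
  shows "prob {\<omega> \<in> space M. \<delta> < real (initial_excess N P \<omega>) / real N} \<le>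
    prob {\<omega> \<in> space M. \<bar>(\<Sum>\<^sub>\<infinity>i\<in>{2..}. occupancy b N l P \<omega> 0 i) - 0\<bar> > \<delta>}"
proof (rule finite_measure_mono_AE)
  have total: "(\<Sum>\<^sub>\<infinity>i\<in>{2..}. occupancy b N l P \<omega> 0 i) = real (initial_excess N P \<omega>) / real N" if "regular N d P \<omega>" for \<omega>
  proof -
    let ?q = "\<lambda>n. init P \<omega> ! n"
    let ?S = "{2..Suc (Suc (\<Sum>n<N. ?q n))}"
    have "(\<Sum>\<^sub>\<infinity>i\<in>{2..}. profile b N ?q i) = (\<Sum>\<^sub>\<infinity>i\<in>?S. profile b N ?q i)"
      by (rule infsum_cong_neutral) (auto intro!: profile_zero)
    also have "\<dots> = (\<Sum>i\<in>?S. profile b N ?q i)" by (rule infsum_finite) simp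
    also have "\<dots> = real (\<Sum>n<N. ?q n - 1) / real N"
    proof (rule sum_profile_tail)
      show "?S \<subseteq> levels b" using b by (auto simp: levels_def)
      fix n assume "n < N"
      then have "?q n \<le> (\<Sum>n<N. ?q n)" by (intro member_le_sum) auto
      then show "{2..?q n} \<subseteq> ?S" by auto
    qed auto
    finally show ?thesis unfolding occupancy_0[OF that] initial_excess_def .
  qed
  show "AE \<omega> in M. \<omega> \<in> {\<omega> \<in> space M. \<delta> < real (initial_excess N P \<omega>) / real N} \<longrightarrow>
      \<omega> \<in> {\<omega> \<in> space M. \<bar>(\<Sum>\<^sub>\<infinity>i\<in>{2..}. occupancy b N l P \<omega> 0 i) - 0\<bar> > \<delta>}"
    using AE_regular by eventually_elim (simp add: total)
  have Z: "(\<lambda>\<omega>. map (queue_length b l P \<omega> 0) [0..<N]) \<in> M \<rightarrow>\<^sub>M count_space UNIV"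
    using measurable_count_space_map[of "[0..<N]" "\<lambda>n \<omega>. queue_length b l P \<omega> 0 n" M] queue_length_rv by simp
  have [measurable]: "(\<lambda>\<omega>. \<Sum>\<^sub>\<infinity>i\<in>{2..}. occupancy b N l P \<omega> 0 i) \<in> borel_measurable M"
    unfolding occupancy_eq_profile_list[OF order_refl] by (rule measurable_compose[OF Z]) simp
  show "{\<omega> \<in> space M. \<bar>(\<Sum>\<^sub>\<infinity>i\<in>{2..}. occupancy b N l P \<omega> 0 i) - 0\<bar> > \<delta>} \<in> events" by measurable
qed

text \<open>For finite buffers there are only finitely many levels, and the total is large only if one of them is.\<close>

lemma initial_excess_tail_finite:
  assumes b: "b = enat B" "1 \<le> b" and \<delta>: "0 < \<delta>"
  shows "prob {\<omega> \<in> space M. \<delta> < real (initial_excess N P \<omega>) / real N} \<le>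
    (\<Sum>i\<in>{2..B}. prob {\<omega> \<in> space M. \<bar>occupancy b N l P \<omega> 0 i - 0\<bar> > \<delta> / real B})"
proof -
  let ?E = "\<lambda>i. {\<omega> \<in> space M. \<bar>occupancy b N l P \<omega> 0 i - 0\<bar> > \<delta> / real B}"
  note occupancy_0_rv[measurable]
  have B: "0 < real B" using b by (simp add: one_enat_def)
  have E: "?E i \<in> events" for i by measurable
  have "prob {\<omega> \<in> space M. \<delta> < real (initial_excess N P \<omega>) / real N} \<le> prob (\<Union>i\<in>{2..B}. ?E i)"
  proof (rule finite_measure_mono_AE)
    from AE_regular AE_space show "AE \<omega> in M. \<omega> \<in> {\<omega> \<in> space M. \<delta> < real (initial_excess N P \<omega>) / real N} \<longrightarrow> \<omega> \<in> (\<Union>i\<in>{2..B}. ?E i)"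
    proof eventually_elim
      case (elim \<omega>)
      let ?q = "\<lambda>n. init P \<omega> ! n"
      have le: "?q n \<le> B" if "n < N" for n
        using init_valid[OF elim(2)] that b by auto
      have sum: "(\<Sum>i\<in>{2..B}. occupancy b N l P \<omega> 0 i) = real (initial_excess N P \<omega>) / real N"
        unfolding occupancy_0[OF elim(1)] initial_excess_def
        by (rule sum_profile_tail) (use b le in \<open>auto simp: levels_def\<close>)
      show ?case
      proof (intro impI)
        assume A: "\<omega> \<in> {\<omega> \<in> space M. \<delta> < real (initial_excess N P \<omega>) / real N}"
        show "\<omega> \<in> (\<Union>i\<in>{2..B}. ?E i)"
        proof (rule ccontr)
          assume "\<omega> \<notin> (\<Union>i\<in>{2..B}. ?E i)"
          then have "occupancy b N l P \<omega> 0 i \<le> \<delta> / real B" if "i \<in> {2..B}" for i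
            using that elim(2) by force
          then have "(\<Sum>i\<in>{2..B}. occupancy b N l P \<omega> 0 i) \<le> (\<Sum>i\<in>{2..B}. \<delta> / real B)" by (rule sum_mono)
          moreover have "\<dots> \<le> \<delta>"
          proof -
            have "(\<Sum>i\<in>{2..B}. \<delta> / real B) = real (card {2..B}) * (\<delta> / real B)" by simp
            also have "\<dots> \<le> real B * (\<delta> / real B)" using \<delta> by (intro mult_right_mono) auto
            finally show ?thesis using B by simp
          qed
          ultimately show False using A unfolding sum by simp
        qed
      qed
    qed
    show "(\<Union>i\<in>{2..B}. ?E i) \<in> events" using E by (intro sets.finite_UN) auto
  qed
  also have "\<dots> \<le> (\<Sum>i\<in>{2..B}. prob (?E i))"
    by (rule finite_measure_subadditive_finite) (use E in auto)
  finally show ?thesis .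
qed

text \<open>
  All estimates for one system: outside an event \<open>U\<close> of small probability the occupancy
  process stays close to the fluid limit. The event collects the deviations at the grid
  points, deviating initial data, and too many bad arrivals.
\<close>

lemma occupancy_close_to_limit:
  fixes lam q \<delta> \<delta>' T :: real
  assumes b: "1 \<le> b" and q: "0 \<le> q" "q \<le> lam" "lam \<le> 1" and \<delta>: "0 < \<delta>" and n: "T / \<delta> + 1 \<le> real n"
    and T: "0 \<le> T" and \<delta>': "0 < \<delta>'"
    and enough: "(1 + \<delta>') * real l \<le> real d * (real N - (lam + 7 * \<delta>) * real N) / real N"
    and rate: "\<bar>r / real N - lam\<bar> * (real n * \<delta> + 1) \<le> \<delta> / 4"
  shows "\<exists>U\<in>events. prob U \<le> real (Suc n) * (16 / (\<delta>\<^sup>2 * real N) + 16 * real l * r / (\<delta> * real N)\<^sup>2 +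
        4 * real l * r * (real n * \<delta>) / (\<delta> * real N)\<^sup>2)
      + prob {\<omega> \<in> space M. \<bar>occupancy b N l P \<omega> 0 1 - q\<bar> > \<delta> / 4}
      + prob {\<omega> \<in> space M. \<delta> < real (initial_excess N P \<omega>) / real N}
      + (1 + \<delta>')\<^sup>2 / \<delta>'\<^sup>2 * batch_rate * T / (\<delta> * real N)
    \<and> (AE \<omega> in M. \<omega> \<notin> U \<longrightarrow> (\<forall>t\<in>{0..T}. l1_dist b (occupancy b N l P \<omega> t)
        (\<lambda>i. if i = 1 then lam + (q - lam) * exp (- t) else 0) \<le> 9 * \<delta>))"
    (is "\<exists>U\<in>events. prob U \<le> ?bound \<and> (AE \<omega> in M. \<omega> \<notin> U \<longrightarrow> ?close \<omega>)")
proof -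
  let ?g = "16 / (\<delta>\<^sup>2 * real N) + 16 * real l * r / (\<delta> * real N)\<^sup>2 +
        4 * real l * r * (real n * \<delta>) / (\<delta> * real N)\<^sup>2"
  have N: "0 < real N" using N_pos by simp
  let ?S1 = "\<lambda>t. {(x, s). x \<le> t \<and> t < x + s}" and ?S2 = "\<lambda>t. {(x, s :: real). x \<le> t}" and ?t = "\<lambda>i. real i * \<delta>"
  define U1 where "U1 i = {\<omega> \<in> space M. \<delta> / 4 * real N \<le> \<bar>real (initial_present N P (?t i) \<omega>) - exp (- ?t i) * real (initial_busy N P \<omega>)\<bar>}" for i
  define U2 where "U2 i = {\<omega> \<in> space M. \<delta> / 4 * real N \<le> \<bar>mark_count (?S1 (?t i)) (?t i) \<omega> - r * (1 - exp (- ?t i))\<bar>}" for i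
  define U3 where "U3 i = {\<omega> \<in> space M. \<delta> / 2 * real N \<le> \<bar>mark_count (?S2 (?t i)) (?t i) \<omega> - r * ?t i\<bar>}" for i
  define U4 where "U4 = {\<omega> \<in> space M. \<bar>occupancy b N l P \<omega> 0 1 - q\<bar> > \<delta> / 4}"
  define U5 where "U5 = {\<omega> \<in> space M. \<delta> < real (initial_excess N P \<omega>) / real N}"
  define U6 where "U6 = {\<omega> \<in> space M. \<delta> * real N \<le> real (bad_arrivals b N l P ((lam + 7 * \<delta>) * real N) T \<omega>)}"
  define V where "V = (\<Union>i\<in>{..n}. U1 i \<union> U2 i \<union> U3 i)"
  have sub: "?S1 t \<subseteq> {..t} \<times> UNIV" "?S2 t \<subseteq> {..t} \<times> UNIV" for t by auto
  note [measurable] = initial_present_rv initial_busy_rv initial_excess_rv bad_arrivals_real_rv occupancy_0_rv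
    mark_count_rv[OF measurable_mark_sets(1) sub(1)] mark_count_rv[OF measurable_mark_sets(2) sub(2)]
  have ev: "U1 i \<in> events" "U2 i \<in> events" "U3 i \<in> events" "U4 \<in> events" "U5 \<in> events" "U6 \<in> events" for i
    unfolding U1_def U2_def U3_def U4_def U5_def U6_def by measurable
  then have Vev: "V \<in> events" unfolding V_def by (intro sets.finite_UN) auto
  have t0: "0 \<le> ?t i" for i using \<delta> by simp
  have p1: "prob (U1 i) \<le> 16 / (\<delta>\<^sup>2 * real N)" for i
  proof -
    have "prob (U1 i) \<le> real N / (\<delta> / 4 * real N)\<^sup>2"
      unfolding U1_def by (rule initial_deviation[OF t0]) (use \<delta> N in simp)
    also have "\<dots> = 16 / (\<delta>\<^sup>2 * real N)" using N \<delta> by (simp add: power2_eq_square field_simps)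
    finally show ?thesis .
  qed
  have p2: "prob (U2 i) \<le> 16 * real l * r / (\<delta> * real N)\<^sup>2" for i
  proof -
    have "prob (U2 i) \<le> real l * r * (1 - exp (- ?t i)) / (\<delta> / 4 * real N)\<^sup>2"
      unfolding U2_def
      by (rule mark_count_deviation[OF measurable_mark_sets(1) sub(1) half_line_integral_present[OF t0]]) (use \<delta> N in simp_all)
    also have "\<dots> \<le> real l * r * 1 / (\<delta> / 4 * real N)\<^sup>2"
      using rate_pos by (intro divide_right_mono mult_left_mono) auto
    also have "\<dots> = 16 * real l * r / (\<delta> * real N)\<^sup>2" by (simp add: power_mult_distrib power_divide)
    finally show ?thesis .
  qed
  have p3: "prob (U3 i) \<le> 4 * real l * r * (real n * \<delta>) / (\<delta> * real N)\<^sup>2" if "i \<le> n" for i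
  proof -
    have "prob (U3 i) \<le> real l * r * ?t i / (\<delta> / 2 * real N)\<^sup>2"
      unfolding U3_def
      by (rule mark_count_deviation[OF measurable_mark_sets(2) sub(2) half_line_integral_arrived[OF t0] t0]) (use \<delta> N in simp)
    also have "\<dots> \<le> real l * r * (real n * \<delta>) / (\<delta> / 2 * real N)\<^sup>2"
      using rate_pos that \<delta> by (intro divide_right_mono mult_left_mono mult_right_mono) auto
    also have "\<dots> = 4 * real l * r * (real n * \<delta>) / (\<delta> * real N)\<^sup>2" by (simp add: power_mult_distrib power_divide)
    finally show ?thesis .
  qed
  have "prob V \<le> (\<Sum>i\<in>{..n}. prob (U1 i \<union> U2 i \<union> U3 i))"
    unfolding V_def by (rule finite_measure_subadditive_finite) (use ev in auto)
  also have "\<dots> \<le> (\<Sum>i\<in>{..n}. ?g)"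
  proof (rule sum_mono)
    fix i assume "i \<in> {..n}"
    then have i: "i \<le> n" by simp
    have "prob (U1 i \<union> U2 i \<union> U3 i) \<le> prob (U1 i \<union> U2 i) + prob (U3 i)"
      by (rule measure_Un_le) (use ev in auto)
    moreover have "prob (U1 i \<union> U2 i) \<le> prob (U1 i) + prob (U2 i)"
      by (rule measure_Un_le) (use ev in auto)
    ultimately show "prob (U1 i \<union> U2 i \<union> U3 i) \<le> ?g"
      using p1[of i] p2[of i] p3[OF i] by linarith
  qed
  also have "\<dots> = real (Suc n) * (?g)" by simp
  finally have pV: "prob V \<le> real (Suc n) * (?g)" .
  have p6: "prob U6 \<le> (1 + \<delta>')\<^sup>2 / \<delta>'\<^sup>2 * batch_rate * T / (\<delta> * real N)"
    unfolding U6_def by (rule bad_arrivals_tail[OF \<delta>' enough T]) (use \<delta> N in simp)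
  let ?U = "V \<union> U4 \<union> U5 \<union> U6"
  have "prob ?U \<le> prob (V \<union> U4 \<union> U5) + prob U6"
    by (rule measure_Un_le) (use ev Vev in auto)
  moreover have "prob (V \<union> U4 \<union> U5) \<le> prob (V \<union> U4) + prob U5"
    by (rule measure_Un_le) (use ev Vev in auto)
  moreover have "prob (V \<union> U4) \<le> prob V + prob U4"
    by (rule measure_Un_le) (use ev Vev in auto)
  ultimately have pU: "prob ?U \<le> real (Suc n) * (?g) + prob U4 + prob U5 +
        (1 + \<delta>')\<^sup>2 / \<delta>'\<^sup>2 * batch_rate * T / (\<delta> * real N)"
    using pV p6 by linarith
  have close: "?close \<omega>"
    if \<omega>: "regular N d P \<omega>" "\<omega> \<in> space M" "\<omega> \<notin> ?U" for \<omega>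
  proof
    fix t assume t: "t \<in> {0..T}"
    have n0: "0 \<le> real n * \<delta>" using \<delta> by simp
    have "\<bar>r / real N - lam\<bar> * 1 \<le> \<bar>r / real N - lam\<bar> * (real n * \<delta> + 1)"
      using n0 by (intro mult_left_mono) auto
    from order_trans[OF this rate] have rate1: "\<bar>r / real N - lam\<bar> \<le> \<delta> / 4" by simp
    have "\<bar>r / real N - lam\<bar> * (real n * \<delta>) \<le> \<bar>r / real N - lam\<bar> * (real n * \<delta> + 1)"
      by (intro mult_left_mono) auto
    then have rate2: "\<bar>r / real N - lam\<bar> * (real n * \<delta>) \<le> \<delta> / 4" using rate by (rule order_trans)
    have Q: "\<bar>real (initial_busy N P \<omega>) / real N - q\<bar> \<le> \<delta> / 4"
      using \<omega> unfolding U4_def occupancy_0_1[OF \<omega>(1) b, symmetric] by auto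
    show "l1_dist b (occupancy b N l P \<omega> t) (\<lambda>i. if i = 1 then lam + (q - lam) * exp (- t) else 0) \<le> 9 * \<delta>"
    proof (rule uniform_closeness[OF \<omega>(1) batch_bounds(2) b N_pos q \<delta> n])
      show "0 \<le> t" "t \<le> T" using t by auto
      show "real (initial_excess N P \<omega>) / real N \<le> \<delta>" using \<omega> unfolding U5_def by auto
      have "real (bad_arrivals b N l P ((lam + 7 * \<delta>) * real N) T \<omega>) \<le> \<delta> * real N" using \<omega> unfolding U6_def by auto
      then show "real (bad_arrivals b N l P ((lam + 7 * \<delta>) * real N) T \<omega>) / real N \<le> \<delta>"
        using N by (simp add: pos_divide_le_eq)
      fix i assume i: "i \<le> n"
      then have notU: "\<omega> \<notin> U1 i" "\<omega> \<notin> U2 i" "\<omega> \<notin> U3 i" using \<omega>(3) unfolding V_def by auto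
      let ?p = "exp (- ?t i)"
      have p: "0 < ?p" "?p \<le> 1" using t0[of i] by auto
      have div: "\<bar>y / real N - z / real N\<bar> \<le> c" if "\<bar>y - z\<bar> < c * real N" for y z c
      proof -
        have "\<bar>y / real N - z / real N\<bar> = \<bar>y - z\<bar> / real N" using N by (simp add: diff_divide_distrib[symmetric] abs_divide)
        also have "\<dots> \<le> c" using that N by (subst pos_divide_le_eq) auto
        finally show ?thesis .
      qed
      have 1: "\<bar>real (initial_present N P (?t i) \<omega>) / real N - ?p * real (initial_busy N P \<omega>) / real N\<bar> \<le> \<delta> / 4"
        using notU(1) \<omega>(2) unfolding U1_def by (intro div) auto
      have 2: "\<bar>mark_count (?S1 (?t i)) (?t i) \<omega> / real N - r * (1 - ?p) / real N\<bar> \<le> \<delta> / 4"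
        using notU(2) \<omega>(2) unfolding U2_def by (intro div) auto
      have 3: "\<bar>mark_count (?S2 (?t i)) (?t i) \<omega> / real N - r * ?t i / real N\<bar> \<le> \<delta> / 2"
        using notU(3) \<omega>(2) unfolding U3_def by (intro div) auto
      have 4: "\<bar>?p * real (initial_busy N P \<omega>) / real N - ?p * q\<bar> \<le> \<delta> / 4"
      proof -
        have "\<bar>?p * real (initial_busy N P \<omega>) / real N - ?p * q\<bar> = ?p * \<bar>real (initial_busy N P \<omega>) / real N - q\<bar>"
          using p by (simp add: abs_mult right_diff_distrib[symmetric] flip: times_divide_eq_right)
        also have "\<dots> \<le> 1 * (\<delta> / 4)" using p Q t0[of i] by (intro mult_mono) auto
        finally show ?thesis by simp
      qed
      have 5: "\<bar>r * (1 - ?p) / real N - lam * (1 - ?p)\<bar> \<le> \<delta> / 4"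
      proof -
        have "r * (1 - ?p) / real N - lam * (1 - ?p) = (r / real N - lam) * (1 - ?p)" by (simp add: left_diff_distrib)
        then have "\<bar>r * (1 - ?p) / real N - lam * (1 - ?p)\<bar> = \<bar>r / real N - lam\<bar> * (1 - ?p)" using p(2) by (simp only: abs_mult abs_of_nonneg diff_ge_0_iff_ge)
        also have "\<dots> \<le> \<delta> / 4 * 1" using p rate1 \<delta> t0[of i] by (intro mult_mono) auto
        finally show ?thesis by simp
      qed
      have 6: "\<bar>r * ?t i / real N - lam * ?t i\<bar> \<le> \<delta> / 4"
      proof -
        have "r * ?t i / real N - lam * ?t i = (r / real N - lam) * ?t i" by (simp add: left_diff_distrib)
        then have "\<bar>r * ?t i / real N - lam * ?t i\<bar> = \<bar>r / real N - lam\<bar> * ?t i" using t0[of i] by (simp only: abs_mult[of _ "?t i"] abs_of_nonneg)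
        also have "\<dots> \<le> \<bar>r / real N - lam\<bar> * (real n * \<delta>)" using i \<delta> by (intro mult_left_mono mult_right_mono) auto
        finally show ?thesis using rate2 by (rule order_trans)
      qed
      have x: "lam + (q - lam) * ?p = ?p * q + lam * (1 - ?p)" by (simp add: algebra_simps)
      show "\<bar>real (present N l P (?t i) \<omega>) / real N - (lam + (q - lam) * ?p)\<bar> \<le> \<delta>"
        unfolding real_present x add_divide_distrib using 1 2 4 5 by linarith
      show "\<bar>real (arrived l P (?t i) \<omega>) / real N - lam * ?t i\<bar> \<le> \<delta>"
      proof -
        have "\<bar>u - w\<bar> \<le> \<delta>" if "\<bar>u - v\<bar> \<le> \<delta> / 2" "\<bar>v - w\<bar> \<le> \<delta> / 4" for u v w
          using that \<delta> by linarith
        from this[OF 3 6] show ?thesis unfolding real_arrived .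
      qed
    qed
  qed
  show ?thesis
  proof (intro bexI[of _ ?U] conjI)
    show "AE \<omega> in M. \<omega> \<notin> ?U \<longrightarrow> ?close \<omega>"
      using AE_regular AE_space by eventually_elim (use close in blast)
    show "prob ?U \<le> ?bound"
      using pU unfolding U4_def U5_def .
    show "?U \<in> events" using ev Vev by auto
  qed
qed

end

section \<open>Weak convergence\<close>

text \<open>
  Convergence in probability to a constant implies convergence of bounded continuous
  functionals, in quantitative form.
\<close>

lemma (in prob_space) expectation_near_constant:
  fixes g :: "'a \<Rightarrow> real"
  assumes g[measurable]: "g \<in> borel_measurable M" and C: "\<And>\<omega>. \<omega> \<in> space M \<Longrightarrow> \<bar>g \<omega>\<bar> \<le> C" "\<bar>c\<bar> \<le> C"
    and U[measurable]: "U \<in> events" and close: "AE \<omega> in M. \<omega> \<notin> U \<longrightarrow> \<bar>g \<omega> - c\<bar> \<le> e" and e: "0 \<le> e"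
  shows "\<bar>expectation g - c\<bar> \<le> e + 2 * C * prob U"
proof -
  have ig: "integrable M g" using C(1) by (intro integrable_const_bound[of _ C]) auto
  have iU: "integrable M (\<lambda>\<omega>. e + 2 * C * indicator U \<omega>)"
    by (intro Bochner_Integration.integrable_add integrable_mult_right integrable_const) (simp add: emeasure_eq_measure)
  have "expectation g - c = expectation (\<lambda>\<omega>. g \<omega> - c)" using ig by (simp add: prob_space)
  also have "\<bar>\<dots>\<bar> \<le> expectation (\<lambda>\<omega>. \<bar>g \<omega> - c\<bar>)" by (rule integral_abs_bound)
  also have "\<dots> \<le> expectation (\<lambda>\<omega>. e + 2 * C * indicator U \<omega>)"
  proof (rule integral_mono_AE)
    show "integrable M (\<lambda>\<omega>. \<bar>g \<omega> - c\<bar>)" using ig by (intro integrable_abs Bochner_Integration.integrable_diff integrable_const)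
    show "AE \<omega> in M. \<bar>g \<omega> - c\<bar> \<le> e + 2 * C * indicator U \<omega>"
      using close AE_space
    proof eventually_elim
      case (elim \<omega>)
      then show ?case using C(1)[of \<omega>] C(2) e by (cases "\<omega> \<in> U") auto
    qed
  qed (rule iU)
  also have "\<dots> = e + 2 * C * prob U"
    by (subst Bochner_Integration.integral_add) (simp_all add: emeasure_eq_measure prob_space)
  finally show ?thesis .
qed

lemma borel_of_continuous_map:
  fixes f :: "'x \<Rightarrow> real"
  assumes "continuous_map T euclideanreal f"
  shows "f \<in> borel_measurable (borel_of T)"
proof (rule borel_measurableI)
  fix S :: "real set" assume "open S"
  have sub: "{U. openin T U} \<subseteq> Pow (topspace T)" by (auto dest: openin_subset)
  have "openin T {x \<in> topspace T. f x \<in> S}"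
    by (rule openin_continuous_map_preimage[OF assms]) (use \<open>open S\<close> in simp)
  moreover have "f -` S \<inter> space (borel_of T) = {x \<in> topspace T. f x \<in> S}"
    unfolding borel_of_def space_measure_of[OF sub] by auto
  ultimately show "f -` S \<inter> space (borel_of T) \<in> sets (borel_of T)"
    unfolding borel_of_def by (simp add: sets_measure_of[OF sub])
qed

lemma space_borel_of: "space (borel_of T) = topspace T"
  unfolding borel_of_def by (rule space_measure_of) (auto dest: openin_subset)

text \<open>The states of the fluid limit, in which no task has to wait.\<close>

definition level_one :: "real \<Rightarrow> nat \<Rightarrow> real" where
  "level_one u = (\<lambda>i. if i = 1 then u else 0)"

lemma level_one_occupancy_space:
  assumes "1 \<le> b" "0 \<le> u" "u \<le> 1"
  shows "level_one u \<in> occupancy_space b"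
proof -
  have one: "1 \<in> levels b" using assms by (simp add: levels_def one_enat_def)
  have "level_one u summable_on levels b \<longleftrightarrow> level_one u summable_on {1}"
    by (rule summable_on_cong_neutral) (use one in \<open>auto simp: level_one_def\<close>)
  then show ?thesis
    using assms one by (auto simp: occupancy_space_def level_one_def summable_on_finite)
qed

lemma l1_dist_level_one:
  assumes "1 \<le> b"
  shows "l1_dist b (level_one u) (level_one v) = \<bar>u - v\<bar>"
proof -
  have one: "1 \<in> levels b" using assms by (simp add: levels_def one_enat_def)
  have "l1_dist b (level_one u) (level_one v) = (\<Sum>\<^sub>\<infinity>i\<in>{1}. \<bar>level_one u i - level_one v i\<bar>)"
    unfolding l1_dist_def by (rule infsum_cong_neutral) (use one in \<open>auto simp: level_one_def\<close>)
  then show ?thesis by (simp add: level_one_def)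
qed

lemma fluid_limit_cadlag:
  assumes b: "1 \<le> b" and q: "0 \<le> q" "q \<le> lam" "lam \<le> 1"
  shows "(\<lambda>t\<in>{0..}. level_one (lam + (q - lam) * exp (- t))) \<in> cadlag_paths (occupancy_metric b)"
proof -
  let ?u = "\<lambda>t. lam + (q - lam) * exp (- t)"
  let ?x = "\<lambda>t\<in>{0..}. level_one (?u t)"
  have mem: "level_one (?u t) \<in> occupancy_space b" if "0 \<le> t" for t
    using limit_lipschitz(2,3)[OF q that order_refl] q by (intro level_one_occupancy_space[OF b]) auto
  have lip: "\<bar>?u s - ?u t\<bar> \<le> \<bar>s - t\<bar>" if "0 \<le> s" "0 \<le> t" for s t
    using limit_lipschitz(1)[OF q, of s t] limit_lipschitz(1)[OF q, of t s] that by (cases "s \<le> t") (auto simp: abs_minus_commute)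
  have lim: "limitin (mtopology_of (occupancy_metric b)) ?x (level_one (?u t)) F"
    if t: "0 \<le> t" and F: "\<And>e. 0 < e \<Longrightarrow> \<forall>\<^sub>F s in F. 0 \<le> s \<and> \<bar>s - t\<bar> < e" for t F
    unfolding mtopology_of_def
  proof (subst Metric_space.limitin_metric[OF Metric_space_mspace_mdist], intro conjI allI impI)
    show "level_one (?u t) \<in> mspace (occupancy_metric b)" using mem[OF t] by simp
    fix e :: real assume "0 < e"
    from F[OF this] show "\<forall>\<^sub>F s in F. ?x s \<in> mspace (occupancy_metric b) \<and>
        mdist (occupancy_metric b) (?x s) (level_one (?u t)) < e"
    proof eventually_elim
      case (elim s)
      then have "l1_dist b (level_one (?u s)) (level_one (?u t)) < e"
        unfolding l1_dist_level_one[OF b] using lip[of s t] t by linarith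
      then show ?case using elim mem[of s] by simp
    qed
  qed
  show ?thesis
    unfolding cadlag_paths_def
  proof (intro CollectI conjI allI impI)
    show "?x \<in> {0..} \<rightarrow>\<^sub>E mspace (occupancy_metric b)" using mem by auto
    fix t :: real
    { assume t: "0 \<le> t"
      have "limitin (mtopology_of (occupancy_metric b)) ?x (level_one (?u t)) (at_right t)"
      proof (rule lim[OF t])
        fix e :: real assume "0 < e"
        then show "\<forall>\<^sub>F s in at_right t. 0 \<le> s \<and> \<bar>s - t\<bar> < e"
          using t by (auto simp: eventually_at_right_field intro!: exI[of _ "t + e"])
      qed
      then show "limitin (mtopology_of (occupancy_metric b)) ?x (?x t) (at_right t)" using t by simp }
    assume t: "0 < t"
    have "limitin (mtopology_of (occupancy_metric b)) ?x (level_one (?u t)) (at_left t)"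
    proof (rule lim)
      fix e :: real assume "0 < e"
      then show "\<forall>\<^sub>F s in at_left t. 0 \<le> s \<and> \<bar>s - t\<bar> < e"
        using t by (auto simp: eventually_at_left_field intro!: exI[of _ "max 0 (t - e)"])
    qed (use t in simp)
    then show "\<exists>l. limitin (mtopology_of (occupancy_metric b)) ?x l (at_left t)" by blast
  qed
qed

text \<open>It shows that \<open>q1inf\<close> is nonnegative, and so is \<open>lam\<close>.\<close>

lemma converges_in_prob_nonneg_limit:
  assumes M: "\<And>N. 1 \<le> N \<Longrightarrow> prob_space (M N)" and Y: "\<And>N \<omega>. 0 \<le> Y N \<omega>" and c: "converges_in_prob M Y c"
  shows "0 \<le> c"
proof (rule ccontr)
  assume "\<not> 0 \<le> c"
  then have "0 < - c / 2" by simp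
  then have lim: "(\<lambda>N. measure (M N) {\<omega> \<in> space (M N). \<bar>Y N \<omega> - c\<bar> > - c / 2}) \<longlonglongrightarrow> 0"
    using c unfolding converges_in_prob_def by blast
  have "measure (M N) {\<omega> \<in> space (M N). \<bar>Y N \<omega> - c\<bar> > - c / 2} = 1" if "1 \<le> N" for N
  proof -
    have "- c / 2 < \<bar>Y N \<omega> - c\<bar>" for \<omega> using Y[of N \<omega>] \<open>\<not> 0 \<le> c\<close> by linarith
    then have "{\<omega> \<in> space (M N). \<bar>Y N \<omega> - c\<bar> > - c / 2} = space (M N)" by auto
    then show ?thesis using prob_space.prob_space[OF M[OF that]] by simp
  qed
  then have "(\<lambda>N. measure (M N) {\<omega> \<in> space (M N). \<bar>Y N \<omega> - c\<bar> > - c / 2}) \<longlonglongrightarrow> 1"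
    by (intro tendsto_eventually) (auto simp: eventually_sequentially intro!: exI[of _ 1])
  from LIMSEQ_unique[OF lim this] show False by simp
qed

theorem theorem2p3:
  fixes M :: "nat \<Rightarrow> 'a measure" and P :: "nat \<Rightarrow> 'a primitives"
    and b :: enat and rate :: "nat \<Rightarrow> real" and l d :: "nat \<Rightarrow> nat"
    and lam eps q1inf :: real
  assumes "1 \<le> b"
    and "\<And>N. 1 \<le> N \<Longrightarrow> batch_jsq_system (M N) (P N) N b (rate N) (l N) (d N)"
    and "filterlim l at_top sequentially"
    and "(\<lambda>N. rate N / real N) \<longlonglongrightarrow> lam" and "lam < 1"
    and "0 < eps" and "lam + eps < 1"
    and "\<forall>\<^sub>F N in sequentially. real (d N) \<ge> real (l N) / (1 - lam - eps)"
    and "converges_in_prob M (\<lambda>N \<omega>. occupancy b N (l N) (P N) \<omega> 0 1) q1inf" and "q1inf \<le> lam"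
    and "\<And>i. i \<in> levels b \<Longrightarrow> 2 \<le> i \<Longrightarrow> converges_in_prob M (\<lambda>N \<omega>. occupancy b N (l N) (P N) \<omega> 0 i) 0"
    and "lam > 0 \<Longrightarrow> (\<lambda>N. real (l N) / real N) \<longlonglongrightarrow> 0"
    and "b = \<infinity> \<Longrightarrow> converges_in_prob M (\<lambda>N \<omega>. \<Sum>\<^sub>\<infinity>i\<in>{2..}. occupancy b N (l N) (P N) \<omega> 0 i) 0"
  shows "converges_in_law (J1_topology (occupancy_metric b)) M (\<lambda>N. occupancy b N (l N) (P N))
           (return (borel_of (J1_topology (occupancy_metric b)))
             (\<lambda>t\<in>{0..}. \<lambda>i. if i = 1 then lam + (q1inf - lam) * exp (- t) else 0))"
proof -
  let ?T = "J1_topology (occupancy_metric b)" and ?X = "\<lambda>N. occupancy b N (l N) (P N)"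
  let ?u = "\<lambda>t. lam + (q1inf - lam) * exp (- t)"
  let ?x = "\<lambda>t\<in>{0..}. \<lambda>i. if i = 1 then ?u t else (0 :: real)"
  let ?close = "\<lambda>T e N \<omega>. \<forall>t\<in>{0..T}. l1_dist b (?X N \<omega> t) (\<lambda>i. if i = 1 then ?u t else 0) < e"
  note b = assms(1) and sys = assms(2)
  have ps: "prob_space (M N)" if "1 \<le> N" for N
    using sys[OF that] by (simp add: batch_jsq_system_def)
  have "0 \<le> q1inf"
    by (rule converges_in_prob_nonneg_limit[OF ps _ assms(9)]) (auto simp: occupancy_def)
  then have q: "0 \<le> q1inf" "q1inf \<le> lam" "lam \<le> 1" using assms by auto
  have x: "?x \<in> cadlag_paths (occupancy_metric b)"
    using fluid_limit_cadlag[OF b q] unfolding level_one_def .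
  \<comment> \<open>For finite buffers this is a finite sum of levels that tend to 0 one by one; for unbounded
    ones the last hypothesis is about the sum itself.\<close>
  have excess: "(\<lambda>N. measure (M N) {\<omega> \<in> space (M N). \<delta> < real (initial_excess N (P N) \<omega>) / real N}) \<longlonglongrightarrow> 0"
    if \<delta>: "0 < \<delta>" for \<delta>
  proof (cases b)
    case (enat B)
    have B: "0 < real B" using b enat by (simp add: one_enat_def)
    show ?thesis
    proof (rule tendsto_sandwich[OF _ _ tendsto_const])
      show "(\<lambda>N. \<Sum>i\<in>{2..B}. measure (M N) {\<omega> \<in> space (M N). \<bar>?X N \<omega> 0 i - 0\<bar> > \<delta> / real B}) \<longlonglongrightarrow> 0"
      proof (rule tendsto_null_sum)
        fix i assume "i \<in> {2..B}"
        then have "i \<in> levels b" "2 \<le> i" using enat by (auto simp: levels_def)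
        note conv = assms(11)[OF this, unfolded converges_in_prob_def, rule_format]
        show "(\<lambda>N. measure (M N) {\<omega> \<in> space (M N). \<bar>?X N \<omega> 0 i - 0\<bar> > \<delta> / real B}) \<longlonglongrightarrow> 0"
          by (rule conv) (use \<delta> B in simp)
      qed
      show "\<forall>\<^sub>F N in sequentially. measure (M N) {\<omega> \<in> space (M N). \<delta> < real (initial_excess N (P N) \<omega>) / real N} \<le>
          (\<Sum>i\<in>{2..B}. measure (M N) {\<omega> \<in> space (M N). \<bar>?X N \<omega> 0 i - 0\<bar> > \<delta> / real B})"
        using eventually_ge_at_top[of 1]
      proof eventually_elim
        case (elim N)
        show ?case by (rule batch_jsq_system.initial_excess_tail_finite[OF sys[OF elim] enat b \<delta>])
      qed
    qed simp
  next
    case infinity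
    show ?thesis
    proof (rule tendsto_sandwich[OF _ _ tendsto_const])
      show "(\<lambda>N. measure (M N) {\<omega> \<in> space (M N). \<bar>(\<Sum>\<^sub>\<infinity>i\<in>{2..}. ?X N \<omega> 0 i) - 0\<bar> > \<delta>}) \<longlonglongrightarrow> 0"
        by (rule assms(13)[OF infinity, unfolded converges_in_prob_def, rule_format, OF \<delta>])
      show "\<forall>\<^sub>F N in sequentially. measure (M N) {\<omega> \<in> space (M N). \<delta> < real (initial_excess N (P N) \<omega>) / real N} \<le>
          measure (M N) {\<omega> \<in> space (M N). \<bar>(\<Sum>\<^sub>\<infinity>i\<in>{2..}. ?X N \<omega> 0 i) - 0\<bar> > \<delta>}"
        using eventually_ge_at_top[of 1]
      proof eventually_elim
        case (elim N)
        show ?case by (rule batch_jsq_system.initial_excess_tail_infinite[OF sys[OF elim] infinity])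
      qed
    qed simp
  qed
  \<comment> \<open>Either the batches are small compared to \<open>N\<close>, or the arrival rate is.\<close>
  have lr: "(\<lambda>N. real (l N) / real N * (rate N / real N)) \<longlonglongrightarrow> 0"
  proof (cases "0 < lam")
    case True
    from tendsto_mult[OF assms(12)[OF this] assms(4)] show ?thesis by simp
  next
    case False
    then have "lam = 0" using q by simp
    then have r0: "(\<lambda>N. rate N / real N) \<longlonglongrightarrow> 0" using assms(4) by simp
    show ?thesis
    proof (rule Lim_null_comparison[OF _ r0])
      show "\<forall>\<^sub>F N in sequentially. norm (real (l N) / real N * (rate N / real N)) \<le> rate N / real N"
        using eventually_ge_at_top[of 1]
      proof eventually_elim
        case (elim N)
        interpret S: batch_jsq_system "M N" "P N" N b "rate N" "l N" "d N" by (rule sys[OF elim])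
        have "real (l N) / real N \<le> 1" using S.batch_bounds by (simp add: divide_le_eq_1)
        moreover have "0 \<le> rate N / real N" using S.rate_pos by simp
        ultimately have "real (l N) / real N * (rate N / real N) \<le> 1 * (rate N / real N)" by (rule mult_right_mono)
        moreover have "0 \<le> real (l N) / real N * (rate N / real N)"
          using \<open>0 \<le> rate N / real N\<close> by (intro mult_nonneg_nonneg) auto
        ultimately show ?case by (simp only: real_norm_def abs_of_nonneg mult_1_left)
      qed
    qed
  qed
  have inv_l: "(\<lambda>N. 1 / real (l N)) \<longlonglongrightarrow> 0"
    using tendsto_inverse_0_at_top[OF filterlim_compose[OF filterlim_real_sequentially assms(3)]]
    by (simp add: inverse_eq_divide)
  have rare: "\<exists>p. p \<longlonglongrightarrow> 0 \<and> (\<forall>\<^sub>F N in sequentially. \<exists>U\<in>sets (M N). measure (M N) U \<le> p N \<and>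
      (AE \<omega> in M N. \<omega> \<notin> U \<longrightarrow> ?close T e N \<omega>))"
    if T: "0 \<le> T" and e: "0 < e" for T e
  proof -
    \<comment> \<open>The error \<open>9 * \<delta>\<close> must stay below \<open>e\<close>, and \<open>7 * \<delta>\<close> at most \<open>eps / 2\<close>, so that half of the
      margin \<open>eps\<close> is left for the samples.\<close>
    define \<delta> where "\<delta> = min (e / 10) (eps / 14)"
    have \<delta>: "0 < \<delta>" "9 * \<delta> < e" "14 * \<delta> \<le> eps" using e assms(6) by (auto simp: \<delta>_def min_def)
    define n where "n = nat \<lceil>T / \<delta>\<rceil> + 1"
    have n: "T / \<delta> + 1 \<le> real n" unfolding n_def by simp linarith
    \<comment> \<open>The relative surplus of idle servers in a sample of size at least \<open>l / (1 - lam - eps)\<close>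
      when at least a fraction \<open>1 - lam - eps / 2\<close> of all servers is idle.\<close>
    define \<delta>' where "\<delta>' = eps / 2 / (1 - lam - eps)"
    have \<delta>': "0 < \<delta>'" using assms(6,7) by (simp add: \<delta>'_def)
    define p where "p N = real (Suc n) * (16 / (\<delta>\<^sup>2 * real N) + 16 * real (l N) * rate N / (\<delta> * real N)\<^sup>2 +
          4 * real (l N) * rate N * (real n * \<delta>) / (\<delta> * real N)\<^sup>2)
        + measure (M N) {\<omega> \<in> space (M N). \<bar>?X N \<omega> 0 1 - q1inf\<bar> > \<delta> / 4}
        + measure (M N) {\<omega> \<in> space (M N). \<delta> < real (initial_excess N (P N) \<omega>) / real N}
        + (1 + \<delta>')\<^sup>2 / \<delta>'\<^sup>2 * (rate N / real (l N)) * T / (\<delta> * real N)" for N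
    have "p \<longlonglongrightarrow> real (Suc n) * (0 + 0 + 0) + 0 + 0 + 0"
      unfolding p_def
    proof (intro tendsto_add tendsto_mult_left)
      show "(\<lambda>N. 16 / (\<delta>\<^sup>2 * real N)) \<longlonglongrightarrow> 0"
        using tendsto_mult_right_zero[OF lim_1_over_n, of "16 / \<delta>\<^sup>2"] by simp
      have "(\<lambda>N. 16 / \<delta>\<^sup>2 * (real (l N) / real N * (rate N / real N))) \<longlonglongrightarrow> 0"
        by (rule tendsto_mult_right_zero[OF lr])
      then show "(\<lambda>N. 16 * real (l N) * rate N / (\<delta> * real N)\<^sup>2) \<longlonglongrightarrow> 0"
        by (simp add: power2_eq_square ac_simps)
      have "(\<lambda>N. 4 * (real n * \<delta>) / \<delta>\<^sup>2 * (real (l N) / real N * (rate N / real N))) \<longlonglongrightarrow> 0"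
        by (rule tendsto_mult_right_zero[OF lr])
      then show "(\<lambda>N. 4 * real (l N) * rate N * (real n * \<delta>) / (\<delta> * real N)\<^sup>2) \<longlonglongrightarrow> 0"
        using \<delta>(1) by (simp add: power2_eq_square ac_simps)
      show "(\<lambda>N. measure (M N) {\<omega> \<in> space (M N). \<bar>?X N \<omega> 0 1 - q1inf\<bar> > \<delta> / 4}) \<longlonglongrightarrow> 0"
        by (rule assms(9)[unfolded converges_in_prob_def, rule_format]) (use \<delta>(1) in simp)
      show "(\<lambda>N. measure (M N) {\<omega> \<in> space (M N). \<delta> < real (initial_excess N (P N) \<omega>) / real N}) \<longlonglongrightarrow> 0"
        by (rule excess[OF \<delta>(1)])
      have "(\<lambda>N. (1 + \<delta>')\<^sup>2 / \<delta>'\<^sup>2 * T / \<delta> * (1 / real (l N) * (rate N / real N))) \<longlonglongrightarrow> (1 + \<delta>')\<^sup>2 / \<delta>'\<^sup>2 * T / \<delta> * (0 * lam)"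
        by (intro tendsto_mult_left tendsto_mult inv_l assms(4))
      then show "(\<lambda>N. (1 + \<delta>')\<^sup>2 / \<delta>'\<^sup>2 * (rate N / real (l N)) * T / (\<delta> * real N)) \<longlonglongrightarrow> 0"
        by (simp add: ac_simps)
    qed
    then have p0: "p \<longlonglongrightarrow> 0" by simp
    have "(\<lambda>N. \<bar>rate N / real N - lam\<bar> * (real n * \<delta> + 1)) \<longlonglongrightarrow> \<bar>lam - lam\<bar> * (real n * \<delta> + 1)"
      by (intro tendsto_intros assms(4))
    then have "\<forall>\<^sub>F N in sequentially. \<bar>rate N / real N - lam\<bar> * (real n * \<delta> + 1) < \<delta> / 4"
      using \<delta>(1) by (intro order_tendstoD(2)) auto
    then have "\<forall>\<^sub>F N in sequentially. \<exists>U\<in>sets (M N). measure (M N) U \<le> p N \<and>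
      (AE \<omega> in M N. \<omega> \<notin> U \<longrightarrow> ?close T e N \<omega>)"
      using assms(8) eventually_ge_at_top[of 1]
    proof eventually_elim
      case (elim N)
      interpret S: batch_jsq_system "M N" "P N" N b "rate N" "l N" "d N" by (rule sys[OF elim(3)])
      have N: "0 < real N" using elim by simp
      have gap: "0 < 1 - lam - eps" using assms(7) by simp
      have "(1 + \<delta>') * real (l N) = real (l N) / (1 - lam - eps) * (1 - lam - eps / 2)"
        using gap by (simp add: \<delta>'_def field_simps)
      also have "\<dots> \<le> real (d N) * (1 - (lam + 7 * \<delta>))"
        using elim(2) \<delta>(3) gap assms(6) by (intro mult_mono) auto
      also have "\<dots> = real (d N) * (real N - (lam + 7 * \<delta>) * real N) / real N"
        using N by (simp add: field_simps)
      finally have enough: "(1 + \<delta>') * real (l N) \<le> real (d N) * (real N - (lam + 7 * \<delta>) * real N) / real N" .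
      from S.occupancy_close_to_limit[OF b q \<delta>(1) n T \<delta>' enough less_imp_le[OF elim(1)]]
      obtain U where U: "U \<in> sets (M N)" "measure (M N) U \<le> p N" and
        close: "AE \<omega> in M N. \<omega> \<notin> U \<longrightarrow> (\<forall>t\<in>{0..T}. l1_dist b (?X N \<omega> t) (\<lambda>i. if i = 1 then ?u t else 0) \<le> 9 * \<delta>)"
        unfolding p_def S.batch_rate_def by blast
      from close have "AE \<omega> in M N. \<omega> \<notin> U \<longrightarrow> ?close T e N \<omega>"
        by eventually_elim (use \<delta>(2) in force)
      with U show ?case by blast
    qed
    with p0 show ?thesis by blast
  qed
  have weak: "(\<lambda>N. \<integral>y. f y \<partial>distr (M N) (borel_of ?T) (?X N)) \<longlonglongrightarrow> (\<integral>y. f y \<partial>return (borel_of ?T) ?x)"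
    if f: "continuous_map ?T euclideanreal f" and bdd: "bounded (f ` topspace ?T)" for f
  proof -
    have fm: "f \<in> borel_measurable (borel_of ?T)" by (rule borel_of_continuous_map[OF f])
    have lim: "(\<integral>y. f y \<partial>return (borel_of ?T) ?x) = f ?x"
      by (rule integral_return) (use x fm in \<open>simp_all add: space_borel_of\<close>)
    obtain C where C: "\<And>y. y \<in> cadlag_paths (occupancy_metric b) \<Longrightarrow> \<bar>f y\<bar> \<le> C"
      using bdd unfolding bounded_iff by auto
    have "0 \<le> C" using C[OF x] by linarith
    show ?thesis
      unfolding lim
    proof (rule LIMSEQ_I)
      fix \<epsilon> :: real assume \<epsilon>: "0 < \<epsilon>"
      define G where "G = {y \<in> topspace ?T. f y \<in> ball (f ?x) (\<epsilon> / 2)}"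
      have "openin ?T G" unfolding G_def by (rule openin_continuous_map_preimage[OF f]) simp
      moreover have "?x \<in> G" using x \<epsilon> by (simp add: G_def)
      ultimately obtain T e where T: "0 < T" and e: "0 < e" and ball: "J1_ball (occupancy_metric b) ?x T e \<subseteq> G"
        unfolding openin_J1_topology by blast
      obtain p where p0: "p \<longlonglongrightarrow> 0" and U: "\<forall>\<^sub>F N in sequentially. \<exists>U\<in>sets (M N). measure (M N) U \<le> p N \<and>
        (AE \<omega> in M N. \<omega> \<notin> U \<longrightarrow> ?close T e N \<omega>)"
        using rare[OF less_imp_le[OF T] e] by blast
      have "(\<lambda>N. 2 * C * p N) \<longlonglongrightarrow> 0" by (rule tendsto_mult_right_zero[OF p0])
      then have "\<forall>\<^sub>F N in sequentially. 2 * C * p N < \<epsilon> / 2" using \<epsilon> by (intro order_tendstoD(2)) auto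
      then have "\<forall>\<^sub>F N in sequentially. norm ((\<integral>y. f y \<partial>distr (M N) (borel_of ?T) (?X N)) - f ?x) < \<epsilon>"
        using U eventually_ge_at_top[of 1]
      proof eventually_elim
        case (elim N)
        interpret S: batch_jsq_system "M N" "P N" N b "rate N" "l N" "d N" by (rule sys[OF elim(3)])
        have cad: "?X N \<omega> \<in> cadlag_paths (occupancy_metric b)" if "\<omega> \<in> space (M N)" for \<omega>
          by (rule occupancy_cadlag[OF S.epochs_diverge[OF that]])
        obtain V where V: "V \<in> sets (M N)" "measure (M N) V \<le> p N"
          "AE \<omega> in M N. \<omega> \<notin> V \<longrightarrow> ?close T e N \<omega>"
          using elim(2) by blast
        \<comment> \<open>As the limit is continuous, closeness is uniform in time, and the identity serves as
          time change.\<close>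
        have id: "(\<lambda>t. t) \<in> time_changes" by (simp add: time_changes_def strict_mono_on_def)
        have "AE \<omega> in M N. \<omega> \<notin> V \<longrightarrow> \<bar>f (?X N \<omega>) - f ?x\<bar> \<le> \<epsilon> / 2"
          using V(3) AE_space
        proof eventually_elim
          case (elim \<omega>)
          show ?case
          proof
            assume "\<omega> \<notin> V"
            then have "\<forall>t\<in>{0..T}. \<bar>t - t\<bar> < e \<and> mdist (occupancy_metric b) (?X N \<omega> t) (?x t) < e"
              using elim(1) e by simp
            then have "?X N \<omega> \<in> J1_ball (occupancy_metric b) ?x T e"
              unfolding J1_ball_def using cad[OF elim(2)] id
              by (intro CollectI conjI bexI[of _ "\<lambda>t. t"]) auto
            then have "f (?X N \<omega>) \<in> ball (f ?x) (\<epsilon> / 2)" using ball by (auto simp: G_def)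
            then show "\<bar>f (?X N \<omega>) - f ?x\<bar> \<le> \<epsilon> / 2" by (simp add: dist_real_def abs_minus_commute)
          qed
        qed
        then have "\<bar>S.expectation (\<lambda>\<omega>. f (?X N \<omega>)) - f ?x\<bar> \<le> \<epsilon> / 2 + 2 * C * measure (M N) V"
          by (intro S.expectation_near_constant measurable_compose[OF S.occupancy_rv fm] V(1) C[OF cad] C[OF x])
            (use \<epsilon> in auto)
        also have "\<dots> \<le> \<epsilon> / 2 + 2 * C * p N"
          using V(2) \<open>0 \<le> C\<close> by (intro add_left_mono mult_left_mono) auto
        also have "\<dots> < \<epsilon>" using elim(1) by simp
        finally show ?case by (simp add: integral_distr[OF S.occupancy_rv fm])
      qed
      then show "\<exists>N0. \<forall>N\<ge>N0. norm ((\<integral>y. f y \<partial>distr (M N) (borel_of ?T) (?X N)) - f ?x) < \<epsilon>"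
        by (simp add: eventually_sequentially)
    qed
  qed
  show ?thesis
    unfolding converges_in_law_def weakly_converges_def
  proof (intro conjI allI impI)
    show "?X N \<in> M N \<rightarrow>\<^sub>M borel_of ?T" if "1 \<le> N" for N
      by (rule batch_jsq_system.occupancy_rv[OF sys[OF that]])
    show "prob_space (return (borel_of ?T) ?x)"
      by (rule prob_space_return) (use x in \<open>simp add: space_borel_of\<close>)
    show "sets (return (borel_of ?T) ?x) = sets (borel_of ?T)" by simp
  qed (use weak in blast)
qed

end
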